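(* Let $K\subset\mathbb R^2\subset\mathbb R^3$ be a planar curve: a smooth compact curve bounding a compact region $\Omega\subset\mathbb R^2$, oriented as $K=\partial\Omega$. Then the planar and the spatial definitions of the energy of $K$ coincide: $$\lim_{\varepsilon\to0}\left(\frac{2L(K)}{\varepsilon}-\int_{(\Omega\times\Omega^c)\setminus\Delta_\varepsilon}\frac{d^2w\,d^2z}{|z-w|^4}\right)=\lim_{\varepsilon\to0}\left(\frac{3\pi L(K)}{8\varepsilon}-\frac{3}{16\pi}\int_{\mathcal S_\varepsilon(1,3)}\lambda(\gamma,K)^2\,d\gamma\right).$$
   Context: $L(K)$ is the length of $K$; $\Omega^c=\mathbb R^2\setminus\Omega$; $d^2w,d^2z$ denote the area element of $\mathbb R^2$; $\Delta_\varepsilon=\{(w,z)\in\mathbb R^2\times\mathbb R^2: |z-w|\le\varepsilon\}$. $\mathcal S_\varepsilon(1,3)$ is the set of oriented circles $\gamma\subset\mathbb R^3$ of radius $r>\varepsilon$; with $c\in\mathbb R^3$ the center, $r$ the radius, and $n\in\mathbb S^2$ the unit normal to the plane of $\gamma$ (determined by the orientation), $d\gamma=\frac{1}{r^4}\,dr\,dc\,dn$. $\lambda(\gamma,K)$ is the linking number of $\gamma$ and $K$. *)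

theory Defs
  imports "HOL-Analysis.Analysis"
begin

definition smooth :: "(real \<Rightarrow> 'a::real_normed_vector) \<Rightarrow> bool" where
  "smooth f \<longleftrightarrow>
     (\<exists>D. D 0 = f \<and> (\<forall>k t. (D k has_vector_derivative D (Suc k) t) (at t)))"

text \<open>
  A smooth compact planar curve is a finite disjoint union of smoothly embedded circles
  \<open>K 0, \<dots>, K (m - 1)\<close>, each given by a regular 1-periodic parametrization.
\<close>

definition smooth_compact_curve :: "nat \<Rightarrow> (nat \<Rightarrow> real \<Rightarrow> real^2) \<Rightarrow> bool" where
  "smooth_compact_curve m K \<longleftrightarrow>
     (\<forall>i<m. smooth (K i) \<and> (\<forall>t. K i (t + 1) = K i t)
            \<and> (\<forall>t. vector_derivative (K i) (at t) \<noteq> 0))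
     \<and> inj_on (\<lambda>(i, t). K i t) ({..<m} \<times> {0..<1})"

definition curve_image :: "nat \<Rightarrow> (nat \<Rightarrow> real \<Rightarrow> 'a) \<Rightarrow> 'a set" where
  "curve_image m K = (\<Union>i<m. range (K i))"

definition curve_length :: "nat \<Rightarrow> (nat \<Rightarrow> real \<Rightarrow> 'a::real_normed_vector) \<Rightarrow> real" where
  "curve_length m K = (\<Sum>i<m. integral {0..1} (\<lambda>t. norm (vector_derivative (K i) (at t))))"

definition rot90 :: "real^2 \<Rightarrow> real^2" where
  "rot90 v = vector [- v$2, v$1]"

text \<open>
  \<open>K = \<partial>\<Omega>\<close> as oriented curves: \<open>K\<close> is the topological boundary of the compact set \<open>\<Omega>\<close>, and
  at each of its points \<open>\<Omega>\<close> lies to the left of \<open>K\<close> and the complement to the right. The latter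
  also excludes sets such as \<open>\<Omega> = K\<close>, so that \<open>\<Omega>\<close> is a smooth domain with boundary \<open>K\<close>.
\<close>

definition bounds_region :: "nat \<Rightarrow> (nat \<Rightarrow> real \<Rightarrow> real^2) \<Rightarrow> (real^2) set \<Rightarrow> bool" where
  "bounds_region m K \<Omega> \<longleftrightarrow>
     compact \<Omega> \<and> frontier \<Omega> = curve_image m K
     \<and> (\<forall>i<m. \<forall>t. \<forall>\<^sub>F s in at_right 0.
            K i t + s *\<^sub>R rot90 (vector_derivative (K i) (at t)) \<in> \<Omega>
          \<and> K i t - s *\<^sub>R rot90 (vector_derivative (K i) (at t)) \<notin> \<Omega>)"

definition embed_plane :: "real^2 \<Rightarrow> real^3" where
  "embed_plane x = vector [x$1, x$2, 0]"

text \<open>Gauss' linking integral of two disjoint 1-periodic closed space curves.\<close>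

definition linking_number :: "(real \<Rightarrow> real^3) \<Rightarrow> (real \<Rightarrow> real^3) \<Rightarrow> real" where
  "linking_number a b =
     1 / (4 * pi) * integral ({0..1} \<times> {0..1})
       (\<lambda>(s, t). (a s - b t) \<bullet> cross3 (vector_derivative a (at s)) (vector_derivative b (at t))
                  / norm (a s - b t) ^ 3)"

text \<open>
  An oriented circle is encoded as the triple \<open>(r, c, n)\<close> of its radius, center and unit normal.
  Its parametrization needs an orthonormal frame \<open>(u, v)\<close> of the plane orthogonal to \<open>n\<close> with
  \<open>u \<times> v = n\<close>; any other such frame only shifts the parameter.
\<close>

type_synonym oriented_circle = "real \<times> (real^3) \<times> (real^3)"

definition frame1 :: "real^3 \<Rightarrow> real^3" where
  "frame1 n = (if cross3 n (axis 3 1) = 0 then axis 1 1 else sgn (cross3 n (axis 3 1)))"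

definition frame2 :: "real^3 \<Rightarrow> real^3" where
  "frame2 n = cross3 n (frame1 n)"

fun circle_param :: "oriented_circle \<Rightarrow> real \<Rightarrow> real^3" where
  "circle_param (r, c, n) t =
     c + (r * cos (2 * pi * t)) *\<^sub>R frame1 n + (r * sin (2 * pi * t)) *\<^sub>R frame2 n"

text \<open>
  The linking number is undefined for the circles meeting the curve. These form a null set for
  the measure below; they are given the value \<open>0\<close>, which keeps the function measurable.
\<close>

definition circle_linking ::
    "oriented_circle \<Rightarrow> nat \<Rightarrow> (nat \<Rightarrow> real \<Rightarrow> real^3) \<Rightarrow> real" where
  "circle_linking \<gamma> m K =
     (if range (circle_param \<gamma>) \<inter> curve_image m K \<noteq> {} then 0
      else (\<Sum>i<m. linking_number (circle_param \<gamma>) (K i)))"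

definition circles_gt :: "real \<Rightarrow> oriented_circle set" where
  "circles_gt \<epsilon> = {(r, c, n). r > \<epsilon> \<and> n \<in> sphere 0 1}"

text \<open>The area measure \<open>dn = sin \<phi> d\<phi> d\<theta>\<close> of the unit sphere, in spherical coordinates.\<close>

definition sphere_chart :: "real \<times> real \<Rightarrow> real^3" where
  "sphere_chart = (\<lambda>(\<phi>, \<theta>). vector [sin \<phi> * cos \<theta>, sin \<phi> * sin \<theta>, cos \<phi>])"

definition sphere_measure :: "(real^3) measure" where
  "sphere_measure =
     distr (density lborel (\<lambda>(\<phi>, \<theta>). ennreal (indicator ({0..pi} \<times> {0..2*pi}) (\<phi>, \<theta>) * sin \<phi>)))
           borel sphere_chart"

text \<open>\<open>d\<gamma> = r\<^sup>-\<^sup>4 dr dc dn\<close>; only its restriction to radii \<open>r > 0\<close> is used.\<close>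

definition circle_measure :: "oriented_circle measure" where
  "circle_measure =
     density (lborel \<Otimes>\<^sub>M lborel \<Otimes>\<^sub>M sphere_measure) (\<lambda>(r, c, n). ennreal (1 / r ^ 4))"

definition Delta :: "real \<Rightarrow> ((real^2) \<times> (real^2)) set" where
  "Delta \<epsilon> = {(w, z). norm (z - w) \<le> \<epsilon>}"

end

theory Submission
  imports Defs "HOL-Real_Asymp.Real_Asymp"
begin

text \<open>
  Let \<open>F(v)\<close> be the area of the set of \<open>w \<in> \<Omega>\<close> with \<open>w + v \<notin> \<Omega>\<close>. With \<open>z = w + v\<close> the planar integral
  with cut-off \<open>\<epsilon>\<close> is \<open>P(\<epsilon>) = \<integral>\<^bsub>|v| > \<epsilon>\<^esub> F(v) |v|\<^sup>-\<^sup>4 dv\<close>. If exactly one of \<open>x\<close> and \<open>x + v\<close>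
  lies in \<open>\<Omega>\<close>, the segment between them crosses \<open>K\<close>, and the crossings, counted with multiplicity, have
  total measure \<open>\<integral>|v \<times> K'| ds\<close>. Hence \<open>2 F(v) \<le> \<integral>|v \<times> K'| ds\<close>, and the defect is
  due to the parameters where \<open>|v \<times> K'| = O(|v|\<^sup>2)\<close>, because for small \<open>v\<close> a transversal segment crosses
  only once. As \<open>\<integral>\<^bsub>|v| > \<epsilon>\<^esub> |v \<times> k| |v|\<^sup>-\<^sup>4 dv = 4|k|/\<epsilon>\<close>, the difference \<open>2L/\<epsilon> - P(\<epsilon>)\<close> is the integral of this
  nonnegative defect against \<open>|v|\<^sup>-\<^sup>4\<close>: it increases to a finite limit \<open>E\<close> as \<open>\<epsilon> \<rightarrow> 0\<close>.

  A generic circle meets the plane in at most two points \<open>p\<close>, \<open>q\<close>. By Green's theorem its Gauss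
  integral is the variation of the solid angle of \<open>\<Omega>\<close>, so \<open>\<lambda>\<^sup>2 = 1\<close> if exactly one of \<open>p\<close>, \<open>q\<close> lies in \<open>\<Omega>\<close>, and
  \<open>\<lambda>\<^sup>2 = 0\<close> otherwise. If the normal is tilted by \<open>\<phi>\<close> and the center has height \<open>r t sin \<phi>\<close>, then
  \<open>|p - q| = 2 r \<surd>(1 - t\<^sup>2)\<close>; integrating first over the horizontal translations of the circle gives
  \<open>\<integral>\<lambda>\<^sup>2 d\<gamma> = 4\<pi> \<integral>\<^bsub>-1<t<1\<^esub> (1 - t\<^sup>2) P(2 \<epsilon> \<surd>(1 - t\<^sup>2)) dt\<close>. Inserting \<open>P(\<delta>) = 2L/\<delta> - E(\<delta>)\<close>, the spatial
  energy is an average of values \<open>E(\<delta>)\<close> with \<open>\<delta> \<le> 2\<epsilon>\<close>, and tends to \<open>E\<close> as well.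
\<close>

section \<open>Change of variables in the plane\<close>

text \<open>The region comes without charts: only its compactness, its frontier and the side
  condition along normals are given. The regularity of \<open>K\<close> therefore enters through one
  uniform estimate, \<open>chord\<close>: for curve points within \<open>\<rho>0\<close> of
  \<open>K i s\<close>, the cross product of the chord with the tangent vector is at most
  \<open>C0\<close> times the squared length of the chord. It decides the sides of transversal
  segments, makes \<open>sweep\<close> injective on good parameters and isolates the grazing ones;
  the same sweeping yields Green's theorem.

  The solid angle jumps where a circle meets the plane. The Gauss integral is therefore evaluated
  arc by arc, as a limit from inside each arc.

  The constants of the spatial energy are forced. The weight \<open>4 * pi * (1 - t^2)\<close> is
  the product of \<open>pi / 2\<close>, the integral of \<open>(sin \<phi>)^2\<close>, and
  \<open>2 * \<kappa>^2\<close> with \<open>\<kappa> = 2 * sqrt (1 - t^2)\<close>. Its integral is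
  \<open>16 * pi / 3\<close>, whose inverse is the factor \<open>3 / (16 * pi)\<close>. The term
  \<open>2 L / \<delta>\<close> with \<open>\<delta> = \<kappa> * \<epsilon>\<close> leaves
  \<open>4 * pi * L / \<epsilon>\<close> times the area \<open>pi / 2\<close> of a half disc, which
  this factor turns into \<open>3 * pi * L / (8 * \<epsilon>)\<close>.\<close>

definition cr :: "real^2 \<Rightarrow> real^2 \<Rightarrow> real" where
  "cr a b = a$1 * b$2 - a$2 * b$1"

definition vec2 :: "real \<Rightarrow> real \<Rightarrow> real^2" where
  "vec2 x y = vector [x, y]"

definition vec3 :: "real^2 \<Rightarrow> real \<Rightarrow> real^3" where
  "vec3 x y = vector [x$1, x$2, y]"

lemma vec2_nth [simp]: "vec2 x y $ 1 = x" "vec2 x y $ 2 = y"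
  by (simp_all add: vec2_def)

lemma vec3_nth [simp]: "vec3 x y $ 1 = x$1" "vec3 x y $ 2 = x$2" "vec3 x y $ 3 = y"
  by (simp_all add: vec3_def)

lemma continuous_on_vec2 [continuous_intros]:
  assumes "continuous_on S f" "continuous_on S g"
  shows "continuous_on S (\<lambda>x. vec2 (f x) (g x))"
proof -
  have eq: "vec2 x y = x *\<^sub>R axis 1 1 + y *\<^sub>R axis 2 1" for x y
    by (simp add: vec_eq_iff forall_2 axis_def)
  show ?thesis unfolding eq by (intro continuous_intros assms)
qed

lemma continuous_on_vec3 [continuous_intros]:
  assumes "continuous_on S f" "continuous_on S g"
  shows "continuous_on S (\<lambda>x. vec3 (f x) (g x))"
proof -
  have eq: "vec3 x y = (x$1) *\<^sub>R axis 1 1 + (x$2) *\<^sub>R axis 2 1 + y *\<^sub>R axis 3 1" for x y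
    by (simp add: vec_eq_iff forall_3 axis_def)
  show ?thesis unfolding eq by (intro continuous_intros assms)
qed

lemma measurable_vec2 [measurable]: "case_prod vec2 \<in> borel_measurable borel"
  unfolding case_prod_beta' by (intro borel_measurable_continuous_onI continuous_intros)

lemma measurable_vec3 [measurable]: "case_prod vec3 \<in> borel_measurable borel"
  unfolding case_prod_beta' by (intro borel_measurable_continuous_onI continuous_intros)

lemma prod_Basis_2: "prod f (Basis :: (real^2) set) = f (axis 1 1) * f (axis 2 1)"
proof -
  have "(axis 1 1 :: real^2) \<noteq> axis 2 1" by (simp add: axis_eq_axis)
  moreover have B: "(Basis :: (real^2) set) = {axis 1 1, axis 2 1}"
    by (auto simp: Basis_vec_def UNIV_2)
  ultimately show ?thesis unfolding B by simp
qed

lemma prod_Basis_3: "prod f (Basis :: (real^3) set) = f (axis 1 1) * f (axis 2 1) * f (axis 3 1)"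
proof -
  have "(axis 1 1 :: real^3) \<noteq> axis 2 1" "(axis 1 1 :: real^3) \<noteq> axis 3 1" "(axis 2 1 :: real^3) \<noteq> axis 3 1"
    by (simp_all add: axis_eq_axis)
  moreover have B: "(Basis :: (real^3) set) = {axis 1 1, axis 2 1, axis 3 1}"
    by (auto simp: Basis_vec_def UNIV_3)
  ultimately show ?thesis unfolding B by (simp add: mult.assoc)
qed

text \<open>Lebesgue measure is determined by its values on boxes. This identification brings
  iterated integrals over pairs to \<open>real^2\<close>, where substitutions are governed by the
  determinant.\<close>

lemma distr_vec2: "distr lborel borel (case_prod vec2) = lborel"
proof (rule lborel_eqI[symmetric])
  fix l u :: "real^2"
  assume *: "\<And>b. b \<in> Basis \<Longrightarrow> l \<bullet> b \<le> u \<bullet> b"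
  have le: "l$1 \<le> u$1" "l$2 \<le> u$2"
    using *[of "axis 1 1"] *[of "axis 2 1"] by (auto simp: inner_axis)
  have "case_prod vec2 -` box l u = {l$1<..<u$1} \<times> {l$2<..<u$2}"
    by (auto simp: mem_box_cart forall_2)
  then have "emeasure (distr lborel borel (case_prod vec2)) (box l u)
      = emeasure (lborel \<Otimes>\<^sub>M lborel) ({l$1<..<u$1} \<times> {l$2<..<u$2})"
    by (subst emeasure_distr) (auto simp: lborel_prod)
  also have "\<dots> = ennreal ((u$1-l$1) * (u$2-l$2))"
    using le by (subst lborel.emeasure_pair_measure_Times) (auto simp: ennreal_mult'')
  finally show "emeasure (distr lborel borel (case_prod vec2)) (box l u) = ennreal (\<Prod>b\<in>Basis. (u - l) \<bullet> b)"
    by (simp add: prod_Basis_2 inner_axis)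
qed auto

lemma distr_vec3: "distr lborel borel (case_prod vec3) = lborel"
proof (rule lborel_eqI[symmetric])
  fix l u :: "real^3"
  assume *: "\<And>b. b \<in> Basis \<Longrightarrow> l \<bullet> b \<le> u \<bullet> b"
  have le: "l$1 \<le> u$1" "l$2 \<le> u$2" "l$3 \<le> u$3"
    using *[of "axis 1 1"] *[of "axis 2 1"] *[of "axis 3 1"] by (auto simp: inner_axis)
  let ?B = "box (vec2 (l$1) (l$2)) (vec2 (u$1) (u$2))"
  have "case_prod vec3 -` box l u = ?B \<times> {l$3<..<u$3}"
    by (auto simp: mem_box_cart forall_2 forall_3)
  then have "emeasure (distr lborel borel (case_prod vec3)) (box l u)
      = emeasure (lborel \<Otimes>\<^sub>M lborel) (?B \<times> {l$3<..<u$3})"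
    by (subst emeasure_distr) (auto simp: lborel_prod)
  also have "\<dots> = emeasure lborel ?B * ennreal (u$3-l$3)"
    using le by (subst lborel.emeasure_pair_measure_Times) (auto)
  also have "emeasure lborel ?B = ennreal ((u$1-l$1) * (u$2-l$2))"
    using le by (subst emeasure_lborel_box) (simp_all add: prod_Basis_2 inner_axis, auto simp: Basis_vec_def UNIV_2 inner_axis)
  finally show "emeasure (distr lborel borel (case_prod vec3)) (box l u) = ennreal (\<Prod>b\<in>Basis. (u - l) \<bullet> b)"
    using le by (simp add: prod_Basis_3 inner_axis ennreal_mult'')
qed auto

lemma nn_integral_vec2:
  assumes [measurable]: "F \<in> borel_measurable borel"
  shows "(\<integral>\<^sup>+x. F x \<partial>lborel) = (\<integral>\<^sup>+x. \<integral>\<^sup>+y. F (vec2 x y) \<partial>lborel \<partial>lborel)"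
proof -
  have "(\<integral>\<^sup>+x. F x \<partial>lborel) = (\<integral>\<^sup>+x. F x \<partial>distr lborel borel (case_prod vec2))"
    by (simp add: distr_vec2)
  also have "\<dots> = (\<integral>\<^sup>+p. F (case_prod vec2 p) \<partial>(lborel \<Otimes>\<^sub>M lborel))"
    by (subst nn_integral_distr) (auto simp: lborel_prod)
  also have "\<dots> = (\<integral>\<^sup>+x. \<integral>\<^sup>+y. F (vec2 x y) \<partial>lborel \<partial>lborel)"
    by (subst lborel.nn_integral_fst[symmetric]) (auto simp: lborel_prod)
  finally show ?thesis .
qed

lemma nn_integral_vec3:
  assumes [measurable]: "F \<in> borel_measurable borel"
  shows "(\<integral>\<^sup>+x. F x \<partial>lborel) = (\<integral>\<^sup>+y. \<integral>\<^sup>+x. F (vec3 x y) \<partial>lborel \<partial>lborel)"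
proof -
  have "(\<integral>\<^sup>+x. F x \<partial>lborel) = (\<integral>\<^sup>+x. F x \<partial>distr lborel borel (case_prod vec3))"
    by (simp add: distr_vec3)
  also have "\<dots> = (\<integral>\<^sup>+p. F (case_prod vec3 p) \<partial>(lborel \<Otimes>\<^sub>M lborel))"
    by (subst nn_integral_distr) (auto simp: lborel_prod)
  also have "\<dots> = (\<integral>\<^sup>+y. \<integral>\<^sup>+x. F (vec3 x y) \<partial>lborel \<partial>lborel)"
    by (subst lborel_pair.nn_integral_snd[symmetric]) (auto simp: lborel_prod)
  finally show ?thesis .
qed

lemma nn_integral_lborel_translate:
  fixes F :: "'a::euclidean_space \<Rightarrow> ennreal"
  assumes [measurable]: "F \<in> borel_measurable borel"
  shows "(\<integral>\<^sup>+x. F (a + x) \<partial>lborel) = (\<integral>\<^sup>+x. F x \<partial>lborel)"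
proof -
  have "(\<integral>\<^sup>+x. F x \<partial>lborel) = (\<integral>\<^sup>+x. F x \<partial>distr lborel borel ((+) a))"
    by (simp add: lborel_distr_plus)
  also have "\<dots> = (\<integral>\<^sup>+x. F (a + x) \<partial>lborel)"
    by (subst nn_integral_distr) auto
  finally show ?thesis by simp
qed

text \<open>\<open>has_measure_differentiable_image\<close> relates a finite measure to a gauge
  integral, hence the restriction to bounded \<open>A\<close>; the density is nonnegative, so that
  integral can be read with respect to \<open>lborel\<close>.\<close>

lemma change_of_variables_emeasure:
  fixes g :: "real^'n::{finite,wellorder} \<Rightarrow> real^'n::_"
  assumes S: "open S" and g: "continuous_on UNIV g"
    and der: "\<And>x. x \<in> S \<Longrightarrow> (g has_derivative g' x) (at x)"
    and inj: "inj_on g S"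
    and d: "\<And>x. x \<in> S \<Longrightarrow> \<bar>det (matrix (g' x))\<bar> = d x"
    and dm [measurable]: "d \<in> borel_measurable borel"
    and A [measurable]: "A \<in> sets borel" and bd: "bounded A"
  shows "(\<integral>\<^sup>+x\<in>S. ennreal (d x) * indicator A (g x) \<partial>lborel) = emeasure lborel (A \<inter> g ` S)"
proof -
  have gm [measurable]: "g \<in> borel_measurable borel"
    using g by (rule borel_measurable_continuous_onI)
  \<comment> \<open>Invariance of domain makes the image open, hence Borel.\<close>
  have "open (g ` S)"
    using invariance_of_domain[OF continuous_on_subset[OF g] S inj] by simp
  then have [measurable]: "g ` S \<in> sets borel" "S \<in> sets borel" using S by auto
  have dpos: "d x \<ge> 0" if "x \<in> S" for x using d[OF that] by (metis abs_ge_zero)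
  let ?T = "A \<inter> g ` S" and ?S' = "{x\<in>S. g x \<in> A}"
  have im: "g ` ?S' = ?T" by auto
  have S'm [measurable]: "?S' \<in> sets borel"
    by measurable
  have "bounded ?T" using bd by (meson bounded_subset inf_le1)
  then have Tm: "?T \<in> lmeasurable" by (intro bounded_set_imp_lmeasurable) (auto intro: sets_completionI_sets)
  have inj': "inj_on g ?S'" using inj by (rule inj_on_subset) auto
  have "((\<lambda>x. \<bar>det (matrix (g' x))\<bar>) has_integral measure lebesgue ?T) ?S'"
    using has_measure_differentiable_image[of ?S' g g' "measure lebesgue ?T"] der inj' Tm im
    by (auto intro: sets_completionI_sets has_derivative_at_withinI)
  then have "(d has_integral measure lebesgue ?T) ?S'"
    by (rule has_integral_eq[rotated]) (auto simp: d)
  then have "((\<lambda>x. d x * indicator ?S' x) has_integral measure lebesgue ?T) UNIV"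
    by (subst (asm) has_integral_restrict_UNIV[symmetric])
       (auto elim!: has_integral_eq[rotated] simp: indicator_def)
  then have "(\<integral>\<^sup>+x. ennreal (d x * indicator ?S' x) \<partial>lborel) = ennreal (measure lebesgue ?T)"
    by (intro nn_integral_has_integral_lborel) (auto simp: dpos indicator_def)
  also have "ennreal (measure lebesgue ?T) = emeasure lborel ?T"
    using Tm by (simp add: emeasure_eq_measure2[symmetric] fmeasurable_def)
  finally show ?thesis
    by (auto simp: indicator_def intro!: nn_integral_cong elim!: trans[rotated])
qed

text \<open>An equality of measures rather than of integrals, so that nonnegative and signed
  integrands can both be substituted. An unbounded \<open>A\<close> is exhausted by its
  intersections with balls.\<close>

lemma distr_change_of_variables:
  fixes g :: "real^'n::{finite,wellorder} \<Rightarrow> real^'n::_"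
  assumes S: "open S" and g: "continuous_on UNIV g"
    and der: "\<And>x. x \<in> S \<Longrightarrow> (g has_derivative g' x) (at x)"
    and inj: "inj_on g S"
    and d: "\<And>x. x \<in> S \<Longrightarrow> \<bar>det (matrix (g' x))\<bar> = d x"
    and dm [measurable]: "d \<in> borel_measurable borel"
  shows "distr (density lborel (\<lambda>x. ennreal (d x) * indicator S x)) borel g
          = density lborel (indicator (g ` S))"
proof (rule measure_eqI)
  have gm [measurable]: "g \<in> borel_measurable borel"
    using g by (rule borel_measurable_continuous_onI)
  have "open (g ` S)"
    using invariance_of_domain[OF continuous_on_subset[OF g] S inj] by simp
  then have [measurable]: "g ` S \<in> sets borel" "S \<in> sets borel" using S by auto
  show "sets (distr (density lborel (\<lambda>x. ennreal (d x) * indicator S x)) borel g)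
      = sets (density lborel (indicator (g ` S)))" by simp
  fix A :: "(real^'n::{finite,wellorder}) set" assume "A \<in> sets (distr (density lborel (\<lambda>x. ennreal (d x) * indicator S x)) borel g)"
  then have [measurable]: "A \<in> sets borel" by simp
  define B where "B n = A \<inter> ball 0 (real n)" for n
  have [measurable]: "B n \<in> sets borel" for n by (auto simp: B_def)
  have B: "incseq B" "(\<Union>n. B n) = A"
    by (auto simp: B_def incseq_def) (metis reals_Archimedean2)
  let ?M = "distr (density lborel (\<lambda>x. ennreal (d x) * indicator S x)) borel g"
  let ?N = "density lborel (indicator (g ` S))"
  have "emeasure ?M (B n) = emeasure ?N (B n)" for n
  proof -
    have "emeasure ?M (B n) = (\<integral>\<^sup>+x\<in>S. ennreal (d x) * indicator (B n) (g x) \<partial>lborel)"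
      by (subst emeasure_distr, simp, simp, subst emeasure_density)
         (auto simp: indicator_def intro!: nn_integral_cong measurable_sets_borel[OF gm])
    also have "\<dots> = emeasure lborel (B n \<inter> g ` S)"
      by (rule change_of_variables_emeasure[OF S g der inj d]) (auto simp: B_def intro: bounded_subset[OF bounded_ball])
    also have "\<dots> = emeasure ?N (B n)"
      by (subst emeasure_density) (auto simp: nn_integral_indicator[symmetric] indicator_def simp del: nn_integral_indicator intro!: nn_integral_cong)
    finally show ?thesis .
  qed
  then have "(SUP n. emeasure ?M (B n)) = (SUP n. emeasure ?N (B n))" by simp
  then show "emeasure ?M A = emeasure ?N A"
    using B SUP_emeasure_incseq[of B ?M] SUP_emeasure_incseq[of B ?N] by (simp add: image_subset_iff)
qed

lemma nn_integral_change_of_variables: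
  fixes g :: "real^'n::{finite,wellorder} \<Rightarrow> real^'n::_"
  assumes S: "open S" and g: "continuous_on UNIV g"
    and der: "\<And>x. x \<in> S \<Longrightarrow> (g has_derivative g' x) (at x)"
    and inj: "inj_on g S"
    and d: "\<And>x. x \<in> S \<Longrightarrow> \<bar>det (matrix (g' x))\<bar> = d x"
    and dm [measurable]: "d \<in> borel_measurable borel"
    and F [measurable]: "F \<in> borel_measurable borel"
  shows "(\<integral>\<^sup>+x\<in>g ` S. F x \<partial>lborel) = (\<integral>\<^sup>+x\<in>S. ennreal (d x) * F (g x) \<partial>lborel)"
proof -
  have gm [measurable]: "g \<in> borel_measurable borel"
    using g by (rule borel_measurable_continuous_onI)
  have "open (g ` S)"
    using invariance_of_domain[OF continuous_on_subset[OF g] S inj] by simp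
  then have [measurable]: "g ` S \<in> sets borel" "S \<in> sets borel" using S by auto
  have "(\<integral>\<^sup>+x\<in>g ` S. F x \<partial>lborel) = (\<integral>\<^sup>+x. F x \<partial>density lborel (indicator (g ` S)))"
    by (subst nn_integral_density) (auto simp: mult.commute)
  also have "\<dots> = (\<integral>\<^sup>+x. F x \<partial>distr (density lborel (\<lambda>x. ennreal (d x) * indicator S x)) borel g)"
    by (subst distr_change_of_variables[OF S g der inj d]) auto
  also have "\<dots> = (\<integral>\<^sup>+x\<in>S. ennreal (d x) * F (g x) \<partial>lborel)"
    by (subst nn_integral_distr, simp, simp, subst nn_integral_density) (auto simp: ac_simps intro!: nn_integral_cong)
  finally show ?thesis .
qed


section \<open>Polar coordinates and the radial and angular integrals\<close>

lemma det_matrix_2: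
  fixes f :: "real^2 \<Rightarrow> real^2"
  shows "det (matrix f) = f (axis 1 1) $ 1 * f (axis 2 1) $ 2 - f (axis 2 1) $ 1 * f (axis 1 1) $ 2"
  by (simp add: det_2 matrix_def)

lemma norm_vec2: "norm (vec2 x y) = sqrt (x\<^sup>2 + y\<^sup>2)"
  by (simp add: norm_vec_def L2_set_def sum_2)

lemma norm_sq2: "(norm (v::real^2))\<^sup>2 = (v$1)\<^sup>2 + (v$2)\<^sup>2"
  by (simp add: norm_vec_def L2_set_def sum_2)

text \<open>
  The polar angle is chosen such that \<open>dirv \<theta>\<close> is the first frame vector of the circles with normal
  \<open>sphere_chart (\<phi>, \<theta>)\<close>, hence the direction of their chord in the plane.
\<close>

definition dirv :: "real \<Rightarrow> real^2" where
  "dirv \<theta> = vec2 (sin \<theta>) (- cos \<theta>)"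

lemma norm_dirv [simp]: "norm (dirv \<theta>) = 1"
  by (simp add: dirv_def norm_vec2)

lemma continuous_on_dirv [continuous_intros]:
  fixes f :: "'a::t2_space \<Rightarrow> real"
  shows "continuous_on S f \<Longrightarrow> continuous_on S (\<lambda>x. dirv (f x))"
  unfolding dirv_def by (intro continuous_intros)

lemma measurable_dirv [measurable]: "dirv \<in> borel_measurable borel"
  by (intro borel_measurable_continuous_onI continuous_intros)

lemma AE_vec_nth_neq_0: "AE x in lborel. (x::real^2) $ 1 \<noteq> 0"
proof -
  have "negligible {x::real^2. x $ 1 = 0}"
    using negligible_standard_hyperplane_cart[of 1] by simp
  then have "{x::real^2. x $ 1 = 0} \<in> null_sets lebesgue"
    by (simp add: negligible_iff_null_sets)
  then have "AE x in lebesgue. x \<notin> {x::real^2. x $ 1 = 0}"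
    by (rule AE_not_in)
  then show ?thesis
    by (simp add: AE_completion_iff)
qed

lemma nn_integral_polar:
  assumes [measurable]: "F \<in> borel_measurable borel"
  shows "(\<integral>\<^sup>+x. F x \<partial>lborel) =
    (\<integral>\<^sup>+\<rho>. \<integral>\<^sup>+\<theta>. indicator {0<..} \<rho> * indicator {0..2*pi} \<theta> * (ennreal \<rho> * F (\<rho> *\<^sub>R dirv \<theta>)) \<partial>lborel \<partial>lborel)"
proof -
  define g :: "real^2 \<Rightarrow> real^2" where "g p = (p$1) *\<^sub>R dirv (p$2)" for p
  define S where "S = {p::real^2. 0 < p$1 \<and> 0 < p$2 \<and> p$2 < 2*pi}"
  have S: "open S"
  proof -
    have "S = {p. 0 < p$1} \<inter> {p. 0 < p$2} \<inter> {p. p$2 < 2*pi}" by (auto simp: S_def)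
    then show ?thesis
      by (auto intro!: open_Collect_less continuous_intros)
  qed
  have [measurable]: "S \<in> sets borel" using S by auto
  have gc: "continuous_on UNIV g"
    unfolding g_def by (intro continuous_intros)
  have gm [measurable]: "g \<in> borel_measurable borel"
    using gc by (rule borel_measurable_continuous_onI)
  define g' :: "real^2 \<Rightarrow> real^2 \<Rightarrow> real^2" where
    "g' p h = vec2 (h$1 * sin (p$2) + p$1 * (cos (p$2) * h$2)) (- (h$1 * cos (p$2)) + p$1 * (sin (p$2) * h$2))" for p h
  have g_axis: "g p = (p$1 * sin (p$2)) *\<^sub>R axis 1 1 + (- (p$1 * cos (p$2))) *\<^sub>R axis 2 1" for p
    by (simp add: g_def dirv_def vec_eq_iff forall_2 axis_def)
  have g'_axis: "g' p = (\<lambda>h. (h$1 * sin (p$2) + p$1 * (cos (p$2) * h$2)) *\<^sub>R axis 1 1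
      + (- (h$1 * cos (p$2)) + p$1 * (sin (p$2) * h$2)) *\<^sub>R axis 2 1)" for p
    by (simp add: g'_def vec_eq_iff forall_2 axis_def fun_eq_iff)
  have der: "(g has_derivative g' p) (at p)" for p
  proof -
    have nth: "((\<lambda>p. p $ i) has_derivative (\<lambda>h. h $ i)) (at p)" for i :: 2
      by (intro bounded_linear_imp_has_derivative bounded_linear_vec_nth)
    have g_eq: "g = (\<lambda>p. (p$1 * sin (p$2)) *\<^sub>R axis 1 1 + (- (p$1 * cos (p$2))) *\<^sub>R axis 2 1)"
      using g_axis by blast
    show ?thesis
      unfolding g_eq g'_axis
      by (auto intro!: derivative_eq_intros nth simp: algebra_simps fun_eq_iff)
  qed
  have inj: "inj_on g S"
  proof (rule inj_onI)
    fix p q assume pq: "p \<in> S" "q \<in> S" "g p = g q"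
    have n: "norm (g p) = p$1" "norm (g q) = q$1"
      using pq(1,2) by (auto simp: g_def S_def)
    then have 1: "p$1 = q$1" using pq(3) by simp
    then have "dirv (p$2) = dirv (q$2)"
      using pq(1,2) pq(3) by (simp add: g_def S_def)
    then have "sin (p$2) = sin (q$2) \<and> cos (p$2) = cos (q$2)"
      by (auto simp: dirv_def vec_eq_iff forall_2)
    then obtain n :: int where n: "p$2 = q$2 + 2 * pi * n"
      using sin_cos_eq_iff by blast
    have "0 < p$2" "p$2 < 2*pi" "0 < q$2" "q$2 < 2*pi" using pq(1,2) by (auto simp: S_def)
    then have "\<bar>2 * pi * n\<bar> < 2 * pi" using n by linarith
    then have "\<bar>real_of_int n\<bar> < 1" by (simp add: abs_mult)
    then have "n = 0" by linarith
    with n 1 show "p = q" by (simp add: vec_eq_iff forall_2)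
  qed
  have det: "\<bar>det (matrix (g' p))\<bar> = p$1" if "p \<in> S" for p
  proof -
    have "det (matrix (g' p)) = p$1 * ((sin (p$2))\<^sup>2 + (cos (p$2))\<^sup>2)"
      unfolding det_matrix_2 g'_def
      by (simp only: distrib_left) (simp add: axis_def power2_eq_square)
    then show ?thesis using that by (simp add: S_def)
  qed
  \<comment> \<open>The open chart omits the ray of angle \<open>0\<close>, which lies in the null
    line \<open>x$1 = 0\<close>; the whole line is discarded.\<close>
  have im: "x \<in> g ` S" if "x$1 \<noteq> 0" for x
  proof -
    define r where "r = norm x"
    have r: "r > 0" using that by (auto simp: r_def)
    have r2: "r\<^sup>2 = (x$1)\<^sup>2 + (x$2)\<^sup>2" by (simp add: r_def norm_sq2)
    have "(- (x$2) / r)\<^sup>2 + (x$1 / r)\<^sup>2 = 1"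
    proof -
      have "(- (x$2) / r)\<^sup>2 + (x$1 / r)\<^sup>2 = ((x$1)\<^sup>2 + (x$2)\<^sup>2) / r\<^sup>2"
        by (simp only: power_divide add_divide_distrib power2_minus add.commute)
      also have "\<dots> = r\<^sup>2 / r\<^sup>2" unfolding r2 ..
      finally have "(- (x$2) / r)\<^sup>2 + (x$1 / r)\<^sup>2 = r\<^sup>2 / r\<^sup>2" .
      then show ?thesis using r by simp
    qed
    then obtain t where t: "0 \<le> t" "t < 2*pi" "- (x$2) / r = cos t" "x$1 / r = sin t"
      using sincos_total_2pi by metis
    have "t \<noteq> 0" using t that r by auto
    have "g (vec2 r t) = x"
      using r by (simp add: g_def dirv_def vec_eq_iff forall_2 t(3,4)[symmetric])
    moreover have "vec2 r t \<in> S" using t r \<open>t \<noteq> 0\<close> by (simp add: S_def)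
    ultimately show ?thesis by (metis imageI)
  qed
  have "(\<integral>\<^sup>+x. F x \<partial>lborel) = (\<integral>\<^sup>+x\<in>g ` S. F x \<partial>lborel)"
    using AE_vec_nth_neq_0 by (intro nn_integral_cong_AE) (auto simp: im)
  also have "\<dots> = (\<integral>\<^sup>+p\<in>S. ennreal (p$1) * F (g p) \<partial>lborel)"
    by (rule nn_integral_change_of_variables[OF S gc der inj det]) auto
  also have "\<dots> = (\<integral>\<^sup>+\<rho>. \<integral>\<^sup>+\<theta>. ennreal \<rho> * F (\<rho> *\<^sub>R dirv \<theta>) * indicator S (vec2 \<rho> \<theta>) \<partial>lborel \<partial>lborel)"
    by (subst nn_integral_vec2) (auto simp: g_def)
  also have "\<dots> = (\<integral>\<^sup>+\<rho>. \<integral>\<^sup>+\<theta>. indicator {0<..} \<rho> * indicator {0..2*pi} \<theta> * (ennreal \<rho> * F (\<rho> *\<^sub>R dirv \<theta>)) \<partial>lborel \<partial>lborel)"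
  proof (rule nn_integral_cong, rule nn_integral_cong_AE)
    fix \<rho> :: real
    show "AE \<theta> in lborel. ennreal \<rho> * F (\<rho> *\<^sub>R dirv \<theta>) * indicator S (vec2 \<rho> \<theta>) =
      indicator {0<..} \<rho> * indicator {0..2*pi} \<theta> * (ennreal \<rho> * F (\<rho> *\<^sub>R dirv \<theta>))"
      using AE_lborel_singleton[of "0::real"] AE_lborel_singleton[of "2*pi"]
      by eventually_elim (auto simp: S_def indicator_def ac_simps)
  qed
  finally show ?thesis .
qed

lemma nn_integral_radial:
  assumes [measurable]: "h \<in> borel_measurable borel"
  shows "(\<integral>\<^sup>+(x::real^2). h (norm x) \<partial>lborel) =
    ennreal (2*pi) * (\<integral>\<^sup>+\<rho>. indicator {0<..} \<rho> * (ennreal \<rho> * h \<rho>) \<partial>lborel)"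
proof -
  have "(\<integral>\<^sup>+(x::real^2). h (norm x) \<partial>lborel) =
    (\<integral>\<^sup>+\<rho>. \<integral>\<^sup>+\<theta>. (indicator {0<..} \<rho> * (ennreal \<rho> * h \<rho>)) * indicator {0..2*pi} \<theta> \<partial>lborel \<partial>lborel)"
    by (subst nn_integral_polar) (auto simp: indicator_def intro!: nn_integral_cong)
  also have "\<dots> = (\<integral>\<^sup>+\<rho>. ennreal (2*pi) * (indicator {0<..} \<rho> * (ennreal \<rho> * h \<rho>)) \<partial>lborel)"
    by (intro nn_integral_cong, subst nn_integral_cmult) (auto simp: mult.commute)
  also have "\<dots> = ennreal (2*pi) * (\<integral>\<^sup>+\<rho>. indicator {0<..} \<rho> * (ennreal \<rho> * h \<rho>) \<partial>lborel)"
    by (rule nn_integral_cmult) simp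
  finally show ?thesis .
qed

text \<open>\<open>2 * pi\<close> is the solid angle of a half-space: the integrand is the solid
  angle density of the plane seen from height one. This fixes the size of the jump of the solid
  angle.\<close>

lemma nn_integral_norm_cube: "(\<integral>\<^sup>+(u::real^2). ennreal (1 / sqrt (1 + (norm u)\<^sup>2) ^ 3) \<partial>lborel) = ennreal (2*pi)"
proof -
  have "(\<integral>\<^sup>+\<rho>. indicator {0<..} \<rho> * (ennreal \<rho> * ennreal (1 / sqrt (1 + \<rho>\<^sup>2) ^ 3)) \<partial>lborel)
      = (\<integral>\<^sup>+\<rho>. ennreal (\<rho> / sqrt (1 + \<rho>\<^sup>2) ^ 3) * indicator {0..} \<rho> \<partial>lborel)"
  proof (intro nn_integral_cong)
    fix \<rho> :: real
    show "indicator {0<..} \<rho> * (ennreal \<rho> * ennreal (1 / sqrt (1 + \<rho>\<^sup>2) ^ 3)) = ennreal (\<rho> / sqrt (1 + \<rho>\<^sup>2) ^ 3) * indicator {0..} \<rho>"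
      by (cases "\<rho> > 0"; cases "\<rho> = 0") (auto simp: indicator_def ennreal_mult'[symmetric])
  qed
  also have "\<dots> = ennreal (0 - (- 1 / sqrt (1 + 0\<^sup>2)))"
  proof (rule nn_integral_FTC_atLeast)
    fix x :: real assume "0 \<le> x"
    have p: "1 + x\<^sup>2 > 0" by (simp add: add_pos_nonneg)
    then show "((\<lambda>x. - 1 / sqrt (1 + x\<^sup>2)) has_real_derivative x / sqrt (1 + x\<^sup>2) ^ 3) (at x)"
      by (auto intro!: derivative_eq_intros simp: power2_eq_square power3_eq_cube field_simps)
    show "0 \<le> x / sqrt (1 + x\<^sup>2) ^ 3" using \<open>0 \<le> x\<close> p by auto
  next
    show "((\<lambda>x::real. - 1 / sqrt (1 + x\<^sup>2)) \<longlongrightarrow> 0) at_top"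
      by real_asymp
  qed auto
  finally have "(\<integral>\<^sup>+\<rho>. indicator {0<..} \<rho> * (ennreal \<rho> * ennreal (1 / sqrt (1 + \<rho>\<^sup>2) ^ 3)) \<partial>lborel) = 1"
    by simp
  then show ?thesis
    by (subst nn_integral_radial[where h = "\<lambda>r. ennreal (1 / sqrt (1 + r\<^sup>2) ^ 3)"]) auto
qed

abbreviation far :: "real \<Rightarrow> real^2 \<Rightarrow> ennreal" where
  "far \<epsilon> v \<equiv> indicator {\<epsilon><..} (norm v) * ennreal (1 / norm v ^ 4)"

abbreviation annulus :: "real \<Rightarrow> real \<Rightarrow> real^2 \<Rightarrow> ennreal" where
  "annulus a b v \<equiv> indicator {a<..b} (norm v) * ennreal (1 / norm v ^ 4)"

text \<open>Since \<open>escape\<close> is bounded by the area of the region, this makes the planar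
  integral with cut-off finite.\<close>

lemma nn_integral_norm_power4:
  assumes "\<epsilon> > 0"
  shows "(\<integral>\<^sup>+(v::real^2). far \<epsilon> v \<partial>lborel) = ennreal (pi / \<epsilon>\<^sup>2)"
proof -
  have "(\<integral>\<^sup>+\<rho>. indicator {0<..} \<rho> * (ennreal \<rho> * (indicator {\<epsilon><..} \<rho> * ennreal (1 / \<rho> ^ 4))) \<partial>lborel)
      = (\<integral>\<^sup>+\<rho>. ennreal (1 / \<rho> ^ 3) * indicator {\<epsilon>..} \<rho> \<partial>lborel)"
  proof (intro nn_integral_cong_AE)
    show "AE \<rho> in lborel. indicator {0<..} \<rho> * (ennreal \<rho> * (indicator {\<epsilon><..} \<rho> * ennreal (1 / \<rho> ^ 4))) = ennreal (1 / \<rho> ^ 3) * indicator {\<epsilon>..} \<rho>"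
      using AE_lborel_singleton[of "\<epsilon>"]
    proof eventually_elim
      case (elim \<rho>)
      then show ?case using assms
        by (cases "\<rho> > \<epsilon>") (auto simp: indicator_def ennreal_mult'[symmetric] power_numeral_reduce)
    qed
  qed
  also have "\<dots> = ennreal (0 - (- 1 / (2 * \<epsilon>\<^sup>2)))"
  proof (rule nn_integral_FTC_atLeast)
    fix x :: real assume "\<epsilon> \<le> x"
    then show "((\<lambda>x. - 1 / (2 * x\<^sup>2)) has_real_derivative 1 / x ^ 3) (at x)"
      using assms by (auto intro!: derivative_eq_intros simp: power_numeral_reduce field_simps)
    show "0 \<le> 1 / x ^ 3" using \<open>\<epsilon> \<le> x\<close> assms by auto
  next
    show "((\<lambda>x::real. - 1 / (2 * x\<^sup>2)) \<longlongrightarrow> 0) at_top"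
      by real_asymp
  qed auto
  finally have *: "(\<integral>\<^sup>+\<rho>. indicator {0<..} \<rho> * (ennreal \<rho> * (indicator {\<epsilon><..} \<rho> * ennreal (1 / \<rho> ^ 4))) \<partial>lborel) = ennreal (1 / (2 * \<epsilon>\<^sup>2))"
    by simp
  show ?thesis
    by (subst nn_integral_radial[where h = "\<lambda>r. indicator {\<epsilon><..} r * ennreal (1 / r ^ 4)"], simp)
       (subst *, simp add: ennreal_mult'[symmetric])
qed

text \<open>A rotation preserves norms and area. The one taking the first axis to the direction of
  \<open>k\<close> turns \<open>cr\<close> with \<open>k\<close> into \<open>- norm k\<close> times
  the second coordinate.\<close>

lemma nn_integral_rotate:
  fixes H :: "real \<Rightarrow> real \<Rightarrow> ennreal" and k :: "real^2"
  assumes H [measurable]: "case_prod H \<in> borel_measurable (borel \<Otimes>\<^sub>M borel)"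
  shows "(\<integral>\<^sup>+v. H (norm v) \<bar>cr v k\<bar> \<partial>lborel) = (\<integral>\<^sup>+(v::real^2). H (norm v) (norm k * \<bar>v$2\<bar>) \<partial>lborel)"
proof (cases "k = 0")
  case True then show ?thesis by (simp add: cr_def)
next
  case False
  define a where "a = (1 / norm k) *\<^sub>R k"
  have a: "norm a = 1" "k = norm k *\<^sub>R a" using False by (auto simp: a_def)
  have a2: "(a$1)\<^sup>2 + (a$2)\<^sup>2 = 1" using norm_sq2[of a] a by simp
  define g :: "real^2 \<Rightarrow> real^2" where "g u = vec2 (u$1 * a$1 - u$2 * a$2) (u$1 * a$2 + u$2 * a$1)" for u
  have lin: "linear g"
    by (rule linearI) (auto simp: g_def vec_eq_iff forall_2 algebra_simps)
  have der: "(g has_derivative g) (at p)" for p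
    using lin by (simp add: linear_conv_bounded_linear bounded_linear_imp_has_derivative)
  have det: "\<bar>det (matrix g)\<bar> = 1" 
    using a2 by (simp add: det_matrix_2 g_def axis_def power2_eq_square)
  have nrm: "norm (g u) = norm u" for u
  proof -
    have "(norm (g u))\<^sup>2 = ((a$1)\<^sup>2 + (a$2)\<^sup>2) * (norm u)\<^sup>2"
      unfolding norm_sq2 by (simp add: g_def power2_eq_square algebra_simps)
    then show ?thesis by (simp add: a2)
  qed
  have inj: "inj g"
    by (rule linear_injective_0[OF lin, THEN iffD2]) (metis nrm norm_eq_zero)
  have surj: "g ` UNIV = UNIV"
    using lin inj by (simp add: linear_injective_imp_surjective)
  have c: "\<bar>cr (g u) k\<bar> = norm k * \<bar>u$2\<bar>" for u
  proof -
    have "cr (g u) k = norm k * cr (g u) a"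
      by (subst a(2)) (simp add: cr_def algebra_simps)
    also have "cr (g u) a = - ((a$1)\<^sup>2 + (a$2)\<^sup>2) * (u$2)"
      by (simp add: g_def cr_def power2_eq_square algebra_simps)
    finally show ?thesis by (simp add: a2 abs_mult)
  qed
  have [measurable]: "(\<lambda>v. cr v k) \<in> borel_measurable borel"
    unfolding cr_def by measurable
  have gc: "continuous_on UNIV g"
    unfolding g_def by (intro continuous_intros)
  have [measurable]: "(\<lambda>v::real^2. H (norm v) \<bar>cr v k\<bar>) \<in> borel_measurable borel"
    by measurable
  have "(\<integral>\<^sup>+v\<in>g ` UNIV. H (norm v) \<bar>cr v k\<bar> \<partial>lborel) = (\<integral>\<^sup>+v\<in>UNIV. ennreal 1 * H (norm (g v)) \<bar>cr (g v) k\<bar> \<partial>lborel)"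
    by (rule nn_integral_change_of_variables[OF open_UNIV gc der inj det]) auto
  then show ?thesis by (simp add: surj nrm c)
qed

lemma nn_integral_abs_cos: "(\<integral>\<^sup>+\<theta>\<in>{0..2*pi}. ennreal \<bar>cos \<theta>\<bar> \<partial>lborel) = 4"
proof -
  have 1: "((\<lambda>\<theta>. \<bar>cos \<theta>\<bar>) has_integral (sin (pi/2) - sin 0)) {0..pi/2}"
    by (rule has_integral_eq[OF _ fundamental_theorem_of_calculus])
       (auto intro!: derivative_eq_intros simp: has_real_derivative_iff_has_vector_derivative[symmetric] abs_of_nonneg cos_ge_zero)
  have cneg: "cos x \<le> 0" if "pi/2 \<le> x" "x \<le> 3*pi/2" for x
    using cos_ge_zero[of "x - pi"] that by (simp add: cos_diff)
  have 2: "((\<lambda>\<theta>. \<bar>cos \<theta>\<bar>) has_integral (- sin (3*pi/2) - - sin (pi/2))) {pi/2..3*pi/2}"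
    by (rule has_integral_eq[OF _ fundamental_theorem_of_calculus])
       (auto intro!: derivative_eq_intros simp: has_real_derivative_iff_has_vector_derivative[symmetric] abs_of_nonpos cneg)
  have cpos: "cos x \<ge> 0" if "3*pi/2 \<le> x" "x \<le> 2*pi" for x
    using cos_ge_zero[of "x - 2*pi"] that by (simp add: cos_diff)
  have 3: "((\<lambda>\<theta>. \<bar>cos \<theta>\<bar>) has_integral (sin (2*pi) - sin (3*pi/2))) {3*pi/2..2*pi}"
    by (rule has_integral_eq[OF _ fundamental_theorem_of_calculus])
       (auto intro!: derivative_eq_intros simp: has_real_derivative_iff_has_vector_derivative[symmetric] abs_of_nonneg cpos)
  have s: "sin (3*pi/2) = -1" using sin_3over2_pi by (simp add: field_simps)
  have "((\<lambda>\<theta>. \<bar>cos \<theta>\<bar>) has_integral 4) {0..2*pi}"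
    using has_integral_combine[OF _ _ has_integral_combine[OF _ _ 1 2] 3] s by auto
  then have "(\<integral>\<^sup>+\<theta>. ennreal (\<bar>cos \<theta>\<bar> * indicator {0..2*pi} \<theta>) \<partial>lborel) = ennreal 4"
    by (intro nn_integral_has_integral_lborel)
       (auto simp: has_integral_restrict_UNIV[of "{0..2*pi}", symmetric] indicator_def of_bool_def if_distrib
          elim!: has_integral_eq[rotated])
  then show ?thesis
    by (simp add: ennreal_mult' ennreal_indicator)
qed

text \<open>In polar coordinates the integral factors into \<open>4\<close>, the integral of
  \<open>|cos \<theta>|\<close> over a period, and the integral of \<open>norm k / \<rho>^2\<close>
  over the radii beyond \<open>\<epsilon>\<close>.\<close>

lemma nn_integral_cr_norm_power4:
  assumes "\<epsilon> > 0"
  shows "(\<integral>\<^sup>+v. indicator {\<epsilon><..} (norm v) * ennreal (\<bar>cr v k\<bar> / norm v ^ 4) \<partial>lborel) = ennreal (4 * norm k / \<epsilon>)"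
proof -
  let ?H = "\<lambda>r x. indicator {\<epsilon><..} r * ennreal (x / r ^ 4)"
  have "(\<integral>\<^sup>+v. ?H (norm v) \<bar>cr v k\<bar> \<partial>lborel) = (\<integral>\<^sup>+(v::real^2). ?H (norm v) (norm k * \<bar>v$2\<bar>) \<partial>lborel)"
    by (rule nn_integral_rotate) measurable
  also have "\<dots> = (\<integral>\<^sup>+\<rho>. \<integral>\<^sup>+\<theta>. (indicator {\<epsilon><..} \<rho> * ennreal (norm k / \<rho>\<^sup>2)) * (ennreal \<bar>cos \<theta>\<bar> * indicator {0..2*pi} \<theta>) \<partial>lborel \<partial>lborel)"
  proof (subst nn_integral_polar, simp, intro nn_integral_cong)
    fix \<rho> \<theta> :: real
    have nth: "dirv \<theta> $ 2 = - cos \<theta>" by (simp add: dirv_def)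
    show "indicator {0<..} \<rho> * indicator {0..2 * pi} \<theta> *
           (ennreal \<rho> * (indicator {\<epsilon><..} (norm (\<rho> *\<^sub>R dirv \<theta>)) *
             ennreal (norm k * \<bar>(\<rho> *\<^sub>R dirv \<theta>) $ 2\<bar> / norm (\<rho> *\<^sub>R dirv \<theta>) ^ 4))) =
          indicator {\<epsilon><..} \<rho> * ennreal (norm k / \<rho>\<^sup>2) * (ennreal \<bar>cos \<theta>\<bar> * indicator {0..2 * pi} \<theta>)"
      using assms
      by (cases "\<rho> > \<epsilon>")
         (auto simp: indicator_def nth abs_mult ennreal_mult'[symmetric] power_numeral_reduce
           intro!: arg_cong[where f=ennreal])
  qed
  also have "\<dots> = (\<integral>\<^sup>+\<rho>. (ennreal (norm k / \<rho>\<^sup>2) * indicator {\<epsilon>..} \<rho>) * 4 \<partial>lborel)"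
    using AE_lborel_singleton[of "\<epsilon>"]
    by (intro nn_integral_cong_AE, elim eventually_mono)
       (simp add: nn_integral_cmult nn_integral_abs_cos, auto simp: indicator_def)
  also have "\<dots> = (\<integral>\<^sup>+\<rho>. ennreal (norm k / \<rho>\<^sup>2) * indicator {\<epsilon>..} \<rho> \<partial>lborel) * 4"
    by (rule nn_integral_multc) simp
  also have "(\<integral>\<^sup>+\<rho>. ennreal (norm k / \<rho>\<^sup>2) * indicator {\<epsilon>..} \<rho> \<partial>lborel) = ennreal (0 - (- norm k / \<epsilon>))"
  proof (rule nn_integral_FTC_atLeast)
    fix x :: real assume "\<epsilon> \<le> x"
    then show "((\<lambda>x. - norm k / x) has_real_derivative norm k / x\<^sup>2) (at x)"
      using assms by (auto intro!: derivative_eq_intros simp: power2_eq_square field_simps)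
    show "0 \<le> norm k / x\<^sup>2" by simp
  next
    show "((\<lambda>x::real. - norm k / x) \<longlongrightarrow> 0) at_top"
      by real_asymp
  qed auto
  also have "ennreal (0 - (- norm k / \<epsilon>)) * 4 = ennreal (4 * norm k / \<epsilon>)"
    using assms by (simp add: ennreal_mult'[symmetric] ennreal_numeral[symmetric] mult.commute del: ennreal_numeral)
  finally show ?thesis .
qed

section \<open>Planar domains and transversal crossings\<close>

text \<open>Lagrange's identity: the squares of \<open>cr a b\<close> and of the inner product add
  up to the product of the squared norms.\<close>

lemma abs_cr_le: "\<bar>cr a b\<bar> \<le> norm a * norm b"
proof -
  have "(cr a b)\<^sup>2 + (a \<bullet> b)\<^sup>2 = (norm a)\<^sup>2 * (norm b)\<^sup>2"
    unfolding norm_sq2 by (simp add: cr_def inner_vec_def sum_2 power2_eq_square algebra_simps)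
  then have "(cr a b)\<^sup>2 \<le> (norm a * norm b)\<^sup>2"
    using zero_le_power2[of "a \<bullet> b"] unfolding power_mult_distrib by linarith
  then show ?thesis by (simp add: abs_le_square_iff[symmetric])
qed

lemma continuous_bounded_compact:
  fixes f :: "'a::topological_space \<Rightarrow> 'b::real_normed_vector"
  assumes "continuous_on S f" "compact S"
  shows "\<exists>A. \<forall>x\<in>S. norm (f x) \<le> A"
  using compact_imp_bounded[OF compact_continuous_image[OF assms]] by (simp add: bounded_iff)

locale planar_domain =
  fixes m :: nat and K K' K'' :: "nat \<Rightarrow> real \<Rightarrow> real^2" and \<Omega> :: "(real^2) set"
  assumes K_deriv: "\<And>i t. i < m \<Longrightarrow> (K i has_vector_derivative K' i t) (at t)"
    and K'_deriv: "\<And>i t. i < m \<Longrightarrow> (K' i has_vector_derivative K'' i t) (at t)"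
    and K''_cont: "\<And>i. i < m \<Longrightarrow> continuous_on UNIV (K'' i)"
    and K_periodic: "\<And>i t. i < m \<Longrightarrow> K i (t + 1) = K i t"
    and K'_nonzero: "\<And>i t. i < m \<Longrightarrow> K' i t \<noteq> 0"
    and K_inj: "inj_on (\<lambda>(i, t). K i t) ({..<m} \<times> {0..<1})"
    and region: "bounds_region m K \<Omega>"
begin

lemma K_cont: "i < m \<Longrightarrow> continuous_on S (K i)"
  by (rule continuous_at_imp_continuous_on) (auto intro!: has_vector_derivative_continuous K_deriv)

lemma K'_cont: "i < m \<Longrightarrow> continuous_on S (K' i)"
  by (rule continuous_at_imp_continuous_on) (auto intro!: has_vector_derivative_continuous K'_deriv)

lemma K_one: "i < m \<Longrightarrow> K i 1 = K i 0"
  using K_periodic[of i 0] by simp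

lemma K_periodic_int: "i < m \<Longrightarrow> K i (t + of_int k) = K i t"
proof (induction k arbitrary: t rule: int_induct[where k=0])
  case base then show ?case by simp
next
  case (step1 k)
  then show ?case using K_periodic[of i "t + of_int k"] by (simp add: ac_simps)
next
  case (step2 k)
  then show ?case using K_periodic[of i "t + of_int k - 1"] by (simp add: algebra_simps)
qed

lemma curve_image_eq: "curve_image m K = (\<Union>i<m. K i ` {0..1})"
proof -
  have "K i t \<in> K i ` {0..1}" if "i < m" for i t
  proof -
    have "K i t = K i (frac t)"
      using K_periodic_int[OF that, of t "- \<lfloor>t\<rfloor>"] by (simp add: frac_def)
    then show ?thesis using frac_ge_0[of t] frac_lt_1[of t] by (auto intro!: imageI)
  qed
  then show ?thesis unfolding curve_image_def by blast
qed

lemma frontier_region: "frontier \<Omega> = curve_image m K"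
  using region by (simp add: bounds_region_def)

lemma compact_region: "compact \<Omega>"
  using region by (simp add: bounds_region_def)

section \<open>The uniform chord estimate\<close>

lemma curve_arg_eq:
  assumes "i < m" "j < m" "s \<in> {0..1}" "s' \<in> {0..1}" "K i s = K j s'"
  shows "i = j \<and> s' - s \<in> {-1, 0, 1}"
proof -
  \<comment> \<open>The closed interval contains both ends of a period, whereas \<open>K_inj\<close>
    concerns the half-open one; this is where the differences \<open>-1\<close> and \<open>1\<close>
    arise.\<close>
  define r where "r t = (if t = 1 then 0 else t)" for t :: real
  have r: "K k (r t) = K k t" if "k < m" for k t
    using K_one[OF that] by (simp add: r_def)
  have "r s \<in> {0..<1}" "r s' \<in> {0..<1}" using assms by (auto simp: r_def)
  moreover have "K i (r s) = K j (r s')" using r assms by simp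
  ultimately have "(i, r s) = (j, r s')"
    using inj_onD[OF K_inj, of "(i, r s)" "(j, r s')"] assms(1,2) by simp
  then show ?thesis by (auto simp: r_def split: if_splits)
qed

text \<open>Taylor expansion: the first-order part of the chord is parallel to the tangent and drops
  out of \<open>cr\<close>, which leaves a term of order \<open>h^2\<close>. For small
  \<open>h\<close> the chord has length at least \<open>c / 2 * |h|\<close>, so \<open>h^2\<close>
  can be exchanged for the squared length.\<close>

lemma chord_local:
  assumes i: "i < m"
  obtains \<delta> C where "\<delta> > 0" "C \<ge> 0"
    "\<And>s h. s \<in> {0..1} \<Longrightarrow> \<bar>h\<bar> < \<delta> \<Longrightarrow>
       \<bar>cr (K i (s + h) - K i s) (K' i s)\<bar> \<le> C * (norm (K i (s + h) - K i s))\<^sup>2"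
proof -
  obtain A where A: "\<And>x. x \<in> {-1..2} \<Longrightarrow> norm (K'' i x) \<le> A"
    using continuous_bounded_compact[OF continuous_on_subset[OF K''_cont[OF i]], of "{-1..2}"] by (metis compact_Icc subset_UNIV)
  obtain N where N: "\<And>x. x \<in> {0..1} \<Longrightarrow> norm (K' i x) \<le> N"
    using continuous_bounded_compact[OF K'_cont[OF i], of "{0..1}"] by (metis compact_Icc)
  obtain s0 where s0: "s0 \<in> {0..1}" "\<And>s. s \<in> {0..1} \<Longrightarrow> norm (K' i s0) \<le> norm (K' i s)"
    using continuous_attains_inf[of "{0..1::real}" "\<lambda>s. norm (K' i s)", OF _ _ continuous_on_norm[OF K'_cont[OF i]]]
    by auto
  define c where "c = norm (K' i s0)"
  have c: "c > 0" using K'_nonzero[OF i] by (simp add: c_def)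
  have A0: "A \<ge> 0" using order_trans[OF norm_ge_zero A[of 0]] by simp
  have N0: "N \<ge> 0" using order_trans[OF norm_ge_zero N[of 0]] by simp
  \<comment> \<open>The bound \<open>1/2\<close> keeps \<open>s + h\<close> inside
    \<open>{-1..2}\<close>, where \<open>A\<close> bounds \<open>K''\<close>; the other one makes
    the second-order error \<open>3 * A * h^2\<close> at most half of \<open>c * |h|\<close>. The
    \<open>+ 1\<close> covers \<open>A = 0\<close>.\<close>
  define \<delta> where "\<delta> = min (1/2) (c / (8 * A + 1))"
  have \<delta>: "\<delta> > 0" "\<delta> \<le> 1/2" "A * \<delta> * 8 \<le> c"
  proof -
    show "\<delta> > 0" using c A0 by (simp add: \<delta>_def)
    show "\<delta> \<le> 1/2" unfolding \<delta>_def by (rule min.cobounded1)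
    have "\<delta> * (8 * A + 1) \<le> c / (8 * A + 1) * (8 * A + 1)"
      using A0 by (intro mult_right_mono) (auto simp: \<delta>_def)
    also have "\<dots> = c" using A0 by simp
    finally have "\<delta> * (8 * A) + \<delta> \<le> c" by (simp add: algebra_simps)
    with \<open>\<delta> > 0\<close> have "\<delta> * (8 * A) \<le> c" by linarith
    then show "A * \<delta> * 8 \<le> c" by (simp add: ac_simps)
  qed
  have lin: "norm (K i (s + h) - K i s - h *\<^sub>R K' i s) \<le> 3 * A * h\<^sup>2" if s: "s \<in> {0..1}" and h: "\<bar>h\<bar> < \<delta>" for s h
  proof -
    have seg: "closed_segment s x \<subseteq> {-1..2}" if "x \<in> closed_segment s (s + h)" for x
      using that s h \<delta> by (auto simp: closed_segment_eq_real_ivl split: if_splits)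
    \<comment> \<open>\<open>K''\<close> is at most \<open>A\<close> at \<open>s\<close> and differs
      from that value by at most \<open>2 * A\<close>, whence the factor \<open>3\<close>.\<close>
    have d: "norm (K' i x - K' i s) \<le> 3 * A * \<bar>h\<bar>" if x: "x \<in> closed_segment s (s + h)" for x
    proof -
      have "norm (K' i x - K' i s - (x - s) *\<^sub>R K'' i s) \<le> norm (x - s) * (2 * A)"
      proof (rule vector_differentiable_bound_linearization[where S = "{-1..2}"])
        show "(K' i has_vector_derivative K'' i y) (at y within {- 1..2})" for y
          using K'_deriv[OF i] has_vector_derivative_at_within by blast
        show "closed_segment s x \<subseteq> {- 1..2}" using seg[OF x] .
        show "s \<in> {-1..2}" using s by auto
        show "norm (K'' i y - K'' i s) \<le> 2 * A" if "y \<in> {-1..2}" for y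
          using norm_triangle_ineq4[of "K'' i y" "K'' i s"] A[OF that] A[of s] s by auto
      qed
      moreover have "norm ((x - s) *\<^sub>R K'' i s) \<le> \<bar>x - s\<bar> * A"
        using A[of s] s by (auto intro: mult_left_mono)
      ultimately have "norm (K' i x - K' i s) \<le> \<bar>x - s\<bar> * (3 * A)"
        using norm_triangle_ineq[of "K' i x - K' i s - (x - s) *\<^sub>R K'' i s" "(x - s) *\<^sub>R K'' i s"] by simp
      also have "\<dots> \<le> \<bar>h\<bar> * (3 * A)"
        using x A0 by (intro mult_right_mono) (auto simp: closed_segment_eq_real_ivl split: if_splits)
      finally show ?thesis by (simp add: ac_simps)
    qed
    have "norm (K i (s + h) - K i s - (s + h - s) *\<^sub>R K' i s) \<le> norm (s + h - s) * (3 * A * \<bar>h\<bar>)"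
      by (rule vector_differentiable_bound_linearization[where S = "closed_segment s (s + h)"])
         (use K_deriv[OF i] has_vector_derivative_at_within d in blast)+
    then show ?thesis by (simp add: power2_eq_square ac_simps abs_mult_self_eq)
  qed
  \<comment> \<open>Chosen such that \<open>3 * A * h^2 * N\<close> equals \<open>C\<close> times
    the square of the lower bound \<open>c / 2 * |h|\<close> for the chord.\<close>
  define C where "C = 12 * A * N / c\<^sup>2"
  show thesis
  proof (rule that[OF \<delta>(1), of C])
    show "C \<ge> 0" using A0 N0 by (simp add: C_def)
    fix s h :: real assume s: "s \<in> {0..1}" and h: "\<bar>h\<bar> < \<delta>"
    let ?w = "K i (s + h) - K i s"
    have "c * \<bar>h\<bar> \<le> norm (h *\<^sub>R K' i s)"
      using s0(2)[OF s] by (simp add: c_def mult.commute mult_left_mono)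
    also have "\<dots> \<le> norm ?w + norm (?w - h *\<^sub>R K' i s)"
      using norm_triangle_ineq4[of ?w "?w - h *\<^sub>R K' i s"] by simp
    also have "\<dots> \<le> norm ?w + 3 * A * h\<^sup>2" using lin[OF s h] by simp
    also have "3 * A * h\<^sup>2 \<le> (c / 2) * \<bar>h\<bar>"
    proof -
      have "3 * A * \<bar>h\<bar> \<le> 3 * A * \<delta>" using h A0 by (intro mult_left_mono) auto
      also have "\<dots> \<le> c / 2" using \<delta>(3) c by linarith
      finally have "3 * A * \<bar>h\<bar> * \<bar>h\<bar> \<le> (c/2) * \<bar>h\<bar>" by (rule mult_right_mono) simp
      then show ?thesis by (simp add: power2_eq_square abs_mult_self_eq mult.assoc)
    qed
    finally have w: "(c / 2) * \<bar>h\<bar> \<le> norm ?w" by simp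
    then have w2: "(c/2)\<^sup>2 * h\<^sup>2 \<le> (norm ?w)\<^sup>2"
      using power_mono[OF w, of 2] c unfolding power_mult_distrib by simp

    have "cr ?w (K' i s) = cr (?w - h *\<^sub>R K' i s) (K' i s)"
      by (simp add: cr_def algebra_simps)
    then have "\<bar>cr ?w (K' i s)\<bar> \<le> norm (?w - h *\<^sub>R K' i s) * norm (K' i s)"
      using abs_cr_le by simp
    also have "\<dots> \<le> (3 * A * h\<^sup>2) * N"
      using lin[OF s h] N[OF s] A0 by (intro mult_mono) auto
    also have "\<dots> = C * ((c/2)\<^sup>2 * h\<^sup>2)"
      using c by (simp add: C_def power2_eq_square)
    also have "\<dots> \<le> C * (norm ?w)\<^sup>2"
      using w2 \<open>C \<ge> 0\<close> by (rule mult_left_mono)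
    finally show "\<bar>cr ?w (K' i s)\<bar> \<le> C * (norm ?w)\<^sup>2" .
  qed
qed

text \<open>By injectivity the distance is positive on the compact set of parameter pairs that
  either belong to different components or stay \<open>\<delta>\<close> away from equality modulo
  the period, hence bounded below there. The shifts \<open>k\<close> occur because both ends of the
  parameter interval give the same point.\<close>

lemma separated_pair:
  assumes ij: "i < m" "j < m" and \<delta>: "\<delta> > 0"
  obtains \<rho> where "\<rho> > 0"
    "\<And>s s'. s \<in> {0..1} \<Longrightarrow> s' \<in> {0..1} \<Longrightarrow> norm (K j s' - K i s) \<le> \<rho> \<Longrightarrow>
       i = j \<and> (\<exists>k\<in>{-1, 0, 1}. \<bar>s' - s - of_int k\<bar> < \<delta>)"
proof -
  define T where "T = ({0..1} \<times> {0..1}) \<inter> {p. i = j \<longrightarrow> (\<forall>k\<in>{-1, 0, 1}. \<delta> \<le> \<bar>snd p - fst p - of_int k\<bar>)}"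
  have "closed {p :: real \<times> real. i = j \<longrightarrow> (\<forall>k\<in>{-1, 0, 1}. \<delta> \<le> \<bar>snd p - fst p - of_int k\<bar>)}"
    by (cases "i = j") (auto intro!: closed_Collect_conj closed_Collect_le continuous_intros)
  then have T: "compact T"
    unfolding T_def by (intro compact_Int_closed compact_Times) auto
  have cont: "continuous_on T (\<lambda>p. norm (K j (snd p) - K i (fst p)))"
    by (intro continuous_intros continuous_on_compose2[OF K_cont[OF ij(1), of UNIV]] continuous_on_compose2[OF K_cont[OF ij(2), of UNIV]]) auto
  show thesis
  proof (cases "T = {}")
    case True
    show thesis
    proof (rule that[of 1])
      fix s s' :: real assume "s \<in> {0..1}" "s' \<in> {0..1}"
      moreover have "(s, s') \<notin> T" using True by simp
      ultimately show "i = j \<and> (\<exists>k\<in>{-1, 0, 1}. \<bar>s' - s - of_int k\<bar> < \<delta>)"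
        by (auto simp: T_def not_le)
    qed simp
  next
    case False
    obtain p where p: "p \<in> T" "\<And>q. q \<in> T \<Longrightarrow> norm (K j (snd p) - K i (fst p)) \<le> norm (K j (snd q) - K i (fst q))"
      using continuous_attains_inf[OF T False cont] by blast
    define d where "d = norm (K j (snd p) - K i (fst p))"
    have "d > 0"
    proof (rule ccontr)
      assume "\<not> d > 0"
      then have "K i (fst p) = K j (snd p)" by (simp add: d_def)
      moreover have "fst p \<in> {0..1}" "snd p \<in> {0..1}" using p(1) by (auto simp: T_def)
      ultimately have "i = j \<and> snd p - fst p \<in> {-1, 0, 1}"
        by (intro curve_arg_eq[OF ij])
      then show False using p(1) \<delta> by (auto simp: T_def)
    qed
    show thesis
    proof (rule that[of "d/2"])
      fix s s' :: real assume s: "s \<in> {0..1}" "s' \<in> {0..1}" "norm (K j s' - K i s) \<le> d/2"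
      have "(s, s') \<notin> T"
      proof
        assume "(s, s') \<in> T"
        from p(2)[OF this] have "d \<le> norm (K j s' - K i s)" by (simp add: d_def)
        with s(3) \<open>d > 0\<close> show False by linarith
      qed
      with s show "i = j \<and> (\<exists>k\<in>{-1, 0, 1}. \<bar>s' - s - of_int k\<bar> < \<delta>)"
        by (auto simp: T_def not_le)
    qed (use \<open>d > 0\<close> in simp)
  qed
qed

text \<open>By \<open>separated_pair\<close>, a curve point close to \<open>K i s\<close> has a
  parameter on the same component close to \<open>s\<close> modulo the period, so the local estimate
  reaches the whole curve. There are finitely many components, hence a common radius and a common
  constant.\<close>

lemma chord_global:
  obtains \<rho> C where "\<rho> > 0" "C \<ge> 0"
    "\<And>i s x. i < m \<Longrightarrow> s \<in> {0..1} \<Longrightarrow> x \<in> curve_image m K \<Longrightarrow> norm (x - K i s) \<le> \<rho> \<Longrightarrow>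
       \<bar>cr (x - K i s) (K' i s)\<bar> \<le> C * (norm (x - K i s))\<^sup>2"
proof -
  have "\<forall>i\<in>{..<m}. \<exists>p. fst p > 0 \<and> snd p \<ge> 0 \<and> (\<forall>s h. s \<in> {0..1} \<longrightarrow> \<bar>h\<bar> < fst p \<longrightarrow>
       \<bar>cr (K i (s + h) - K i s) (K' i s)\<bar> \<le> snd p * (norm (K i (s + h) - K i s))\<^sup>2)"
  proof
    fix i assume "i \<in> {..<m}"
    then have "i < m" by simp
    obtain \<delta> C where "\<delta> > 0" "C \<ge> 0"
      "\<And>s h. s \<in> {0..1} \<Longrightarrow> \<bar>h\<bar> < \<delta> \<Longrightarrow>
         \<bar>cr (K i (s + h) - K i s) (K' i s)\<bar> \<le> C * (norm (K i (s + h) - K i s))\<^sup>2"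
      using chord_local[OF \<open>i < m\<close>] by blast
    then show "\<exists>p. fst p > 0 \<and> snd p \<ge> 0 \<and> (\<forall>s h. s \<in> {0..1} \<longrightarrow> \<bar>h\<bar> < fst p \<longrightarrow>
       \<bar>cr (K i (s + h) - K i s) (K' i s)\<bar> \<le> snd p * (norm (K i (s + h) - K i s))\<^sup>2)"
      by (intro exI[of _ "(\<delta>, C)"]) simp
  qed
  then obtain p where p: "\<And>i. i < m \<Longrightarrow> fst (p i) > 0" "\<And>i. i < m \<Longrightarrow> snd (p i) \<ge> (0::real)"
    "\<And>i s h. i < m \<Longrightarrow> s \<in> {0..1} \<Longrightarrow> \<bar>h\<bar> < fst (p i) \<Longrightarrow>
       \<bar>cr (K i (s + h) - K i s) (K' i s)\<bar> \<le> snd (p i) * (norm (K i (s + h) - K i s))\<^sup>2"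
    unfolding bchoice_iff by (elim exE) (rule that, auto)
  define C where "C = (\<Sum>i<m. snd (p i))"
  have C: "C \<ge> 0" "\<And>i. i < m \<Longrightarrow> snd (p i) \<le> C"
    unfolding C_def using p(2) by (auto intro!: sum_nonneg member_le_sum)
  have ev: "\<forall>\<^sub>F \<rho> in at_right 0. \<forall>s s'. s \<in> {0..1} \<longrightarrow> s' \<in> {0..1} \<longrightarrow> norm (K j s' - K i s) \<le> \<rho> \<longrightarrow>
       i = j \<and> (\<exists>k\<in>{-1, 0, 1}. \<bar>s' - s - of_int k\<bar> < fst (p i))" if "i < m" "j < m" for i j
  proof -
    note ij = that
    obtain \<rho> where \<rho>: "\<rho> > 0" "\<And>s s'. s \<in> {0..1} \<Longrightarrow> s' \<in> {0..1} \<Longrightarrow> norm (K j s' - K i s) \<le> \<rho> \<Longrightarrow>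
       i = j \<and> (\<exists>k\<in>{-1, 0, 1}. \<bar>s' - s - of_int k\<bar> < fst (p i))"
      using separated_pair[OF ij p(1)[OF ij(1)]] by blast
    show ?thesis
      unfolding eventually_at_right_field
      by (rule exI[of _ \<rho>]) (use \<rho> in \<open>auto intro: \<rho>(2)\<close>)
  qed
  have "\<forall>\<^sub>F \<rho> in at_right 0. \<forall>i\<in>{..<m}. \<forall>j\<in>{..<m}. \<forall>s s'. s \<in> {0..1} \<longrightarrow> s' \<in> {0..1} \<longrightarrow> norm (K j s' - K i s) \<le> \<rho> \<longrightarrow>
       i = j \<and> (\<exists>k\<in>{-1, 0, 1}. \<bar>s' - s - of_int k\<bar> < fst (p i))"
    by (intro eventually_ball_finite ballI ev) auto
  then obtain b where b: "b > (0::real)" "\<And>\<rho>. 0 < \<rho> \<Longrightarrow> \<rho> < b \<Longrightarrow> \<forall>i\<in>{..<m}. \<forall>j\<in>{..<m}. \<forall>s s'. s \<in> {0..1} \<longrightarrow> s' \<in> {0..1} \<longrightarrow> norm (K j s' - K i s) \<le> \<rho> \<longrightarrow>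
       i = j \<and> (\<exists>k\<in>{-1, 0, 1}. \<bar>s' - s - of_int k\<bar> < fst (p i))"
    unfolding eventually_at_right_field by auto
  show thesis
  proof (rule that[of "b/2" C])
    show "b / 2 > 0" using b by simp
    show "C \<ge> 0" by fact
    fix i s x assume i: "i < m" and s: "s \<in> {0..1}" and x: "x \<in> curve_image m K" and le: "norm (x - K i s) \<le> b/2"
    obtain j s' where j: "j < m" "s' \<in> {0..1}" "x = K j s'"
      using x unfolding curve_image_eq by auto
    have "i = j \<and> (\<exists>k\<in>{-1, 0, 1}. \<bar>s' - s - of_int k\<bar> < fst (p i))"
      using b(2)[of "b/2"] b(1) i j s le by simp
    then obtain k where k: "i = j" "\<bar>s' - s - of_int k\<bar> < fst (p i)"
      by blast
    \<comment> \<open>Periodicity moves the parameter of \<open>x\<close> next to \<open>s\<close>,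
      possibly out of \<open>{0..1}\<close>; \<open>chord_local\<close> bounds only the
      increment.\<close>
    have "x = K i (s + (s' - s - of_int k))"
      using K_periodic_int[OF i, of s' "-k"] j k by (simp add: algebra_simps)
    then have "\<bar>cr (x - K i s) (K' i s)\<bar> \<le> snd (p i) * (norm (x - K i s))\<^sup>2"
      using p(3)[OF i s k(2)] by simp
    also have "\<dots> \<le> C * (norm (x - K i s))\<^sup>2"
      using C(2)[OF i] by (rule mult_right_mono) simp
    finally show "\<bar>cr (x - K i s) (K' i s)\<bar> \<le> C * (norm (x - K i s))\<^sup>2" .
  qed
qed

text \<open>Fixed once for the whole domain, because the definitions of \<open>good\<close> and
  \<open>grazing\<close> refer to these constants.\<close>

definition chord_consts :: "real \<times> real" where
  "chord_consts = (SOME p. fst p > 0 \<and> snd p \<ge> 0 \<and>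
    (\<forall>i s x. i < m \<longrightarrow> s \<in> {0..1} \<longrightarrow> x \<in> curve_image m K \<longrightarrow> norm (x - K i s) \<le> fst p \<longrightarrow>
       \<bar>cr (x - K i s) (K' i s)\<bar> \<le> snd p * (norm (x - K i s))\<^sup>2))"

definition "\<rho>0 = fst chord_consts"
definition "C0 = snd chord_consts"

lemma chord:
  "\<rho>0 > 0" "C0 \<ge> 0"
  "i < m \<Longrightarrow> s \<in> {0..1} \<Longrightarrow> x \<in> curve_image m K \<Longrightarrow> norm (x - K i s) \<le> \<rho>0 \<Longrightarrow>
       \<bar>cr (x - K i s) (K' i s)\<bar> \<le> C0 * (norm (x - K i s))\<^sup>2"
proof -
  have "\<exists>p. fst p > 0 \<and> snd p \<ge> 0 \<and>
    (\<forall>i s x. i < m \<longrightarrow> s \<in> {0..1} \<longrightarrow> x \<in> curve_image m K \<longrightarrow> norm (x - K i s) \<le> fst p \<longrightarrow>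
       \<bar>cr (x - K i s) (K' i s)\<bar> \<le> snd p * (norm (x - K i s))\<^sup>2)"
  proof -
    obtain \<rho> C where "\<rho> > 0" "C \<ge> 0"
      "\<And>i s x. i < m \<Longrightarrow> s \<in> {0..1} \<Longrightarrow> x \<in> curve_image m K \<Longrightarrow> norm (x - K i s) \<le> \<rho> \<Longrightarrow>
         \<bar>cr (x - K i s) (K' i s)\<bar> \<le> C * (norm (x - K i s))\<^sup>2"
      using chord_global by blast
    then show ?thesis by (intro exI[of _ "(\<rho>, C)"]) simp
  qed
  from someI_ex[OF this] show "\<rho>0 > 0" "C0 \<ge> 0"
    "i < m \<Longrightarrow> s \<in> {0..1} \<Longrightarrow> x \<in> curve_image m K \<Longrightarrow> norm (x - K i s) \<le> \<rho>0 \<Longrightarrow>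
       \<bar>cr (x - K i s) (K' i s)\<bar> \<le> C0 * (norm (x - K i s))\<^sup>2"
    unfolding chord_consts_def[symmetric] \<rho>0_def[symmetric] C0_def[symmetric] by blast+
qed

section \<open>Sides of the curve and transversal segments\<close>

lemma same_side:
  assumes "connected S" "S \<inter> curve_image m K = {}" "x \<in> S" "y \<in> S"
  shows "x \<in> \<Omega> \<longleftrightarrow> y \<in> \<Omega>"
  using connected_Int_frontier[OF assms(1), of \<Omega>] assms by (auto simp: frontier_region)

text \<open>
  The directions \<open>(1 - \<kappa>) w + \<kappa> N\<close> between \<open>w\<close> and a normal vector \<open>N\<close> on the same side stay
  uniformly transversal to the curve, so by the quadratic chord estimate the segments joining
  \<open>p + \<eta> w\<close> to \<open>p + \<eta> N\<close> miss the curve for small \<open>\<eta>\<close>.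
\<close>

lemma transversal_side:
  assumes i: "i < m" and s: "s \<in> {0..1}" and w: "cr (K' i s) w > 0" and \<sigma>: "\<sigma> = 1 \<or> \<sigma> = -1"
  shows "\<forall>\<^sub>F \<eta> in at_right 0. K i s + (\<eta> * \<sigma>) *\<^sub>R w \<in> \<Omega> \<longleftrightarrow> \<sigma> = 1"
proof -
  define N where "N = rot90 (K' i s)"
  have N: "cr (K' i s) N > 0"
  proof -
    have "cr (K' i s) N = (norm (K' i s))\<^sup>2"
      unfolding norm_sq2 by (simp add: N_def rot90_def cr_def power2_eq_square)
    then show ?thesis using K'_nonzero[OF i] by simp
  qed
  define c where "c = min (cr (K' i s) w) (cr (K' i s) N)"
  define R where "R = norm w + norm N"
  have c: "c > 0" using w N by (simp add: c_def)
  have "N \<noteq> 0" using N by (auto simp: cr_def)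
  then have R: "R > 0" by (auto simp: R_def intro: add_nonneg_pos)
  \<comment> \<open>Below \<open>\<rho>0 / R\<close> the path \<open>f\<close> stays within reach of
    the chord estimate; below the second bound a curve point on it would give
    \<open>c \<le> \<eta> * (C0 * R^2) < c\<close>. The \<open>+ 1\<close> covers
    \<open>C0 = 0\<close>.\<close>
  define \<eta>0 where "\<eta>0 = min (\<rho>0 / R) (c / (C0 * R\<^sup>2 + 1))"
  have \<eta>0: "\<eta>0 > 0" using c R chord(1,2) by (auto simp: \<eta>0_def intro!: divide_pos_pos add_nonneg_pos)
  have 1: "\<forall>\<^sub>F \<eta> in at_right 0. K i s + \<eta> *\<^sub>R N \<in> \<Omega> \<and> K i s - \<eta> *\<^sub>R N \<notin> \<Omega>"
    using region i vector_derivative_at[OF K_deriv[OF i]] unfolding bounds_region_def N_def by auto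
  have 2: "\<forall>\<^sub>F \<eta> in at_right 0. 0 < \<eta> \<and> \<eta> < \<eta>0"
    using \<eta>0 by (auto simp: eventually_at_right_field)
  from 1 2 show ?thesis
  proof eventually_elim
    case (elim \<eta>)
    define f where "f \<kappa> = K i s + (\<eta> * \<sigma>) *\<^sub>R ((1 - \<kappa>) *\<^sub>R w + \<kappa> *\<^sub>R N)" for \<kappa> :: real
    have "f ` {0..1} \<inter> curve_image m K = {}"
    proof (rule ccontr)
      assume "f ` {0..1} \<inter> curve_image m K \<noteq> {}"
      then obtain \<kappa> where \<kappa>: "\<kappa> \<in> {0..1}" "f \<kappa> \<in> curve_image m K" by blast
      define d where "d = (1 - \<kappa>) *\<^sub>R w + \<kappa> *\<^sub>R N"
      have fd: "f \<kappa> - K i s = (\<eta> * \<sigma>) *\<^sub>R d" by (simp add: f_def d_def)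
      have "norm d \<le> (1 - \<kappa>) * norm w + \<kappa> * norm N"
        unfolding d_def using \<kappa> by (intro order_trans[OF norm_triangle_ineq]) simp
      also have "\<dots> \<le> R"
        unfolding R_def using \<kappa> by (intro add_mono mult_left_le_one_le) auto
      finally have dR: "norm d \<le> R" .
      have nf: "norm (f \<kappa> - K i s) = \<eta> * norm d" unfolding fd using \<sigma> elim by auto
      have "\<eta> * norm d \<le> \<eta> * R" using dR elim by (intro mult_left_mono) auto
      also have "\<dots> \<le> \<rho>0" using elim R by (auto simp: \<eta>0_def field_simps)
      finally have "norm (f \<kappa> - K i s) \<le> \<rho>0" unfolding nf .
      from chord(3)[OF i s \<kappa>(2) this] have "\<bar>cr (f \<kappa> - K i s) (K' i s)\<bar> \<le> C0 * (\<eta> * norm d)\<^sup>2"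
        unfolding nf .
      also have "\<dots> \<le> C0 * (\<eta> * R)\<^sup>2"
        using dR elim chord(2) by (intro mult_left_mono power_mono) auto
      also have "\<bar>cr (f \<kappa> - K i s) (K' i s)\<bar> = \<eta> * \<bar>cr (K' i s) d\<bar>"
      proof -
        have "cr (f \<kappa> - K i s) (K' i s) = - (\<eta> * \<sigma>) * cr (K' i s) d"
          unfolding fd by (simp add: cr_def algebra_simps)
        then show ?thesis using \<sigma> elim by (auto simp: abs_mult)
      qed
      finally have "\<eta> * \<bar>cr (K' i s) d\<bar> \<le> \<eta> * (\<eta> * (C0 * R\<^sup>2))"
        by (simp add: power2_eq_square ac_simps)
      then have le: "\<bar>cr (K' i s) d\<bar> \<le> \<eta> * (C0 * R\<^sup>2)" using elim by simp
      \<comment> \<open>Both \<open>w\<close> and \<open>N\<close> have cross product at least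
        \<open>c\<close> with the tangent, and so has their convex combination
        \<open>d\<close>.\<close>
      have "c = (1 - \<kappa>) * c + \<kappa> * c" by (simp add: algebra_simps)
      also have "\<dots> \<le> (1 - \<kappa>) * cr (K' i s) w + \<kappa> * cr (K' i s) N"
        using \<kappa> by (intro add_mono mult_left_mono) (auto simp: c_def)
      also have "\<dots> = cr (K' i s) d" by (simp add: d_def cr_def algebra_simps)
      also have "\<dots> \<le> \<eta> * (C0 * R\<^sup>2)" using le by simp
      also have "\<dots> < c"
      proof -
        have "\<eta> * (C0 * R\<^sup>2 + 1) < c"
          using elim chord(2) by (auto simp: \<eta>0_def pos_less_divide_eq add_nonneg_pos)
        then show ?thesis using elim by (simp add: algebra_simps)
      qed
      finally show False by simp
    qed
    moreover have "connected (f ` {0..1})"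
      unfolding f_def by (intro connected_continuous_image continuous_intros) auto
    ultimately have "f 0 \<in> \<Omega> \<longleftrightarrow> f 1 \<in> \<Omega>"
      by (intro same_side) auto
    moreover have "f 1 \<in> \<Omega> \<longleftrightarrow> \<sigma> = 1"
      using \<sigma> elim by (auto simp: f_def)
    ultimately show ?case by (simp add: f_def)
  qed
qed

text \<open>Near \<open>K i s\<close> the side is known from \<open>transversal_side\<close>, and it
  cannot change along a segment that does not return to the curve. The sign \<open>\<sigma>\<close>
  turns \<open>w\<close> to the left, where that lemma applies.\<close>

lemma transversal_side_segment:
  assumes i: "i < m" and s: "s \<in> {0..1}" and w: "cr (K' i s) w \<noteq> 0"
    and miss: "\<And>\<alpha>. 0 < \<alpha> \<Longrightarrow> \<alpha> \<le> 1 \<Longrightarrow> K i s + \<alpha> *\<^sub>R w \<notin> curve_image m K"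
  shows "K i s + w \<in> \<Omega> \<longleftrightarrow> cr (K' i s) w > 0"
proof -
  define \<sigma> :: real where "\<sigma> = (if cr (K' i s) w > 0 then 1 else -1)"
  have \<sigma>: "\<sigma> = 1 \<or> \<sigma> = -1" "\<sigma> * \<sigma> = 1" by (auto simp: \<sigma>_def)
  have "cr (K' i s) (\<sigma> *\<^sub>R w) > 0"
    using w by (auto simp: \<sigma>_def cr_def algebra_simps)
  from transversal_side[OF i s this \<sigma>(1)]
  have 1: "\<forall>\<^sub>F \<eta> in at_right 0. K i s + \<eta> *\<^sub>R w \<in> \<Omega> \<longleftrightarrow> \<sigma> = 1"
    by (simp add: mult.assoc \<sigma>(2))
  have 2: "\<forall>\<^sub>F \<eta> in at_right 0. 0 < \<eta> \<and> \<eta> < (1::real)"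
    unfolding eventually_at_right_field by (intro exI[of _ 1]) auto
  have "\<exists>\<eta>. (K i s + \<eta> *\<^sub>R w \<in> \<Omega> \<longleftrightarrow> \<sigma> = 1) \<and> 0 < \<eta> \<and> \<eta> < 1"
    using eventually_happens[OF eventually_conj[OF 1 2]] by auto
  then obtain \<eta> where \<eta>: "K i s + \<eta> *\<^sub>R w \<in> \<Omega> \<longleftrightarrow> \<sigma> = 1" "0 < \<eta>" "\<eta> < 1" by blast
  have "K i s + \<eta> *\<^sub>R w \<in> \<Omega> \<longleftrightarrow> K i s + 1 *\<^sub>R w \<in> \<Omega>"
  proof (rule same_side)
    show "connected ((\<lambda>\<alpha>. K i s + \<alpha> *\<^sub>R w) ` {\<eta>..1})"
      by (intro connected_continuous_image continuous_intros) auto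
    show "(\<lambda>\<alpha>. K i s + \<alpha> *\<^sub>R w) ` {\<eta>..1} \<inter> curve_image m K = {}"
      using miss \<eta> by force
    show "K i s + 1 *\<^sub>R w \<in> (\<lambda>\<alpha>. K i s + \<alpha> *\<^sub>R w) ` {\<eta>..1}"
      using \<eta> by (intro imageI) simp
  qed (use \<eta> in auto)
  with \<eta> show ?thesis by (auto simp: \<sigma>_def split: if_splits)
qed

text \<open>Parameters at which \<open>v\<close> violates the bound of the chord estimate: if
  \<open>norm v \<le> \<rho>0\<close>, the segment from \<open>K i s - v\<close> to
  \<open>K i s + v\<close> then meets the curve only at \<open>K i s\<close>. Strict inequalities
  make the set open, as the substitution rule requires.\<close>

definition good :: "nat \<Rightarrow> real^2 \<Rightarrow> real set" where
  "good i v = {s. 0 < s \<and> s < 1 \<and> C0 * (norm v)\<^sup>2 < \<bar>cr v (K' i s)\<bar>}"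

text \<open>Moving by \<open>\<alpha> *\<^sub>R v\<close> scales the left side of the chord estimate
  by \<open>|\<alpha>|\<close> and the right side by its square. Since
  \<open>|\<alpha>| \<le> 1\<close>, a second curve point would contradict the threshold in
  \<open>good\<close>.\<close>

lemma good_miss:
  assumes i: "i < m" and s: "s \<in> good i v" and v: "norm v \<le> \<rho>0" and \<alpha>: "\<alpha> \<noteq> 0" "\<bar>\<alpha>\<bar> \<le> 1"
  shows "K i s + \<alpha> *\<^sub>R v \<notin> curve_image m K"
proof
  assume x: "K i s + \<alpha> *\<^sub>R v \<in> curve_image m K"
  have s01: "s \<in> {0..1}" using s by (simp add: good_def)
  have "norm (\<alpha> *\<^sub>R v) \<le> \<rho>0"
    using v \<alpha> by (auto intro: order_trans[OF mult_left_le_one_le])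
  then have "\<bar>cr (\<alpha> *\<^sub>R v) (K' i s)\<bar> \<le> C0 * (norm (\<alpha> *\<^sub>R v))\<^sup>2"
    using chord(3)[OF i s01 x] by simp
  moreover have "cr (\<alpha> *\<^sub>R v) (K' i s) = \<alpha> * cr v (K' i s)"
    by (simp add: cr_def algebra_simps)
  ultimately have "\<bar>\<alpha>\<bar> * \<bar>cr v (K' i s)\<bar> \<le> \<bar>\<alpha>\<bar> * (\<bar>\<alpha>\<bar> * (C0 * (norm v)\<^sup>2))"
    by (simp add: abs_mult power2_eq_square ac_simps)
  then have "\<bar>cr v (K' i s)\<bar> \<le> \<bar>\<alpha>\<bar> * (C0 * (norm v)\<^sup>2)" using \<alpha> by simp
  also have "\<dots> \<le> C0 * (norm v)\<^sup>2"
    using \<alpha> chord(2) by (intro mult_left_le_one_le) auto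
  finally show False using s by (simp add: good_def)
qed

text \<open>The segment from \<open>K i s - \<tau> *\<^sub>R v\<close> to its translate by
  \<open>v\<close> crosses the curve only at \<open>K i s\<close>, and transversally there; its ends
  therefore lie on opposite sides, decided by the sign of \<open>cr\<close>.\<close>

lemma good_sides:
  assumes i: "i < m" and s: "s \<in> good i v" and v: "norm v \<le> \<rho>0" and \<tau>: "0 < \<tau>" "\<tau> < 1"
  shows "K i s - \<tau> *\<^sub>R v \<in> \<Omega> \<longleftrightarrow> cr (K' i s) v < 0"
    and "K i s - \<tau> *\<^sub>R v + v \<in> \<Omega> \<longleftrightarrow> cr (K' i s) v > 0"
proof -
  have s01: "s \<in> {0..1}" using s by (simp add: good_def)
  have nz: "cr (K' i s) v \<noteq> 0"
  proof -
    have "\<bar>cr v (K' i s)\<bar> > 0" using s mult_nonneg_nonneg[OF chord(2) zero_le_power2[of "norm v"]]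
      by (auto simp: good_def)
    then show ?thesis by (auto simp: cr_def algebra_simps)
  qed
  have crs: "cr (K' i s) (a *\<^sub>R v) = a * cr (K' i s) v" for a by (simp add: cr_def algebra_simps)
  have "K i s + (-\<tau>) *\<^sub>R v \<in> \<Omega> \<longleftrightarrow> cr (K' i s) ((-\<tau>) *\<^sub>R v) > 0"
  proof (rule transversal_side_segment[OF i s01])
    show "cr (K' i s) ((-\<tau>) *\<^sub>R v) \<noteq> 0" using nz \<tau> unfolding crs by simp
    show "K i s + \<alpha> *\<^sub>R (- \<tau>) *\<^sub>R v \<notin> curve_image m K" if "0 < \<alpha>" "\<alpha> \<le> 1" for \<alpha>
    proof -
      have "\<alpha> * \<tau> \<le> 1" using that \<tau> by (simp add: mult_le_one)
      then show ?thesis using good_miss[OF i s v, of "- (\<alpha> * \<tau>)"] that \<tau> by (auto simp: abs_mult)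
    qed
  qed
  then show "K i s - \<tau> *\<^sub>R v \<in> \<Omega> \<longleftrightarrow> cr (K' i s) v < 0"
    unfolding crs using \<tau> by (simp add: mult_less_0_iff)
  have "K i s + (1-\<tau>) *\<^sub>R v \<in> \<Omega> \<longleftrightarrow> cr (K' i s) ((1-\<tau>) *\<^sub>R v) > 0"
  proof (rule transversal_side_segment[OF i s01])
    show "cr (K' i s) ((1-\<tau>) *\<^sub>R v) \<noteq> 0" using nz \<tau> unfolding crs by simp
    show "K i s + \<alpha> *\<^sub>R (1 - \<tau>) *\<^sub>R v \<notin> curve_image m K" if "0 < \<alpha>" "\<alpha> \<le> 1" for \<alpha>
    proof -
      have "\<alpha> * (1 - \<tau>) \<le> 1" using that \<tau> by (simp add: mult_le_one)
      then show ?thesis using good_miss[OF i s v, of "\<alpha> * (1 - \<tau>)"] that \<tau> by (auto simp: abs_mult)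
    qed
  qed
  then show "K i s - \<tau> *\<^sub>R v + v \<in> \<Omega> \<longleftrightarrow> cr (K' i s) v > 0"
    unfolding crs using \<tau> by (simp add: zero_less_mult_iff) (simp add: algebra_simps)
qed

text \<open>The point from which the segment in direction \<open>v\<close> reaches
  \<open>K i (p$1)\<close> after the fraction \<open>p$2\<close> of its length. Its Jacobian is
  \<open>cr v (K' i (p$1))\<close> up to sign, so crossings become areas.\<close>

definition sweep :: "nat \<Rightarrow> real^2 \<Rightarrow> real^2 \<Rightarrow> real^2" where
  "sweep i v p = K i (p$1) - (p$2) *\<^sub>R v"

definition goodp :: "nat \<Rightarrow> real^2 \<Rightarrow> (real^2) set" where
  "goodp i v = {p. p$1 \<in> good i v \<and> 0 < p$2 \<and> p$2 < 1}"

text \<open>Two representations of one point put two curve points on one segment in direction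
  \<open>v\<close>. By \<open>good_miss\<close> they must be the same curve point, reached after the
  same fraction; injectivity of the curve does the rest.\<close>

lemma sweep_inj:
  assumes "i < m" "j < m" "norm v \<le> \<rho>0" "p \<in> goodp i v" "q \<in> goodp j v" "sweep i v p = sweep j v q"
  shows "i = j \<and> p = q"
proof -
  have eq: "K i (p$1) + (q$2 - p$2) *\<^sub>R v = K j (q$1)"
    using assms(6) by (simp add: sweep_def algebra_simps)
  have pq2: "q$2 = p$2"
  proof (rule ccontr)
    assume "q$2 \<noteq> p$2"
    then have "K i (p$1) + (q$2 - p$2) *\<^sub>R v \<notin> curve_image m K"
      using assms by (intro good_miss) (auto simp: goodp_def)
    then show False using assms(2) unfolding eq by (auto simp: curve_image_def)
  qed
  have "(i, p$1) \<in> {..<m} \<times> {0..<1}" "(j, q$1) \<in> {..<m} \<times> {0..<1}"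
    using assms(1,2,4,5) by (auto simp: goodp_def good_def)
  moreover have "K i (p$1) = K j (q$1)" using eq pq2 by simp
  ultimately have "(i, p$1) = (j, q$1)"
    using inj_onD[OF K_inj, of "(i, p$1)" "(j, q$1)"] by simp
  with pq2 show ?thesis by (simp add: vec_eq_iff forall_2)
qed

lemma sides_differ_imp_sweep:
  assumes "(x \<in> \<Omega>) \<noteq> (x + v \<in> \<Omega>)"
  shows "\<exists>i<m. \<exists>p. p$1 \<in> {0..1} \<and> p$2 \<in> {0..1} \<and> x = sweep i v p"
proof -
  have "(\<lambda>\<tau>. x + \<tau> *\<^sub>R v) ` {0..1} \<inter> curve_image m K \<noteq> {}"
  proof
    assume *: "(\<lambda>\<tau>. x + \<tau> *\<^sub>R v) ` {0..1} \<inter> curve_image m K = {}"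
    have "connected ((\<lambda>\<tau>. x + \<tau> *\<^sub>R v) ` {0..1})"
      by (intro connected_continuous_image continuous_intros) auto
    moreover have "x + 0 *\<^sub>R v \<in> (\<lambda>\<tau>. x + \<tau> *\<^sub>R v) ` {0..1}" "x + 1 *\<^sub>R v \<in> (\<lambda>\<tau>. x + \<tau> *\<^sub>R v) ` {0..1}"
      by (intro imageI; simp)+
    ultimately have "x + 0 *\<^sub>R v \<in> \<Omega> \<longleftrightarrow> x + 1 *\<^sub>R v \<in> \<Omega>"
      using same_side * by blast
    with assms show False by simp
  qed
  then obtain \<tau> i s where "\<tau> \<in> {0..1}" "i < m" "s \<in> {0..1}" "x + \<tau> *\<^sub>R v = K i s"
    unfolding curve_image_eq by blast
  then show ?thesis
    by (intro exI[of _ i] conjI exI[of _ "vec2 s \<tau>"]) (auto simp: sweep_def algebra_simps)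
qed

end

section \<open>Translates of the domain and the planar energy\<close>

text \<open>The area formula as an inequality, without injectivity: a point covered several times
  counts once on the left, but each time on the right.\<close>

lemma emeasure_differentiable_image_le:
  fixes g :: "real^'n::{finite,wellorder} \<Rightarrow> real^'n::_"
  assumes S: "compact S" and der: "\<And>x. x \<in> S \<Longrightarrow> (g has_derivative g' x) (at x)"
    and d: "\<And>x. x \<in> S \<Longrightarrow> \<bar>det (matrix (g' x))\<bar> = d x" and dc: "continuous_on S d"
  shows "emeasure lborel (g ` S) \<le> (\<integral>\<^sup>+x\<in>S. ennreal (d x) \<partial>lborel)"
proof -
  have dpos: "d x \<ge> 0" if "x \<in> S" for x using d[OF that] by (metis abs_ge_zero)
  have gc: "continuous_on S g"
    using der by (intro continuous_at_imp_continuous_on) (auto intro: has_derivative_continuous)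
  have "compact (g ` S)" by (rule compact_continuous_image[OF gc S])
  have int: "set_integrable lborel S d"
    using borel_integrable_compact[OF S dc] by (simp add: set_integrable_def)
  have eq: "integral S d = integral S (\<lambda>x. \<bar>det (matrix (g' x))\<bar>)"
    by (rule integral_cong) (simp add: d)
  have "d integrable_on S" by (rule set_borel_integral_eq_integral(1)[OF int])
  then have int': "(\<lambda>x. \<bar>det (matrix (g' x))\<bar>) integrable_on S"
    by (rule integrable_eq) (simp add: d)
  have "measure lebesgue (g ` S) \<le> integral S d"
    unfolding eq using S der int'
    by (intro measure_differentiable_image)
       (auto intro: has_derivative_at_withinI fmeasurableD[OF lmeasurable_compact])
  also have "\<dots> = (LINT x:S|lborel. d x)"
    by (rule set_borel_integral_eq_integral(2)[OF int, symmetric])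
  finally have "ennreal (measure lebesgue (g ` S)) \<le> ennreal (LINT x:S|lborel. d x)"
    by (rule ennreal_leI)
  also have "ennreal (LINT x:S|lborel. d x) = (\<integral>\<^sup>+x. ennreal (indicator S x *\<^sub>R d x) \<partial>lborel)"
    unfolding set_lebesgue_integral_def
    by (rule nn_integral_eq_integral[symmetric]) (use int dpos in \<open>auto simp: set_integrable_def indicator_def\<close>)
  also have "\<dots> = (\<integral>\<^sup>+x\<in>S. ennreal (d x) \<partial>lborel)"
    by (intro nn_integral_cong) (auto simp: indicator_def)
  also have "ennreal (measure lebesgue (g ` S)) = emeasure lborel (g ` S)"
    using lmeasurable_compact[OF \<open>compact (g ` S)\<close>] compact_imp_closed[OF \<open>compact (g ` S)\<close>]
    by (simp add: emeasure_eq_measure2[symmetric] fmeasurable_def)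
  finally show ?thesis .
qed

lemma continuous_on_cr [continuous_intros]:
  assumes "continuous_on S f" "continuous_on S g"
  shows "continuous_on S (\<lambda>x. cr (f x) (g x))"
  unfolding cr_def by (intro continuous_intros assms)

lemma measurable_cr [measurable (raw)]:
  assumes [measurable]: "f \<in> borel_measurable M" "g \<in> borel_measurable M"
  shows "(\<lambda>x. cr (f x) (g x)) \<in> borel_measurable M"
proof -
  have "(\<lambda>p. cr (fst p) (snd p)) \<in> borel_measurable borel"
    by (intro borel_measurable_continuous_onI continuous_intros)
  then have "(\<lambda>x. (\<lambda>p. cr (fst p) (snd p)) (f x, g x)) \<in> borel_measurable M"
    by (rule measurable_compose[rotated]) measurable
  then show ?thesis by simp
qed

context planar_domain
begin

lemma measurable_region [measurable]: "\<Omega> \<in> sets borel"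
  using compact_region by (intro borel_closed compact_imp_closed)

lemma measurable_K' [measurable]: "i < m \<Longrightarrow> K' i \<in> borel_measurable borel"
  by (intro borel_measurable_continuous_onI K'_cont)

text \<open>
  \<open>2 * escape v\<close> is the area of the points separated from their translate by \<open>v\<close>, \<open>crossing v\<close> counts
  these points with the multiplicity of the crossings, and \<open>grazing v\<close> bounds the error.
\<close>

definition escape :: "real^2 \<Rightarrow> ennreal" where
  "escape v = (\<integral>\<^sup>+x. indicator \<Omega> x * indicator (- \<Omega>) (x + v) \<partial>lborel)"

definition crossing :: "real^2 \<Rightarrow> ennreal" where
  "crossing v = (\<Sum>i<m. \<integral>\<^sup>+s\<in>{0..1}. ennreal \<bar>cr v (K' i s)\<bar> \<partial>lborel)"

definition grazing :: "real^2 \<Rightarrow> ennreal" where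
  "grazing v = (\<Sum>i<m. \<integral>\<^sup>+s\<in>{0..1}. ennreal (if \<bar>cr v (K' i s)\<bar> \<le> C0 * (norm v)\<^sup>2 then \<bar>cr v (K' i s)\<bar> else 0) \<partial>lborel)"

lemma measurable_escape [measurable]: "escape \<in> borel_measurable borel"
  unfolding escape_def by measurable

lemma measurable_crossing [measurable]: "crossing \<in> borel_measurable borel"
  unfolding crossing_def by measurable

lemma measurable_grazing [measurable]: "grazing \<in> borel_measurable borel"
  unfolding grazing_def by measurable

lemma emeasure_region_finite: "emeasure lborel \<Omega> < \<infinity>"
  using emeasure_bounded_finite[OF compact_imp_bounded[OF compact_region]] by simp

lemma escape_le: "escape v \<le> emeasure lborel \<Omega>"
proof -
  have "escape v \<le> (\<integral>\<^sup>+x. indicator \<Omega> x \<partial>lborel)"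
    unfolding escape_def by (intro nn_integral_mono) (auto simp: indicator_def)
  then show ?thesis by simp
qed

abbreviation separated :: "real^2 \<Rightarrow> (real^2) set" where
  "separated v \<equiv> {x. (x \<in> \<Omega>) \<noteq> (x + v \<in> \<Omega>)}"

lemma measurable_sides_differ [measurable]: "separated v \<in> sets borel"
proof -
  have "Measurable.pred borel (\<lambda>x. (x \<in> \<Omega>) \<noteq> (x + v \<in> \<Omega>))" by measurable
  then show ?thesis by (simp add: pred_def)
qed

text \<open>A translation preserves area, so as much area enters the region as leaves it. Cancelling
  the common part \<open>a\<close> uses that the region has finite area.\<close>

lemma emeasure_sides_differ:
  "emeasure lborel (separated v) = 2 * escape v"
proof -
  define a where "a = (\<integral>\<^sup>+x. indicator \<Omega> x * indicator \<Omega> (x + v) \<partial>lborel)"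
  define b where "b = (\<integral>\<^sup>+x. indicator (- \<Omega>) x * indicator \<Omega> (x + v) \<partial>lborel)"
  have 1: "a + escape v = emeasure lborel \<Omega>"
  proof -
    have "a + escape v = (\<integral>\<^sup>+x. indicator \<Omega> x * indicator \<Omega> (x + v) + indicator \<Omega> x * indicator (- \<Omega>) (x + v) \<partial>lborel)"
      unfolding a_def escape_def by (rule nn_integral_add[symmetric]) measurable
    also have "\<dots> = (\<integral>\<^sup>+x. indicator \<Omega> x \<partial>lborel)"
      by (rule nn_integral_cong) (auto simp: indicator_def)
    finally show ?thesis by simp
  qed
  have 2: "a + b = emeasure lborel \<Omega>"
  proof -
    have "a + b = (\<integral>\<^sup>+x. indicator \<Omega> x * indicator \<Omega> (x + v) + indicator (- \<Omega>) x * indicator \<Omega> (x + v) \<partial>lborel)"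
      unfolding a_def b_def by (rule nn_integral_add[symmetric]) measurable
    also have "\<dots> = (\<integral>\<^sup>+x. indicator \<Omega> (v + x) \<partial>lborel)"
      by (rule nn_integral_cong) (auto simp: indicator_def add.commute)
    also have "\<dots> = (\<integral>\<^sup>+x. indicator \<Omega> x \<partial>lborel)"
      by (rule nn_integral_lborel_translate) measurable
    finally show ?thesis by simp
  qed
  have "a \<noteq> \<infinity>" using 1 emeasure_region_finite by auto
  then have "b = escape v" using 1 2 by (metis ennreal_add_left_cancel infinity_ennreal_def)
  moreover have "emeasure lborel (separated v) = escape v + b"
  proof -
    have "escape v + b = (\<integral>\<^sup>+x. indicator \<Omega> x * indicator (- \<Omega>) (x + v) + indicator (- \<Omega>) x * indicator \<Omega> (x + v) \<partial>lborel)"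
      unfolding b_def escape_def by (rule nn_integral_add[symmetric]) measurable
    also have "\<dots> = (\<integral>\<^sup>+x. indicator (separated v) x \<partial>lborel)"
      by (rule nn_integral_cong) (auto simp: indicator_def)
    finally show ?thesis using measurable_sides_differ by simp
  qed
  ultimately show ?thesis by (simp add: mult_2)
qed

lemma sweep_cont: "i < m \<Longrightarrow> continuous_on S (sweep i v)"
  unfolding sweep_def by (intro continuous_intros continuous_on_compose2[OF K_cont[of i UNIV]]) auto

lemma sweep_deriv:
  assumes "i < m"
  shows "(sweep i v has_derivative (\<lambda>h. h$1 *\<^sub>R K' i (p$1) - h$2 *\<^sub>R v)) (at p)"
proof -
  have nth: "((\<lambda>p. p $ j) has_derivative (\<lambda>h. h $ j)) (at p)" for j :: 2
    by (intro bounded_linear_imp_has_derivative bounded_linear_vec_nth)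
  have "(K i has_derivative (\<lambda>h. h *\<^sub>R K' i (p$1))) (at (p$1))"
    using K_deriv[OF assms] by (simp add: has_vector_derivative_def)
  from has_derivative_compose[OF nth this]
  show ?thesis unfolding sweep_def by (auto intro!: derivative_eq_intros nth)
qed

lemma sweep_det: "\<bar>det (matrix (\<lambda>h. h$1 *\<^sub>R K' i (p$1) - h$2 *\<^sub>R v))\<bar> = \<bar>cr v (K' i (p$1))\<bar>"
  by (simp add: det_matrix_2 axis_def cr_def algebra_simps)

text \<open>The images of the closed parameter square under \<open>sweep\<close> cover all separated
  points, and overlaps only enlarge the sum of their areas. The Jacobian does not depend on the
  fraction \<open>p$2\<close>, which contributes the factor \<open>1\<close>.\<close>

lemma sides_differ_le_crossing: "2 * escape v \<le> crossing v"
proof -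
  let ?Q = "{p::real^2. p$1 \<in> {0..1} \<and> p$2 \<in> {0..1}}"
  have Q: "compact ?Q"
  proof -
    have "?Q = cbox (vec2 0 0) (vec2 1 1)" by (auto simp: mem_box_cart forall_2)
    then show ?thesis by simp
  qed
  have [measurable]: "?Q \<in> sets borel" using Q by (intro borel_closed compact_imp_closed)
  have im [measurable]: "sweep i v ` ?Q \<in> sets borel" if "i < m" for i
    using compact_continuous_image[OF sweep_cont[OF that] Q] by (intro borel_closed compact_imp_closed)
  have un: "(\<Union>i<m. sweep i v ` ?Q) \<in> sets lborel"
    unfolding sets_lborel by (rule sets.finite_UN) (simp, rule im, simp)
  have "2 * escape v = emeasure lborel (separated v)"
    by (rule emeasure_sides_differ[symmetric])
  also have "\<dots> \<le> emeasure lborel (\<Union>i<m. sweep i v ` ?Q)"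
    using sides_differ_imp_sweep[of _ v] by (intro emeasure_mono un) blast
  also have "\<dots> \<le> (\<Sum>i<m. emeasure lborel (sweep i v ` ?Q))"
    using im by (intro emeasure_subadditive_finite image_subsetI) (simp_all del: atLeastAtMost_iff)
  also have "\<dots> \<le> crossing v"
    unfolding crossing_def
  proof (intro sum_mono)
    fix i assume "i \<in> {..<m}"
    then have i [measurable]: "i < m" by simp
    have "emeasure lborel (sweep i v ` ?Q) \<le> (\<integral>\<^sup>+p\<in>?Q. ennreal \<bar>cr v (K' i (p$1))\<bar> \<partial>lborel)"
      by (rule emeasure_differentiable_image_le[OF Q sweep_deriv[OF i] sweep_det])
         (intro continuous_intros continuous_on_compose2[OF K'_cont[OF i, of UNIV]], auto)
    also have "\<dots> = (\<integral>\<^sup>+s. \<integral>\<^sup>+t. ennreal \<bar>cr v (K' i s)\<bar> * indicator ?Q (vec2 s t) \<partial>lborel \<partial>lborel)"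
      by (subst nn_integral_vec2) auto
    also have "\<dots> = (\<integral>\<^sup>+s. \<integral>\<^sup>+t. (ennreal \<bar>cr v (K' i s)\<bar> * indicator {0..1} s) * indicator {0..1::real} t \<partial>lborel \<partial>lborel)"
      by (rule nn_integral_cong, rule nn_integral_cong) (auto simp: indicator_def)
    also have "\<dots> = (\<integral>\<^sup>+s\<in>{0..1}. ennreal \<bar>cr v (K' i s)\<bar> \<partial>lborel)"
      by (subst nn_integral_cmult) auto
    finally show "emeasure lborel (sweep i v ` ?Q) \<le> \<dots>" .
  qed
  finally show ?thesis .
qed

lemma good_open: "i < m \<Longrightarrow> open (good i v)"
  unfolding good_def
  by (intro open_Collect_conj open_Collect_less continuous_intros continuous_on_compose2[OF K'_cont[of i UNIV]]) auto

lemma goodp_open: "i < m \<Longrightarrow> open (goodp i v)"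
proof -
  assume i: "i < m"
  have "continuous_on UNIV (\<lambda>p::real^2. p$1)" by (intro continuous_intros)
  from open_vimage[OF good_open[OF i] this, of v] show ?thesis
    unfolding goodp_def by (intro open_Collect_conj open_Collect_less continuous_intros) (simp_all add: vimage_def)
qed

lemma sweep_inj_on: "i < m \<Longrightarrow> norm v \<le> \<rho>0 \<Longrightarrow> inj_on (sweep i v) (goodp i v)"
  using sweep_inj by (auto simp: inj_on_def)

lemma sweep_image_open: "i < m \<Longrightarrow> norm v \<le> \<rho>0 \<Longrightarrow> open (sweep i v ` goodp i v)"
  by (intro invariance_of_domain sweep_cont goodp_open sweep_inj_on)

lemma sweep_image_sides:
  assumes "i < m" "norm v \<le> \<rho>0" "x \<in> sweep i v ` goodp i v"
  shows "(x \<in> \<Omega>) \<noteq> (x + v \<in> \<Omega>)"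
proof -
  obtain p where p: "p \<in> goodp i v" "x = sweep i v p" using assms by auto
  have g: "p$1 \<in> good i v" "0 < p$2" "p$2 < 1" using p by (auto simp: goodp_def)
  have "cr (K' i (p$1)) v \<noteq> 0"
  proof -
    have "\<bar>cr v (K' i (p$1))\<bar> > 0"
      using g(1) mult_nonneg_nonneg[OF chord(2) zero_le_power2[of "norm v"]] by (auto simp: good_def)
    then show ?thesis by (auto simp: cr_def algebra_simps)
  qed
  then show ?thesis using good_sides[OF assms(1) g(1) assms(2) g(2,3)] p(2) by (auto simp: sweep_def)
qed

lemma disjoint_sweep:
  "norm v \<le> \<rho>0 \<Longrightarrow> disjoint_family_on (\<lambda>i. sweep i v ` goodp i v) {..<m}"
  using sweep_inj by (fastforce simp: disjoint_family_on_def)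

text \<open>On good parameters \<open>sweep\<close> is injective, so the integral of the Jacobian is
  exactly the area.\<close>

lemma emeasure_sweep_image:
  assumes i [measurable]: "i < m" and v: "norm v \<le> \<rho>0"
  shows "emeasure lborel (sweep i v ` goodp i v) = (\<integral>\<^sup>+s\<in>good i v. ennreal \<bar>cr v (K' i s)\<bar> \<partial>lborel)"
proof -
  have [measurable]: "sweep i v ` goodp i v \<in> sets borel" "goodp i v \<in> sets borel" "good i v \<in> sets borel"
    using sweep_image_open[OF i v] goodp_open[OF i] good_open[OF i] by auto
  have "emeasure lborel (sweep i v ` goodp i v) = (\<integral>\<^sup>+x\<in>sweep i v ` goodp i v. 1 \<partial>lborel)"
    by simp
  also have "\<dots> = (\<integral>\<^sup>+p\<in>goodp i v. ennreal \<bar>cr v (K' i (p$1))\<bar> * 1 \<partial>lborel)"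
    by (rule nn_integral_change_of_variables[OF goodp_open[OF i] sweep_cont[OF i] sweep_deriv[OF i] sweep_inj_on[OF i v] sweep_det])
       auto
  also have "\<dots> = (\<integral>\<^sup>+s. \<integral>\<^sup>+t. ennreal \<bar>cr v (K' i s)\<bar> * indicator (goodp i v) (vec2 s t) \<partial>lborel \<partial>lborel)"
    by (subst nn_integral_vec2) auto
  also have "\<dots> = (\<integral>\<^sup>+s. \<integral>\<^sup>+t. (ennreal \<bar>cr v (K' i s)\<bar> * indicator (good i v) s) * indicator {0<..<1::real} t \<partial>lborel \<partial>lborel)"
    by (rule nn_integral_cong, rule nn_integral_cong) (auto simp: indicator_def goodp_def)
  also have "\<dots> = (\<integral>\<^sup>+s\<in>good i v. ennreal \<bar>cr v (K' i s)\<bar> \<partial>lborel)"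
    by (subst nn_integral_cmult) auto
  finally show ?thesis .
qed

text \<open>Apart from the end points \<open>0\<close> and \<open>1\<close>, a null set, every
  parameter is either good or grazing.\<close>

lemma crossing_le_swept:
  assumes v: "norm v \<le> \<rho>0"
  shows "crossing v \<le> (\<Sum>i<m. emeasure lborel (sweep i v ` goodp i v)) + grazing v"
proof -
  have [measurable]: "sweep i v ` goodp i v \<in> sets borel" "good i v \<in> sets borel" if "i < m" for i
    using sweep_image_open[OF that v] good_open[OF that] by auto
  have "crossing v \<le> (\<Sum>i<m. (\<integral>\<^sup>+s\<in>good i v. ennreal \<bar>cr v (K' i s)\<bar> \<partial>lborel)
      + (\<integral>\<^sup>+s\<in>{0..1}. ennreal (if \<bar>cr v (K' i s)\<bar> \<le> C0 * (norm v)\<^sup>2 then \<bar>cr v (K' i s)\<bar> else 0) \<partial>lborel))"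
    unfolding crossing_def
  proof (intro sum_mono)
    fix i assume "i \<in> {..<m}"
    then have [measurable]: "i < m" by simp
    have "(\<integral>\<^sup>+s\<in>{0..1}. ennreal \<bar>cr v (K' i s)\<bar> \<partial>lborel)
      \<le> (\<integral>\<^sup>+s. ennreal \<bar>cr v (K' i s)\<bar> * indicator (good i v) s +
           ennreal (if \<bar>cr v (K' i s)\<bar> \<le> C0 * (norm v)\<^sup>2 then \<bar>cr v (K' i s)\<bar> else 0) * indicator {0..1} s \<partial>lborel)"
      using AE_lborel_singleton[of "0::real"] AE_lborel_singleton[of "1::real"]
      by (intro nn_integral_mono_AE, eventually_elim) (auto simp: indicator_def good_def)
    also have "\<dots> = (\<integral>\<^sup>+s\<in>good i v. ennreal \<bar>cr v (K' i s)\<bar> \<partial>lborel)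
      + (\<integral>\<^sup>+s\<in>{0..1}. ennreal (if \<bar>cr v (K' i s)\<bar> \<le> C0 * (norm v)\<^sup>2 then \<bar>cr v (K' i s)\<bar> else 0) \<partial>lborel)"
      by (rule nn_integral_add) measurable
    finally show "(\<integral>\<^sup>+s\<in>{0..1}. ennreal \<bar>cr v (K' i s)\<bar> \<partial>lborel) \<le> \<dots>" .
  qed
  also have "\<dots> = (\<Sum>i<m. emeasure lborel (sweep i v ` goodp i v)) + grazing v"
    unfolding grazing_def sum.distrib using v by (simp add: emeasure_sweep_image)
  finally show ?thesis .
qed

text \<open>The converse of \<open>sides_differ_le_crossing\<close> up to an error: the sets swept
  by good parameters are disjoint for different components and contain separated points
  only.\<close>

lemma crossing_le:
  assumes v: "norm v \<le> \<rho>0"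
  shows "crossing v \<le> 2 * escape v + grazing v"
proof -
  have [measurable]: "sweep i v ` goodp i v \<in> sets borel" if "i < m" for i
    using sweep_image_open[OF that v] by auto
  have "crossing v \<le> (\<Sum>i<m. emeasure lborel (sweep i v ` goodp i v)) + grazing v"
    by (rule crossing_le_swept[OF v])
  also have "\<dots> \<le> 2 * escape v + grazing v"
  proof (rule add_right_mono)
    have "(\<Sum>i<m. emeasure lborel (sweep i v ` goodp i v)) = emeasure lborel (\<Union>i<m. sweep i v ` goodp i v)"
      by (rule sum_emeasure) (use disjoint_sweep[OF v] in auto)
    also have "\<dots> \<le> emeasure lborel (separated v)"
      using sweep_image_sides[OF _ v] measurable_sides_differ
      by (intro emeasure_mono) (blast, simp)
    also have "\<dots> = 2 * escape v" by (rule emeasure_sides_differ)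
    finally show "(\<Sum>i<m. emeasure lborel (sweep i v ` goodp i v)) \<le> 2 * escape v" .
  qed
  finally show ?thesis .
qed


section \<open>Monotonicity and boundedness of the energy\<close>

definition arclength :: real where
  "arclength = (\<Sum>i<m. integral {0..1} (\<lambda>s. norm (K' i s)))"

lemma curve_length_eq: "curve_length m K = arclength"
  unfolding curve_length_def arclength_def using vector_derivative_at[OF K_deriv] by (intro sum.cong) simp_all

lemma arclength_nonneg: "arclength \<ge> 0"
  unfolding arclength_def by (intro sum_nonneg integral_nonneg integrable_continuous_real continuous_intros K'_cont) auto

lemma nn_integral_sum_swap:
  fixes h :: "real^2 \<Rightarrow> ennreal" and G :: "nat \<Rightarrow> real^2 \<Rightarrow> real \<Rightarrow> ennreal"
  assumes [measurable]: "h \<in> borel_measurable borel"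
    and G: "\<And>i. i < m \<Longrightarrow> (\<lambda>(v, s). G i v s) \<in> borel_measurable (lborel \<Otimes>\<^sub>M lborel)"
  shows "(\<integral>\<^sup>+v. h v * (\<Sum>i<m. \<integral>\<^sup>+s\<in>{0..1}. G i v s \<partial>lborel) \<partial>lborel)
    = (\<Sum>i<m. \<integral>\<^sup>+s\<in>{0..1}. (\<integral>\<^sup>+v. h v * G i v s \<partial>lborel) \<partial>lborel)"
proof -
  have [measurable]: "(\<lambda>p. G i (fst p) (snd p)) \<in> borel_measurable (lborel \<Otimes>\<^sub>M lborel)"
    "(\<lambda>p. G i (snd p) (fst p)) \<in> borel_measurable (lborel \<Otimes>\<^sub>M lborel)"
    "G i v \<in> borel_measurable lborel" "(\<lambda>v. G i v s) \<in> borel_measurable lborel" if "i < m" for i v s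
  proof -
    show *: "(\<lambda>p. G i (fst p) (snd p)) \<in> borel_measurable (lborel \<Otimes>\<^sub>M lborel)"
      using G[OF that] by (simp add: case_prod_beta')
    show "(\<lambda>p. G i (snd p) (fst p)) \<in> borel_measurable (lborel \<Otimes>\<^sub>M lborel)"
      using measurable_compose[OF measurable_pair_swap' *] by (simp add: case_prod_beta')
    show "G i v \<in> borel_measurable lborel" "(\<lambda>v. G i v s) \<in> borel_measurable lborel"
      using measurable_Pair2[OF G[OF that], of v] measurable_Pair1[OF G[OF that], of s] by simp_all
  qed
  have "(\<integral>\<^sup>+v. h v * (\<Sum>i<m. \<integral>\<^sup>+s\<in>{0..1}. G i v s \<partial>lborel) \<partial>lborel)
    = (\<Sum>i<m. \<integral>\<^sup>+v. h v * (\<integral>\<^sup>+s\<in>{0..1}. G i v s \<partial>lborel) \<partial>lborel)"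
    unfolding sum_distrib_left by (subst nn_integral_sum) auto
  also have "\<dots> = (\<Sum>i<m. \<integral>\<^sup>+s\<in>{0..1}. (\<integral>\<^sup>+v. h v * G i v s \<partial>lborel) \<partial>lborel)"
  proof (intro sum.cong refl)
    fix i assume "i \<in> {..<m}"
    then have i [measurable]: "i < m" by simp
    have "(\<integral>\<^sup>+v. h v * (\<integral>\<^sup>+s\<in>{0..1}. G i v s \<partial>lborel) \<partial>lborel)
      = (\<integral>\<^sup>+v. \<integral>\<^sup>+s. h v * (G i v s * indicator {0..1} s) \<partial>lborel \<partial>lborel)"
      by (intro nn_integral_cong nn_integral_cmult[symmetric]) measurable
    also have "\<dots> = (\<integral>\<^sup>+s. \<integral>\<^sup>+v. h v * (G i v s * indicator {0..1} s) \<partial>lborel \<partial>lborel)"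
      by (rule lborel_pair.Fubini') measurable
    also have "\<dots> = (\<integral>\<^sup>+s. \<integral>\<^sup>+v. (h v * G i v s) * indicator {0..1} s \<partial>lborel \<partial>lborel)"
      by (simp add: mult.assoc)
    also have "\<dots> = (\<integral>\<^sup>+s\<in>{0..1}. (\<integral>\<^sup>+v. h v * G i v s \<partial>lborel) \<partial>lborel)"
      by (rule nn_integral_cong, rule nn_integral_multc) measurable
    finally show "(\<integral>\<^sup>+v. h v * (\<integral>\<^sup>+s\<in>{0..1}. G i v s \<partial>lborel) \<partial>lborel) = \<dots>" .
  qed
  finally show ?thesis .
qed

lemma nn_integral_crossing:
  assumes "\<epsilon> > 0"
  shows "(\<integral>\<^sup>+v. far \<epsilon> v * crossing v \<partial>lborel) = ennreal (4 * arclength / \<epsilon>)"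
proof -
  have "(\<integral>\<^sup>+v. far \<epsilon> v * crossing v \<partial>lborel)
    = (\<Sum>i<m. \<integral>\<^sup>+s\<in>{0..1}. (\<integral>\<^sup>+v. far \<epsilon> v * ennreal \<bar>cr v (K' i s)\<bar> \<partial>lborel) \<partial>lborel)"
    unfolding crossing_def by (rule nn_integral_sum_swap) measurable
  also have "\<dots> = (\<Sum>i<m. \<integral>\<^sup>+s\<in>{0..1}. ennreal (4 * norm (K' i s) / \<epsilon>) \<partial>lborel)"
    unfolding nn_integral_cr_norm_power4[OF assms, symmetric]
    by (simp add: mult.assoc ennreal_mult'[symmetric])
  also have "\<dots> = (\<Sum>i<m. ennreal (integral {0..1} (\<lambda>s. 4 * norm (K' i s) / \<epsilon>)))"
  proof (intro sum.cong refl)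
    fix i assume "i \<in> {..<m}"
    then have i: "i < m" by simp
    have c: "continuous_on {0..1} (\<lambda>s. 4 * norm (K' i s) / \<epsilon>)"
      using assms by (intro continuous_intros K'_cont[OF i]) auto
    have int: "set_integrable lborel {0..1} (\<lambda>s. 4 * norm (K' i s) / \<epsilon>)"
      using borel_integrable_compact[OF _ c] by (simp add: set_integrable_def)
    have "(\<integral>\<^sup>+s\<in>{0..1}. ennreal (4 * norm (K' i s) / \<epsilon>) \<partial>lborel)
      = (\<integral>\<^sup>+s. ennreal (indicator {0..1} s *\<^sub>R (4 * norm (K' i s) / \<epsilon>)) \<partial>lborel)"
      by (rule nn_integral_cong) (auto simp: indicator_def)
    also have "\<dots> = ennreal (LINT s:{0..1}|lborel. 4 * norm (K' i s) / \<epsilon>)"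
      unfolding set_lebesgue_integral_def
      by (rule nn_integral_eq_integral) (use int assms in \<open>auto simp: set_integrable_def\<close>)
    also have "\<dots> = ennreal (integral {0..1} (\<lambda>s. 4 * norm (K' i s) / \<epsilon>))"
      by (subst set_borel_integral_eq_integral(2)[OF int]) simp
    finally show "(\<integral>\<^sup>+s\<in>{0..1}. ennreal (4 * norm (K' i s) / \<epsilon>) \<partial>lborel) = \<dots>" .
  qed
  also have "\<dots> = ennreal (\<Sum>i<m. 4 / \<epsilon> * integral {0..1} (\<lambda>s. norm (K' i s)))"
  proof (subst sum_ennreal)
    show "0 \<le> integral {0..1} (\<lambda>s. 4 * norm (K' i s) / \<epsilon>)" if "i \<in> {..<m}" for i
      using that assms
      by (intro integral_nonneg integrable_continuous_real continuous_intros K'_cont) auto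
    show "ennreal (\<Sum>i<m. integral {0..1} (\<lambda>s. 4 * norm (K' i s) / \<epsilon>)) = ennreal (\<Sum>i<m. 4 / \<epsilon> * integral {0..1} (\<lambda>s. norm (K' i s)))"
      by (subst integral_mult_right[symmetric]) (simp add: ac_simps)
  qed
  also have "\<dots> = ennreal (4 * arclength / \<epsilon>)"
    by (simp add: arclength_def sum_distrib_left sum_divide_distrib)
  finally show ?thesis .
qed

lemma K'_lower_bound:
  obtains c where "c > 0" "\<And>i s. i < m \<Longrightarrow> s \<in> {0..1} \<Longrightarrow> c \<le> norm (K' i s)"
proof -
  have "\<forall>\<^sub>F c in at_right 0. \<forall>s\<in>{0..1}. c \<le> norm (K' i s)" if i: "i < m" for i
  proof -
    obtain s0 where s0: "s0 \<in> {0..1}" "\<And>s. s \<in> {0..1} \<Longrightarrow> norm (K' i s0) \<le> norm (K' i s)"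
      using continuous_attains_inf[of "{0..1::real}" "\<lambda>s. norm (K' i s)", OF _ _ continuous_on_norm[OF K'_cont[OF i]]]
      by auto
    show ?thesis
      unfolding eventually_at_right_field
      by (rule exI[of _ "norm (K' i s0)"]) (use K'_nonzero[OF i] s0(2) in force)
  qed
  then have "\<forall>\<^sub>F c in at_right 0. \<forall>i\<in>{..<m}. \<forall>s\<in>{0..1}. c \<le> norm (K' i s)"
    by (intro eventually_ball_finite) auto
  then obtain b where b: "b > (0::real)" "\<And>c. 0 < c \<Longrightarrow> c < b \<Longrightarrow> \<forall>i\<in>{..<m}. \<forall>s\<in>{0..1}. c \<le> norm (K' i s)"
    unfolding eventually_at_right_field by auto
  show thesis
    by (rule that[of "b/2"]) (use b b(2)[of "b/2"] in auto)
qed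

text \<open>
  A tangent vector \<open>k\<close> is rotated to the first axis. The vectors \<open>v = (x, y)\<close> with
  \<open>|v \<times> k| \<le> C |v|\<^sup>2\<close> then satisfy \<open>|y| = O(x\<^sup>2)\<close>, whence \<open>|v|\<^sup>-\<^sup>4 |v \<times> k|\<close> is integrable over them.
\<close>

lemma nn_integral_grazing_direction:
  assumes c: "0 < c" "c \<le> norm k" and r: "0 < r" "r * (2 * C0) \<le> c"
  shows "(\<integral>\<^sup>+v. annulus 0 r v *
      ennreal (if \<bar>cr v k\<bar> \<le> C0 * (norm v)\<^sup>2 then \<bar>cr v k\<bar> else 0) \<partial>lborel) \<le> ennreal (16 * C0\<^sup>2 * r / c)"
proof -
  let ?H = "\<lambda>s x. indicator {0<..r} s * ennreal (1 / s ^ 4) * ennreal (if x \<le> C0 * s\<^sup>2 then x else 0)"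
  have C0: "C0 \<ge> 0" by (rule chord)
  have pt: "?H (norm (vec2 x y)) (norm k * \<bar>vec2 x y $ 2\<bar>) \<le>
      indicator {-r..r} x * ennreal (2 * C0 / x\<^sup>2) * indicator {- (2 * C0 * x\<^sup>2 / c)..2 * C0 * x\<^sup>2 / c} y" for x y
  proof (cases "0 < norm (vec2 x y) \<and> norm (vec2 x y) \<le> r \<and> norm k * \<bar>y\<bar> \<le> C0 * (norm (vec2 x y))\<^sup>2")
    case True
    define n where "n = norm (vec2 x y)"
    have n: "0 < n" "n \<le> r" "norm k * \<bar>y\<bar> \<le> C0 * n\<^sup>2" using True by (auto simp: n_def)
    have n2: "n\<^sup>2 = x\<^sup>2 + y\<^sup>2" by (simp add: n_def norm_sq2)
    have "c * \<bar>y\<bar> \<le> norm k * \<bar>y\<bar>" using c by (intro mult_right_mono) auto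
    also have "\<dots> \<le> (C0 * n) * n" using n by (simp add: power2_eq_square mult.assoc)
    \<comment> \<open>The smallness of \<open>r\<close> enters here: it forces
      \<open>|y| \<le> n / 2\<close>, so \<open>v\<close> lies in a cone around the tangent, where
      \<open>x^2\<close> and \<open>n^2\<close> are comparable.\<close>
    also have "\<dots> \<le> (c / 2) * n"
    proof (intro mult_right_mono)
      have "C0 * n \<le> C0 * r" using n C0 by (intro mult_left_mono) auto
      then show "C0 * n \<le> c / 2" using r by (simp add: ac_simps)
    qed (use n in auto)
    finally have "c * \<bar>y\<bar> \<le> c * (n / 2)" by simp
    then have y: "\<bar>y\<bar> \<le> n / 2" using c by simp
    have "y\<^sup>2 \<le> (n / 2)\<^sup>2" using y n by (intro abs_le_square_iff[THEN iffD1]) auto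
    then have "4 * y\<^sup>2 \<le> x\<^sup>2 + y\<^sup>2" using n2 by (simp add: power_divide)
    then have "y\<^sup>2 \<le> x\<^sup>2" using zero_le_power2[of y] by linarith
    then have x2: "n\<^sup>2 \<le> 2 * x\<^sup>2" using n2 by simp
    have "n\<^sup>2 > 0" using n(1) by simp
    with x2 have xpos: "x\<^sup>2 > 0" by linarith
    have xr: "\<bar>x\<bar> \<le> r"
    proof -
      have "x\<^sup>2 \<le> n\<^sup>2" using n2 by simp
      then have "\<bar>x\<bar> \<le> \<bar>n\<bar>" by (simp add: abs_le_square_iff)
      then show ?thesis using n by simp
    qed
    have k: "norm k * \<bar>y\<bar> \<le> 2 * C0 * x\<^sup>2"
      using n(3) mult_left_mono[OF x2 C0] by simp
    have yb: "\<bar>y\<bar> \<le> 2 * C0 * x\<^sup>2 / c"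
    proof -
      have "c * \<bar>y\<bar> \<le> 2 * C0 * x\<^sup>2" using k c mult_right_mono[of c "norm k" "\<bar>y\<bar>"] by simp
      then show ?thesis using c by (simp add: field_simps)
    qed
    have x4: "(x\<^sup>2)\<^sup>2 \<le> n ^ 4"
    proof -
      have "(x\<^sup>2)\<^sup>2 \<le> (n\<^sup>2)\<^sup>2" by (rule power_mono) (simp_all add: n2)
      then show ?thesis by simp
    qed
    have "1 / n ^ 4 * (norm k * \<bar>y\<bar>) \<le> 1 / (x\<^sup>2)\<^sup>2 * (2 * C0 * x\<^sup>2)"
    proof (rule mult_mono)
      show "1 / n ^ 4 \<le> 1 / (x\<^sup>2)\<^sup>2"
        using x4 xpos n by (intro divide_left_mono) (auto intro!: mult_pos_pos)
    qed (use k in auto)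
    also have "\<dots> = 2 * C0 / x\<^sup>2" using xpos by (simp add: power2_eq_square)
    finally have "ennreal (1 / n ^ 4) * ennreal (norm k * \<bar>y\<bar>) \<le> ennreal (2 * C0 / x\<^sup>2)"
      by (subst ennreal_mult'[symmetric]) (auto intro: ennreal_leI)
    then show ?thesis
      using True xr yb by (auto simp: n_def indicator_def abs_le_iff)
  next
    case False
    then show ?thesis by (auto simp: indicator_def)
  qed
  have "(\<integral>\<^sup>+v. ?H (norm v) \<bar>cr v k\<bar> \<partial>lborel) = (\<integral>\<^sup>+(v::real^2). ?H (norm v) (norm k * \<bar>v$2\<bar>) \<partial>lborel)"
    by (rule nn_integral_rotate) measurable
  also have "\<dots> = (\<integral>\<^sup>+x. \<integral>\<^sup>+y. ?H (norm (vec2 x y)) (norm k * \<bar>vec2 x y $ 2\<bar>) \<partial>lborel \<partial>lborel)"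
    by (rule nn_integral_vec2) measurable
  also have "\<dots> \<le> (\<integral>\<^sup>+x. \<integral>\<^sup>+y. indicator {-r..r} x * ennreal (2 * C0 / x\<^sup>2) *
      indicator {- (2 * C0 * x\<^sup>2 / c)..2 * C0 * x\<^sup>2 / c} y \<partial>lborel \<partial>lborel)"
    by (intro nn_integral_mono pt)
  \<comment> \<open>For fixed \<open>x\<close> the admissible \<open>y\<close> form an interval of
    length \<open>4 * C0 * x^2 / c\<close>, which cancels the singular factor
    \<open>2 * C0 / x^2\<close>.\<close>
  also have "\<dots> \<le> (\<integral>\<^sup>+x. ennreal (8 * C0\<^sup>2 / c) * indicator {-r..r} x \<partial>lborel)"
  proof (intro nn_integral_mono)
    fix x :: real
    have "(\<integral>\<^sup>+y. indicator {-r..r} x * ennreal (2 * C0 / x\<^sup>2) * indicator {- (2 * C0 * x\<^sup>2 / c)..2 * C0 * x\<^sup>2 / c} y \<partial>lborel)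
      = indicator {-r..r} x * ennreal (2 * C0 / x\<^sup>2) * ennreal (4 * C0 * x\<^sup>2 / c)"
      using c C0 by (subst nn_integral_cmult) (simp_all add: mult.commute mult.left_commute)
    also have "\<dots> = indicator {-r..r} x * ennreal (2 * C0 / x\<^sup>2 * (4 * C0 * x\<^sup>2 / c))"
      using C0 by (subst ennreal_mult'[of "2 * C0 / x\<^sup>2"]) (simp_all only: mult.assoc, simp)
    also have "\<dots> \<le> ennreal (8 * C0\<^sup>2 / c) * indicator {-r..r} x"
      using c C0 by (cases "x = 0") (auto simp: indicator_def power2_eq_square field_simps)
    finally show "(\<integral>\<^sup>+y. indicator {-r..r} x * ennreal (2 * C0 / x\<^sup>2) * indicator {- (2 * C0 * x\<^sup>2 / c)..2 * C0 * x\<^sup>2 / c} y \<partial>lborel)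
      \<le> ennreal (8 * C0\<^sup>2 / c) * indicator {-r..r} x" .
  qed
  also have "\<dots> = ennreal (8 * C0\<^sup>2 / c) * ennreal (2 * r)"
    using r by (subst nn_integral_cmult) auto
  also have "\<dots> = ennreal (16 * C0\<^sup>2 * r / c)"
    using c r by (subst ennreal_mult'[symmetric]) (auto simp: ac_simps)
  finally show ?thesis .
qed

lemma nn_integral_grazing:
  obtains r Q where "0 < r" "r \<le> \<rho>0"
    "(\<integral>\<^sup>+v. annulus 0 r v * grazing v \<partial>lborel) \<le> ennreal Q"
proof -
  obtain c where c: "c > 0" "\<And>i s. i < m \<Longrightarrow> s \<in> {0..1} \<Longrightarrow> c \<le> norm (K' i s)"
    using K'_lower_bound by blast
  \<comment> \<open>The bound \<open>\<rho>0\<close> lets \<open>crossing_le\<close> apply on the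
    resulting disc; the other is the smallness asked for by
    \<open>nn_integral_grazing_direction\<close>, with \<open>+ 1\<close> in case
    \<open>C0 = 0\<close>.\<close>
  define r where "r = min \<rho>0 (c / (2 * C0 + 1))"
  have C0: "C0 \<ge> 0" "\<rho>0 > 0" by (rule chord)+
  have r: "0 < r" "r \<le> \<rho>0" using c C0 by (auto simp: r_def)
  have "r * (2 * C0 + 1) \<le> c / (2 * C0 + 1) * (2 * C0 + 1)"
    using C0 by (intro mult_right_mono) (auto simp: r_def)
  also have "\<dots> = c" using C0 by simp
  finally have rc: "r * (2 * C0) \<le> c" using r by (simp add: distrib_left)
  have "(\<integral>\<^sup>+v. annulus 0 r v * grazing v \<partial>lborel)
    = (\<Sum>i<m. \<integral>\<^sup>+s\<in>{0..1}. (\<integral>\<^sup>+v. annulus 0 r v *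
        ennreal (if \<bar>cr v (K' i s)\<bar> \<le> C0 * (norm v)\<^sup>2 then \<bar>cr v (K' i s)\<bar> else 0) \<partial>lborel) \<partial>lborel)"
    unfolding grazing_def by (rule nn_integral_sum_swap) measurable
  also have "\<dots> \<le> (\<Sum>i<m. \<integral>\<^sup>+s\<in>{0..1::real}. ennreal (16 * C0\<^sup>2 * r / c) \<partial>lborel)"
  proof (intro sum_mono nn_integral_mono)
    fix i and s :: real assume "i \<in> {..<m}"
    then show "(\<integral>\<^sup>+v. annulus 0 r v *
        ennreal (if \<bar>cr v (K' i s)\<bar> \<le> C0 * (norm v)\<^sup>2 then \<bar>cr v (K' i s)\<bar> else 0) \<partial>lborel) * indicator {0..1} s
      \<le> ennreal (16 * C0\<^sup>2 * r / c) * indicator {0..1} s"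
      using nn_integral_grazing_direction[OF c(1) c(2) r(1) rc, of i s] by (auto simp: indicator_def)
  qed
  also have "\<dots> = ennreal (real m * (16 * C0\<^sup>2 * r / c))"
    by (subst nn_integral_cmult) (simp_all add: ennreal_of_nat_eq_real_of_nat ennreal_mult'[symmetric])
  finally show thesis using r that by blast
qed

definition planar_integral :: "real \<Rightarrow> real" where
  "planar_integral \<epsilon> = enn2real (\<integral>\<^sup>+v. far \<epsilon> v * escape v \<partial>lborel)"

definition energy :: "real \<Rightarrow> real" where
  "energy \<epsilon> = 2 * arclength / \<epsilon> - planar_integral \<epsilon>"

lemma nn_integral_escape:
  assumes "\<epsilon> > 0"
  shows "(\<integral>\<^sup>+v. far \<epsilon> v * escape v \<partial>lborel) = ennreal (planar_integral \<epsilon>)"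
proof -
  have "(\<integral>\<^sup>+v. far \<epsilon> v * escape v \<partial>lborel)
    \<le> (\<integral>\<^sup>+(v::real^2). far \<epsilon> v * emeasure lborel \<Omega> \<partial>lborel)"
    by (intro nn_integral_mono mult_left_mono escape_le) auto
  also have "\<dots> = ennreal (pi / \<epsilon>\<^sup>2) * emeasure lborel \<Omega>"
    by (subst nn_integral_multc) (auto simp: nn_integral_norm_power4[OF assms])
  also have "\<dots> < \<infinity>" using emeasure_region_finite by (simp add: ennreal_mult_less_top)
  finally show ?thesis by (simp add: planar_integral_def)
qed

lemma planar_integral_nonneg: "planar_integral \<epsilon> \<ge> 0"
  by (simp add: planar_integral_def)

lemma nn_integral_annulus_split:
  fixes f :: "real^2 \<Rightarrow> ennreal"
  assumes "a \<le> b" and [measurable]: "f \<in> borel_measurable borel"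
  shows "(\<integral>\<^sup>+v. far a v * f v \<partial>lborel)
    = (\<integral>\<^sup>+v. annulus a b v * f v \<partial>lborel)
    + (\<integral>\<^sup>+v. far b v * f v \<partial>lborel)"
proof -
  have "(\<integral>\<^sup>+v. far a v * f v \<partial>lborel)
    = (\<integral>\<^sup>+v. annulus a b v * f v
        + far b v * f v \<partial>lborel)"
    using assms(1) by (intro nn_integral_cong) (auto simp: indicator_def)
  also have "\<dots> = (\<integral>\<^sup>+v. annulus a b v * f v \<partial>lborel)
    + (\<integral>\<^sup>+v. far b v * f v \<partial>lborel)"
    by (rule nn_integral_add) measurable
  finally show ?thesis .
qed

text \<open>Integrals over an annulus are finite, so the comparison of \<open>2 * escape\<close>
  with \<open>crossing\<close> can be carried out in the reals:
  \<open>energy a - energy b = y / 2 - x\<close>.\<close>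

lemma annulus_reals:
  assumes "0 < a" "a \<le> b"
  obtains x y where "0 \<le> x" "0 \<le> y"
    "(\<integral>\<^sup>+v. annulus a b v * escape v \<partial>lborel) = ennreal x"
    "(\<integral>\<^sup>+v. annulus a b v * crossing v \<partial>lborel) = ennreal y"
    "planar_integral a = x + planar_integral b" "4 * arclength / a = y + 4 * arclength / b"
proof -
  have b: "0 < b" using assms by simp
  have 1: "ennreal (planar_integral a) = (\<integral>\<^sup>+v. annulus a b v * escape v \<partial>lborel) + ennreal (planar_integral b)"
    using nn_integral_annulus_split[OF assms(2) measurable_escape] by (simp only: nn_integral_escape[OF assms(1)] nn_integral_escape[OF b])
  have 2: "ennreal (4 * arclength / a) = (\<integral>\<^sup>+v. annulus a b v * crossing v \<partial>lborel) + ennreal (4 * arclength / b)"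
    using nn_integral_annulus_split[OF assms(2) measurable_crossing] by (simp only: nn_integral_crossing[OF assms(1)] nn_integral_crossing[OF b])
  obtain x where x: "0 \<le> x" "(\<integral>\<^sup>+v. annulus a b v * escape v \<partial>lborel) = ennreal x"
    using 1 by (cases "(\<integral>\<^sup>+v. annulus a b v * escape v \<partial>lborel)") auto
  obtain y where y: "0 \<le> y" "(\<integral>\<^sup>+v. annulus a b v * crossing v \<partial>lborel) = ennreal y"
    using 2 by (cases "(\<integral>\<^sup>+v. annulus a b v * crossing v \<partial>lborel)") auto
  have "planar_integral a = x + planar_integral b"
    using 1 x planar_integral_nonneg by (simp add: ennreal_plus[symmetric] del: ennreal_plus)
  moreover have "4 * arclength / a = y + 4 * arclength / b"
    using 2 y arclength_nonneg assms b by (simp add: ennreal_plus[symmetric] del: ennreal_plus)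
  ultimately show thesis using that x y by blast
qed

lemma energy_antimono:
  assumes "0 < a" "a \<le> b"
  shows "energy b \<le> energy a"
proof -
  obtain x y where xy: "0 \<le> x" "0 \<le> y"
    "(\<integral>\<^sup>+v. annulus a b v * escape v \<partial>lborel) = ennreal x"
    "(\<integral>\<^sup>+v. annulus a b v * crossing v \<partial>lborel) = ennreal y"
    "planar_integral a = x + planar_integral b" "4 * arclength / a = y + 4 * arclength / b"
    using annulus_reals[OF assms] by blast
  have "2 * ennreal x = (\<integral>\<^sup>+v. 2 * (annulus a b v * escape v) \<partial>lborel)"
    unfolding xy(3)[symmetric] by (rule nn_integral_cmult[symmetric]) measurable
  also have "\<dots> = (\<integral>\<^sup>+v. annulus a b v * (2 * escape v) \<partial>lborel)"
    by (simp add: ac_simps)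
  also have "\<dots> \<le> (\<integral>\<^sup>+v. annulus a b v * crossing v \<partial>lborel)"
    by (intro nn_integral_mono mult_left_mono sides_differ_le_crossing) auto
  also have "\<dots> = ennreal y" by (rule xy)
  finally have "ennreal (2 * x) \<le> ennreal y" by (simp add: ennreal_mult' )
  then have "2 * x \<le> y" using xy by simp
  with xy(5,6) show ?thesis by (simp add: energy_def)
qed

text \<open>For \<open>\<epsilon> \<le> r\<close> the energy gained between \<open>r\<close> and
  \<open>\<epsilon>\<close> is at most half the grazing integral over the whole punctured disc of
  radius \<open>r\<close>, a bound independent of \<open>\<epsilon>\<close>. Beyond \<open>r\<close>
  monotonicity suffices.\<close>

lemma energy_bounded:
  obtains B where "\<And>\<epsilon>. 0 < \<epsilon> \<Longrightarrow> energy \<epsilon> \<le> B"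
proof -
  obtain r Q where r: "0 < r" "r \<le> \<rho>0"
    and Q: "(\<integral>\<^sup>+v. annulus 0 r v * grazing v \<partial>lborel) \<le> ennreal Q"
    using nn_integral_grazing by blast
  \<comment> \<open>\<open>Q\<close> is known only through \<open>ennreal\<close>, which reads
    negative numbers as \<open>0\<close>.\<close>
  define Q' where "Q' = max Q 0"
  have Q': "ennreal Q \<le> ennreal Q'" "0 \<le> Q'" by (auto simp: Q'_def intro: ennreal_leI)
  have small: "energy \<epsilon> \<le> energy r + Q' / 2" if \<epsilon>: "0 < \<epsilon>" "\<epsilon> \<le> r" for \<epsilon>
  proof -
    obtain x y where xy: "0 \<le> x" "0 \<le> y"
      "(\<integral>\<^sup>+v. annulus \<epsilon> r v * escape v \<partial>lborel) = ennreal x"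
      "(\<integral>\<^sup>+v. annulus \<epsilon> r v * crossing v \<partial>lborel) = ennreal y"
      "planar_integral \<epsilon> = x + planar_integral r" "4 * arclength / \<epsilon> = y + 4 * arclength / r"
      using annulus_reals[OF \<epsilon>] by blast
    have "ennreal y \<le> (\<integral>\<^sup>+v. 2 * (annulus \<epsilon> r v * escape v)
        + annulus 0 r v * grazing v \<partial>lborel)"
      unfolding xy(4)[symmetric]
    proof (intro nn_integral_mono)
      fix v :: "real^2"
      show "annulus \<epsilon> r v * crossing v
        \<le> 2 * (annulus \<epsilon> r v * escape v)
        + annulus 0 r v * grazing v"
      proof (cases "\<epsilon> < norm v \<and> norm v \<le> r")
        case True
        then have "crossing v \<le> 2 * escape v + grazing v" using r by (intro crossing_le) auto
        then have "ennreal (1 / norm v ^ 4) * crossing v \<le> ennreal (1 / norm v ^ 4) * (2 * escape v + grazing v)"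
          by (intro mult_left_mono) auto
        then show ?thesis using True \<epsilon> by (auto simp: indicator_def distrib_left ac_simps)
      qed (auto simp: indicator_def)
    qed
    also have "\<dots> = 2 * ennreal x + (\<integral>\<^sup>+v. annulus 0 r v * grazing v \<partial>lborel)"
      unfolding xy(3)[symmetric] by (subst nn_integral_add, measurable, subst nn_integral_cmult) auto
    also have "\<dots> \<le> 2 * ennreal x + ennreal Q'"
      using order_trans[OF Q Q'(1)] by (rule add_left_mono)
    also have "\<dots> = ennreal (2 * x + Q')" using xy Q' by (simp add: ennreal_mult')
    finally have "y \<le> 2 * x + Q'"
      using xy(1) Q'(2) by (simp add: ennreal_plus[symmetric] del: ennreal_plus)
    with xy(5,6) show ?thesis by (simp add: energy_def)
  qed
  show thesis
  proof (rule that[of "energy r + Q' / 2"])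
    fix \<epsilon> :: real assume "0 < \<epsilon>"
    then show "energy \<epsilon> \<le> energy r + Q' / 2"
      using small[of \<epsilon>] energy_antimono[of r \<epsilon>] r Q' by (cases "\<epsilon> \<le> r") auto
  qed
qed

text \<open>The limit is the supremum. That it bounds all values is recorded because it gives one
  half of the later sandwich.\<close>

lemma energy_tendsto:
  obtains E where "(energy \<longlongrightarrow> E) (at_right 0)" "\<And>\<epsilon>. 0 < \<epsilon> \<Longrightarrow> energy \<epsilon> \<le> E"
proof -
  obtain B where B: "\<And>\<epsilon>. 0 < \<epsilon> \<Longrightarrow> energy \<epsilon> \<le> B" using energy_bounded by blast
  define E where "E = (SUP \<epsilon>\<in>{0<..}. energy \<epsilon>)"
  have bdd: "bdd_above (energy ` {0<..})" using B by (auto intro!: bdd_aboveI)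
  have le: "energy \<epsilon> \<le> E" if "0 < \<epsilon>" for \<epsilon>
    unfolding E_def using that by (intro cSUP_upper bdd) auto
  have "(energy \<longlongrightarrow> E) (at_right 0)"
  proof (rule order_tendstoI)
    fix a assume "a < E"
    then obtain \<epsilon> where \<epsilon>: "\<epsilon> > 0" "a < energy \<epsilon>"
      unfolding E_def using less_cSUP_iff[OF _ bdd, of a] by auto
    show "\<forall>\<^sub>F x in at_right 0. a < energy x"
      unfolding eventually_at_right_field
      by (rule exI[of _ \<epsilon>]) (use \<epsilon> less_le_trans[OF \<epsilon>(2) energy_antimono] in auto)
  next
    fix a assume "E < a"
    show "\<forall>\<^sub>F x in at_right 0. energy x < a"
      unfolding eventually_at_right_field
      by (rule exI[of _ 1]) (use le \<open>E < a\<close> in force)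
  qed
  with le that show thesis by blast
qed

lemma nn_integral_pairs:
  "(\<integral>\<^sup>+p\<in>(\<Omega> \<times> - \<Omega>) - Delta \<epsilon>. ennreal (case p of (w, z) \<Rightarrow> 1 / norm (z - w) ^ 4) \<partial>lborel)
    = (\<integral>\<^sup>+v. far \<epsilon> v * escape v \<partial>lborel)"
proof -
  have "(\<integral>\<^sup>+p\<in>(\<Omega> \<times> - \<Omega>) - Delta \<epsilon>. ennreal (case p of (w, z) \<Rightarrow> 1 / norm (z - w) ^ 4) \<partial>lborel)
    = (\<integral>\<^sup>+p. (case p of (w, z) \<Rightarrow> indicator {\<epsilon><..} (norm (z - w)) * ennreal (1 / norm (z - w) ^ 4) * (indicator \<Omega> w * indicator (- \<Omega>) z)) \<partial>(lborel \<Otimes>\<^sub>M lborel))"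
    unfolding lborel_prod by (intro nn_integral_cong) (auto simp: indicator_def Delta_def split: prod.splits)
  also have "\<dots> = (\<integral>\<^sup>+w. \<integral>\<^sup>+z. indicator {\<epsilon><..} (norm (z - w)) * ennreal (1 / norm (z - w) ^ 4) * (indicator \<Omega> w * indicator (- \<Omega>) z) \<partial>lborel \<partial>lborel)"
  proof -
    have "(\<lambda>(w, z). indicator {\<epsilon><..} (norm (z - w)) * ennreal (1 / norm (z - w) ^ 4) * (indicator \<Omega> w * indicator (- \<Omega>) z))
      \<in> borel_measurable (lborel \<Otimes>\<^sub>M lborel)"
      by measurable
    from lborel.nn_integral_fst[OF this] show ?thesis by simp
  qed
  also have "\<dots> = (\<integral>\<^sup>+w. \<integral>\<^sup>+v. far \<epsilon> v * (indicator \<Omega> w * indicator (- \<Omega>) (w + v)) \<partial>lborel \<partial>lborel)"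
  proof (rule nn_integral_cong)
    fix w :: "real^2"
    show "(\<integral>\<^sup>+z. indicator {\<epsilon><..} (norm (z - w)) * ennreal (1 / norm (z - w) ^ 4) * (indicator \<Omega> w * indicator (- \<Omega>) z) \<partial>lborel)
      = (\<integral>\<^sup>+v. far \<epsilon> v * (indicator \<Omega> w * indicator (- \<Omega>) (w + v)) \<partial>lborel)"
      by (subst nn_integral_lborel_translate[of _ w, symmetric]) simp_all
  qed
  also have "\<dots> = (\<integral>\<^sup>+v. \<integral>\<^sup>+w. far \<epsilon> v * (indicator \<Omega> w * indicator (- \<Omega>) (w + v)) \<partial>lborel \<partial>lborel)"
    by (rule lborel_pair.Fubini'[symmetric]) measurable
  also have "\<dots> = (\<integral>\<^sup>+v. far \<epsilon> v * escape v \<partial>lborel)"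
    unfolding escape_def by (rule nn_integral_cong, rule nn_integral_cmult) measurable
  finally show ?thesis .
qed

end

section \<open>Green's theorem\<close>

text \<open>The signed form of the substitution rule, from the same equality of measures; Green's
  theorem involves integrands of both signs.\<close>

lemma integral_change_of_variables_open:
  fixes g :: "real^'n::{finite,wellorder} \<Rightarrow> real^'n::_" and F :: "real^'n::{finite,wellorder} \<Rightarrow> real"
  assumes S: "open S" and g: "continuous_on UNIV g"
    and der: "\<And>x. x \<in> S \<Longrightarrow> (g has_derivative g' x) (at x)"
    and inj: "inj_on g S"
    and d: "\<And>x. x \<in> S \<Longrightarrow> \<bar>det (matrix (g' x))\<bar> = d x"
    and dm [measurable]: "d \<in> borel_measurable borel"
    and F [measurable]: "F \<in> borel_measurable borel"
  shows "(LINT x|lborel. indicator (g ` S) x * F x) = (LINT x|lborel. indicator S x * (d x * F (g x)))"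
proof -
  have gm [measurable]: "g \<in> borel_measurable borel"
    using g by (rule borel_measurable_continuous_onI)
  have "open (g ` S)"
    using invariance_of_domain[OF continuous_on_subset[OF g] S inj] by simp
  then have [measurable]: "g ` S \<in> sets borel" "S \<in> sets borel" using S by auto
  have dpos: "d x \<ge> 0" if "x \<in> S" for x using d[OF that] by (metis abs_ge_zero)
  have e1: "density lborel (indicator (g ` S)) = density lborel (\<lambda>x. ennreal (indicator (g ` S) x))"
    by (rule density_cong) (auto simp: indicator_def)
  have e2: "density lborel (\<lambda>x. ennreal (d x) * indicator S x) = density lborel (\<lambda>x. ennreal (indicator S x * d x))"
    by (rule density_cong) (auto simp: indicator_def)
  have "(LINT x|lborel. indicator (g ` S) x * F x) = (LINT x|density lborel (indicator (g ` S)). F x)"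
    unfolding e1 by (subst integral_density) auto
  also have "\<dots> = (LINT x|distr (density lborel (\<lambda>x. ennreal (d x) * indicator S x)) borel g. F x)"
    by (subst distr_change_of_variables[OF S g der inj d]) auto
  also have "\<dots> = (LINT x|density lborel (\<lambda>x. ennreal (indicator S x * d x)). F (g x))"
    unfolding e2 by (rule integral_distr) auto
  also have "\<dots> = (LINT x|lborel. indicator S x * (d x * F (g x)))"
    by (subst integral_density) (auto simp: mult.assoc indicator_def dpos)
  finally show ?thesis .
qed

lemma integral_unit_square:
  fixes c :: "real \<Rightarrow> real"
  assumes c: "continuous_on UNIV c"
  shows "(LINT p|lborel. indicator {p::real^2. 0 < p$1 \<and> p$1 < 1 \<and> 0 < p$2 \<and> p$2 < 1} p * c (p$1)) = integral {0..1} c"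
proof -
  have [measurable]: "c \<in> borel_measurable borel" using c by (rule borel_measurable_continuous_onI)
  have int: "set_integrable lborel {0..1} c"
    using borel_integrable_compact[OF _ continuous_on_subset[OF c], of "{0..1}"] by (simp add: set_integrable_def)
  have int': "set_integrable lborel {0<..<1} c" by (rule set_integrable_subset[OF int]) auto
  have inta: "integrable lborel (\<lambda>x. indicator {0<..<1} x * \<bar>c x\<bar>)"
    using integrable_abs[OF int'[unfolded set_integrable_def]] by (simp add: abs_mult)
  have int1: "integrable lborel (\<lambda>y. indicator {0<..<1::real} y :: real)" by simp
  have "(LINT p|lborel. indicator {p::real^2. 0 < p$1 \<and> p$1 < 1 \<and> 0 < p$2 \<and> p$2 < 1} p * c (p$1))
    = (LINT p|distr lborel borel (case_prod vec2). indicator {p::real^2. 0 < p$1 \<and> p$1 < 1 \<and> 0 < p$2 \<and> p$2 < 1} p * c (p$1))"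
    by (simp add: distr_vec2)
  also have "\<dots> = (LINT p|lborel. (case p of (x, y) \<Rightarrow> (indicator {0<..<1} x * c x) * indicator {0<..<1::real} y))"
  proof -
    have "(\<lambda>p. indicator {p::real^2. 0 < p$1 \<and> p$1 < 1 \<and> 0 < p$2 \<and> p$2 < 1} p * c (p$1)) \<in> borel_measurable borel"
      by measurable
    moreover have "case_prod vec2 \<in> lborel \<rightarrow>\<^sub>M borel" by simp
    ultimately have "(LINT p|distr lborel borel (case_prod vec2). indicator {p::real^2. 0 < p$1 \<and> p$1 < 1 \<and> 0 < p$2 \<and> p$2 < 1} p * c (p$1))
      = (LINT q|lborel. indicator {p::real^2. 0 < p$1 \<and> p$1 < 1 \<and> 0 < p$2 \<and> p$2 < 1} (case_prod vec2 q) * c (case_prod vec2 q $ 1))"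
      by (intro integral_distr)
    also have "\<dots> = (LINT p|lborel. (case p of (x, y) \<Rightarrow> (indicator {0<..<1} x * c x) * indicator {0<..<1::real} y))"
      by (rule Bochner_Integration.integral_cong[OF refl]) (auto simp: indicator_def)
    finally show ?thesis .
  qed
  also have "\<dots> = (LINT x|lborel. LINT y|lborel. (indicator {0<..<1} x * c x) * indicator {0<..<1::real} y)"
    unfolding lborel_prod[symmetric]
  proof (rule lborel_pair.integral_fst'[symmetric, where f = "\<lambda>(x, y). (indicator {0<..<1} x * c x) * indicator {0<..<1::real} y", unfolded prod.case])
    show "integrable (lborel \<Otimes>\<^sub>M lborel) (\<lambda>(x, y). (indicator {0<..<1} x * c x) * indicator {0<..<1::real} y)"
      using int' inta int1 by (intro lborel_pair.Fubini_integrable)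
        (auto simp: set_integrable_def abs_mult)
  qed
  also have "\<dots> = (LINT x:{0<..<1}|lborel. c x)"
    by (simp add: set_lebesgue_integral_def)
  also have "\<dots> = integral {0<..<1} c"
    by (rule set_borel_integral_eq_integral(2)[OF int'])
  also have "\<dots> = integral {0..1} c"
    by (rule integral_open_interval_real[symmetric])
  finally show ?thesis .
qed

section \<open>Area integrals under a small translation\<close>

context planar_domain
begin

definition swept :: "real^2 \<Rightarrow> (real^2) set" where
  "swept v = (\<Union>i<m. sweep i v ` goodp i v)"

definition side_jump :: "real^2 \<Rightarrow> real^2 \<Rightarrow> real" where
  "side_jump v x = indicator \<Omega> (x + v) - indicator \<Omega> x"

lemma measurable_side_jump [measurable]: "side_jump v \<in> borel_measurable borel"
  unfolding side_jump_def by measurable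

lemma measurable_swept:
  assumes "norm v \<le> \<rho>0"
  shows "swept v \<in> sets borel"
  unfolding swept_def using sweep_image_open[OF _ assms] by (intro borel_open open_UN) auto

lemma swept_subset: "norm v \<le> \<rho>0 \<Longrightarrow> swept v \<subseteq> (separated v)"
  unfolding swept_def using sweep_image_sides by blast

text \<open>The separated area is at most \<open>crossing\<close>, which is at most the swept area
  plus \<open>grazing\<close>; cancelling the finite swept area leaves \<open>grazing\<close>, with
  integrand at most \<open>C0 * (norm v)^2\<close>. This is of second order in \<open>v\<close> and
  will vanish in the derivative.\<close>

lemma emeasure_unswept:
  assumes v: "norm v \<le> \<rho>0"
  shows "emeasure lborel ((separated v) - swept v) \<le> ennreal (m * (C0 * (norm v)\<^sup>2))"
proof -
  let ?D = "separated v"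
  have [measurable]: "sweep i v ` goodp i v \<in> sets borel" if "i < m" for i
    using sweep_image_open[OF that v] by auto
  have sw: "emeasure lborel (swept v) = (\<Sum>i<m. emeasure lborel (sweep i v ` goodp i v))"
    unfolding swept_def by (rule sum_emeasure[symmetric]) (use disjoint_sweep[OF v] in auto)
  have "emeasure lborel ?D = emeasure lborel (?D - swept v) + emeasure lborel (swept v)"
    using swept_subset[OF v] measurable_swept[OF v] measurable_sides_differ
    by (subst plus_emeasure) (auto intro!: arg_cong[where f="emeasure lborel"])
  moreover have "emeasure lborel ?D \<le> emeasure lborel (swept v) + grazing v"
    using sides_differ_le_crossing crossing_le_swept[OF v] unfolding sw emeasure_sides_differ by (rule order_trans)
  moreover have "emeasure lborel (swept v) \<noteq> \<infinity>"
  proof -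
    have "emeasure lborel (swept v) \<le> 2 * escape v"
      unfolding emeasure_sides_differ[symmetric] using swept_subset[OF v] measurable_sides_differ
      by (intro emeasure_mono) auto
    also have "\<dots> \<le> 2 * emeasure lborel \<Omega>" by (intro mult_left_mono escape_le) auto
    also have "\<dots> < \<infinity>" using emeasure_region_finite by (simp add: ennreal_mult_less_top)
    finally show ?thesis by simp
  qed
  ultimately have "emeasure lborel (?D - swept v) \<le> grazing v"
    by (simp add: add.commute ennreal_add_left_cancel_le)
  also have "\<dots> \<le> (\<Sum>i<m. \<integral>\<^sup>+s\<in>{0..1::real}. ennreal (C0 * (norm v)\<^sup>2) \<partial>lborel)"
    unfolding grazing_def using chord(2)
    by (intro sum_mono nn_integral_mono) (auto simp: indicator_def intro!: ennreal_leI)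
  also have "\<dots> = ennreal (m * (C0 * (norm v)\<^sup>2))"
    by (subst nn_integral_cmult) (simp_all add: ennreal_of_nat_eq_real_of_nat ennreal_mult'[symmetric])
  finally show ?thesis .
qed

text \<open>The Jacobian is the absolute value of \<open>cr\<close>, and the jump at a swept point
  is the sign of \<open>cr (K' i (p$1)) v\<close>. Their product is the signed expression, which
  makes the line integral oriented.\<close>

lemma integral_swept_piece:
  fixes f :: "real^2 \<Rightarrow> real"
  assumes i: "i < m" and v: "norm v \<le> \<rho>0" and [measurable]: "f \<in> borel_measurable borel"
  shows "(LINT x|lborel. indicator (sweep i v ` goodp i v) x * (f x * side_jump v x))
    = (LINT p|lborel. indicator (goodp i v) p * (f (sweep i v p) * cr (K' i (p$1)) v))"
proof -
  note [measurable] = measurable_K'[OF i]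
  have "(LINT x|lborel. indicator (sweep i v ` goodp i v) x * (f x * side_jump v x))
    = (LINT p|lborel. indicator (goodp i v) p * (\<bar>cr v (K' i (p$1))\<bar> * (f (sweep i v p) * side_jump v (sweep i v p))))"
    by (rule integral_change_of_variables_open[OF goodp_open[OF i] sweep_cont[OF i] sweep_deriv[OF i] sweep_inj_on[OF i v] sweep_det])
       auto
  also have "\<dots> = (LINT p|lborel. indicator (goodp i v) p * (f (sweep i v p) * cr (K' i (p$1)) v))"
  proof (rule Bochner_Integration.integral_cong[OF refl])
    fix p :: "real^2"
    show "indicator (goodp i v) p * (\<bar>cr v (K' i (p$1))\<bar> * (f (sweep i v p) * side_jump v (sweep i v p)))
      = indicator (goodp i v) p * (f (sweep i v p) * cr (K' i (p$1)) v)"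
    proof (cases "p \<in> goodp i v")
      case True
      then have g: "p$1 \<in> good i v" "0 < p$2" "p$2 < 1" by (auto simp: goodp_def)
      have "\<bar>cr v (K' i (p$1))\<bar> = \<bar>cr (K' i (p$1)) v\<bar>" by (simp add: cr_def algebra_simps abs_minus_commute)
      then have "\<bar>cr v (K' i (p$1))\<bar> * side_jump v (sweep i v p) = cr (K' i (p$1)) v"
        using good_sides[OF i g(1) v g(2,3)] by (auto simp: side_jump_def sweep_def indicator_def)
      then show ?thesis by (simp add: algebra_simps)
    qed simp
  qed
  finally show ?thesis .
qed

lemma integrable_region:
  fixes f :: "real^2 \<Rightarrow> real"
  assumes "continuous_on UNIV f"
  shows "integrable lborel (\<lambda>x. f x * indicator \<Omega> (x + v))"
proof -
  have "compact ((\<lambda>x. x - v) ` \<Omega>)"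
    by (intro compact_continuous_image compact_region continuous_intros)
  from borel_integrable_compact[OF this continuous_on_subset[OF assms]]
  have "integrable lborel (\<lambda>x. indicator ((\<lambda>x. x - v) ` \<Omega>) x *\<^sub>R f x)" by simp
  moreover have "(\<lambda>x. indicator ((\<lambda>x. x - v) ` \<Omega>) x *\<^sub>R f x) = (\<lambda>x. f x * indicator \<Omega> (x + v))"
  proof
    fix x
    have "x \<in> (\<lambda>x. x - v) ` \<Omega> \<longleftrightarrow> x + v \<in> \<Omega>"
      by (auto intro: image_eqI[of x _ "x + v"])
    then show "indicator ((\<lambda>x. x - v) ` \<Omega>) x *\<^sub>R f x = f x * indicator \<Omega> (x + v)"
      by (simp add: indicator_def)
  qed
  ultimately show ?thesis by (simp only:)
qed

lemma integral_side_jump: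
  fixes f :: "real^2 \<Rightarrow> real"
  assumes f: "continuous_on UNIV f"
  shows "(LINT x|lborel. f x * side_jump v x) = (LINT x|lborel. indicator \<Omega> x * (f (x - v) - f x))"
proof -
  have fm [measurable]: "f \<in> borel_measurable borel" using f by (rule borel_measurable_continuous_onI)
  have f': "continuous_on UNIV (\<lambda>x. f (x - v))"
    by (intro continuous_on_compose2[OF f] continuous_intros) auto
  have i1: "integrable lborel (\<lambda>x. f x * indicator \<Omega> (x + v))" by (rule integrable_region[OF f])
  have i2: "integrable lborel (\<lambda>x. f x * indicator \<Omega> x)" using integrable_region[OF f, of 0] by simp
  have i3: "integrable lborel (\<lambda>x. f (x - v) * indicator \<Omega> x)" using integrable_region[OF f', of 0] by simp
  have "(LINT x|lborel. f x * side_jump v x) = (LINT x|lborel. f x * indicator \<Omega> (x + v)) - (LINT x|lborel. f x * indicator \<Omega> x)"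
    unfolding side_jump_def right_diff_distrib by (rule Bochner_Integration.integral_diff[OF i1 i2])
  also have "(LINT x|lborel. f x * indicator \<Omega> (x + v)) = (LINT x|distr lborel borel ((+) (- v)). f x * indicator \<Omega> (x + v))"
    by (simp add: lborel_distr_plus)
  also have "\<dots> = (LINT x|lborel. f (x - v) * indicator \<Omega> x)"
    by (subst integral_distr) (auto simp: algebra_simps)
  also have "\<dots> - (LINT x|lborel. f x * indicator \<Omega> x) = (LINT x|lborel. indicator \<Omega> x * (f (x - v) - f x))"
    by (subst Bochner_Integration.integral_diff[OF i3 i2, symmetric]) (simp add: algebra_simps)
  finally show ?thesis .
qed

text \<open>The jump vanishes off the separated points, and the swept ones give the sum over the
  components. What remains is an integral over the unswept points, estimated by \<open>A\<close>
  times their area.\<close>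

lemma side_jump_decomposition:
  fixes f :: "real^2 \<Rightarrow> real"
  assumes v: "norm v \<le> \<rho>0" and f: "continuous_on UNIV f"
    and A: "\<And>x. (x \<in> \<Omega>) \<noteq> (x + v \<in> \<Omega>) \<Longrightarrow> \<bar>f x\<bar> \<le> A" "0 \<le> A"
  shows "\<bar>(LINT x|lborel. f x * side_jump v x)
      - (\<Sum>i<m. LINT p|lborel. indicator (goodp i v) p * (f (sweep i v p) * cr (K' i (p$1)) v))\<bar>
    \<le> A * (m * (C0 * (norm v)\<^sup>2))"
proof -
  let ?D = "separated v"
  define R where "R = ?D - swept v"
  note [measurable] = measurable_swept[OF v]
  have Rm [measurable]: "R \<in> sets borel" unfolding R_def using measurable_sides_differ by auto
  have fm [measurable]: "f \<in> borel_measurable borel" using f by (rule borel_measurable_continuous_onI)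
  have im [measurable]: "sweep i v ` goodp i v \<in> sets borel" if "i < m" for i
    using sweep_image_open[OF that v] by auto
  have int: "integrable lborel (\<lambda>x. f x * side_jump v x)"
    unfolding side_jump_def right_diff_distrib
    using integrable_region[OF f, of v] integrable_region[OF f, of 0] by (intro Bochner_Integration.integrable_diff) auto
  have intS: "integrable lborel (\<lambda>x. indicator S x * (f x * side_jump v x))" if [measurable]: "S \<in> sets borel" for S
    using integrable_real_mult_indicator[OF _ int, of S] by (simp add: mult.commute)
  have split: "f x * side_jump v x = (\<Sum>i<m. indicator (sweep i v ` goodp i v) x * (f x * side_jump v x)) + indicator R x * (f x * side_jump v x)" for x
  proof -
    have "(\<Sum>i<m. indicator (sweep i v ` goodp i v) x * (f x * side_jump v x)) = indicator (swept v) x * (f x * side_jump v x)"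
      unfolding swept_def by (subst indicator_UN_disjoint[OF _ disjoint_sweep[OF v]]) (auto simp: sum_distrib_right)
    moreover have "side_jump v x = 0" if "x \<notin> swept v" "x \<notin> R"
      using that by (auto simp: R_def side_jump_def indicator_def)
    moreover have "x \<notin> swept v \<or> x \<notin> R" by (auto simp: R_def)
    ultimately show ?thesis by (cases "x \<in> swept v"; cases "x \<in> R") simp_all
  qed
  have "(LINT x|lborel. f x * side_jump v x)
    = (\<Sum>i<m. LINT x|lborel. indicator (sweep i v ` goodp i v) x * (f x * side_jump v x)) + (LINT x|lborel. indicator R x * (f x * side_jump v x))"
  proof -
    have "(LINT x|lborel. f x * side_jump v x)
      = (LINT x|lborel. (\<Sum>i<m. indicator (sweep i v ` goodp i v) x * (f x * side_jump v x)) + indicator R x * (f x * side_jump v x))"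
      by (rule Bochner_Integration.integral_cong[OF refl split])
    also have "\<dots> = (LINT x|lborel. (\<Sum>i<m. indicator (sweep i v ` goodp i v) x * (f x * side_jump v x))) + (LINT x|lborel. indicator R x * (f x * side_jump v x))"
      by (intro Bochner_Integration.integral_add Bochner_Integration.integrable_sum intS im Rm) simp
    also have "(LINT x|lborel. (\<Sum>i<m. indicator (sweep i v ` goodp i v) x * (f x * side_jump v x)))
      = (\<Sum>i<m. LINT x|lborel. indicator (sweep i v ` goodp i v) x * (f x * side_jump v x))"
      by (intro Bochner_Integration.integral_sum intS im) simp
    finally show ?thesis .
  qed
  also have "(\<Sum>i<m. LINT x|lborel. indicator (sweep i v ` goodp i v) x * (f x * side_jump v x))
    = (\<Sum>i<m. LINT p|lborel. indicator (goodp i v) p * (f (sweep i v p) * cr (K' i (p$1)) v))"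
    by (intro sum.cong refl integral_swept_piece[OF _ v fm]) simp
  finally have "(LINT x|lborel. f x * side_jump v x)
      - (\<Sum>i<m. LINT p|lborel. indicator (goodp i v) p * (f (sweep i v p) * cr (K' i (p$1)) v))
    = (LINT x|lborel. indicator R x * (f x * side_jump v x))" by simp
  also have "\<bar>\<dots>\<bar> \<le> A * measure lborel R"
  proof -
    have Rfin: "emeasure lborel R < \<infinity>"
      using emeasure_unswept[OF v] unfolding R_def by (auto intro: le_less_trans)
    have "\<bar>LINT x|lborel. indicator R x * (f x * side_jump v x)\<bar> \<le> (LINT x|lborel. norm (indicator R x * (f x * side_jump v x)))"
      using integral_norm_bound[of lborel "\<lambda>x. indicator R x * (f x * side_jump v x)"] by simp
    also have "\<dots> \<le> (LINT x|lborel. A * indicator R x)"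
    proof (rule integral_mono)
      show "integrable lborel (\<lambda>x. norm (indicator R x * (f x * side_jump v x)))"
        by (intro integrable_norm intS) simp
      show "integrable lborel (\<lambda>x. A * indicator R x)"
        using Rfin by simp
      show "norm (indicator R x * (f x * side_jump v x)) \<le> A * indicator R x" for x
        using A by (auto simp: R_def indicator_def side_jump_def)
    qed
    also have "\<dots> = A * measure lborel R" by simp
    finally show ?thesis .
  qed
  also have "\<dots> \<le> A * (m * (C0 * (norm v)\<^sup>2))"
  proof (rule mult_left_mono[OF _ A(2)])
    have "measure lborel R = enn2real (emeasure lborel R)" by (simp add: measure_def)
    also have "\<dots> \<le> enn2real (ennreal (m * (C0 * (norm v)\<^sup>2)))"
      using emeasure_unswept[OF v] unfolding R_def by (intro enn2real_mono) auto
    also have "\<dots> = m * (C0 * (norm v)\<^sup>2)" using chord(2) by simp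
    finally show "measure lborel R \<le> m * (C0 * (norm v)\<^sup>2)" .
  qed
  finally show ?thesis .
qed

text \<open>
  Green's theorem: compare the two evaluations of \<open>\<integral> f(x) (1\<^sub>\<Omega>(x + h w) - 1\<^sub>\<Omega>(x)) dx\<close>, by translating
  \<open>f\<close> and by sweeping the curve along \<open>h w\<close>, to first order in \<open>h\<close>.
\<close>

theorem green:
  fixes f :: "real^2 \<Rightarrow> real" and w :: "real^2"
  assumes der: "\<And>x. (f has_derivative D x) (at x)" and Dc: "continuous_on UNIV (\<lambda>x. D x w)"
  shows "(LINT x|lborel. indicator \<Omega> x * D x w) = (\<Sum>i<m. integral {0..1} (\<lambda>s. f (K i s) * cr w (K' i s)))"
proof -
  have f: "continuous_on UNIV f"
    using der by (intro continuous_at_imp_continuous_on) (auto intro: has_derivative_continuous)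
  have fm [measurable]: "f \<in> borel_measurable borel" using f by (rule borel_measurable_continuous_onI)
  obtain R0 where R0: "\<And>x. x \<in> \<Omega> \<Longrightarrow> norm x \<le> R0"
    using compact_imp_bounded[OF compact_region] by (auto simp: bounded_iff)
  \<comment> \<open>Contains all points of the region moved back by at most \<open>w\<close>, which
    are the points where \<open>f\<close> and its derivative have to be estimated.\<close>
  let ?B = "cball 0 (R0 + norm w) :: (real^2) set"
  obtain A where A: "\<And>x. x \<in> ?B \<Longrightarrow> norm (f x) \<le> A"
    using continuous_bounded_compact[OF continuous_on_subset[OF f], of ?B] compact_cball by blast
  obtain G where G: "\<And>x. x \<in> ?B \<Longrightarrow> norm (D x w) \<le> G"
    using continuous_bounded_compact[OF continuous_on_subset[OF Dc], of ?B] compact_cball by blast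
  define A' where "A' = max A 0"
  have A': "\<bar>f x\<bar> \<le> A'" if "x \<in> ?B" for x using A[OF that] by (simp add: A'_def)
  \<comment> \<open>Makes every step \<open>h n *\<^sub>R w\<close> at most \<open>\<rho>0\<close>
    long, so that the sweeping lemmas apply; the \<open>+ 1\<close> covers
    \<open>w = 0\<close>.\<close>
  define c where "c = min 1 (\<rho>0 / (norm w + 1))"
  have c: "0 < c" "c \<le> 1" "c * norm w \<le> \<rho>0"
  proof -
    show "0 < c" using chord(1) by (auto simp: c_def intro!: divide_pos_pos add_nonneg_pos)
    show "c \<le> 1" by (simp add: c_def)
    have "c * norm w \<le> \<rho>0 / (norm w + 1) * (norm w + 1)"
      using \<open>0 < c\<close> by (intro mult_mono) (auto simp: c_def)
    also have "\<dots> = \<rho>0" using norm_ge_zero[of w] by (simp add: add_nonneg_eq_0_iff)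
    finally show "c * norm w \<le> \<rho>0" .
  qed
  define h where "h n = c / real (Suc n)" for n
  have h: "0 < h n" "h n \<le> 1" "norm (h n *\<^sub>R w) \<le> \<rho>0" for n
  proof -
    show "0 < h n" using c by (simp add: h_def)
    have "h n \<le> c" using c by (simp add: h_def divide_le_eq)
    then show "h n \<le> 1" using c by simp
    have "norm (h n *\<^sub>R w) = h n * norm w" using \<open>0 < h n\<close> by simp
    also have "\<dots> \<le> c * norm w" using \<open>h n \<le> c\<close> by (intro mult_right_mono) auto
    finally show "norm (h n *\<^sub>R w) \<le> \<rho>0" using c by simp
  qed
  have h0: "h \<longlonglongrightarrow> 0"
    unfolding h_def using tendsto_mult[OF tendsto_const[of c] LIMSEQ_inverse_real_of_nat] by (simp add: field_simps)
  have h_at: "filterlim h (at 0) sequentially"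
    using h0 h(1) by (auto simp: filterlim_at less_imp_neq[symmetric])
  have near: "x - t *\<^sub>R w \<in> ?B" if "x \<in> \<Omega>" "0 \<le> t" "t \<le> 1" for x t
  proof -
    have "norm (x - t *\<^sub>R w) \<le> norm x + norm (t *\<^sub>R w)" by (rule norm_triangle_ineq4)
    also have "\<dots> \<le> R0 + norm w"
      using R0[OF that(1)] that by (intro add_mono) (auto intro: mult_left_le_one_le)
    finally show ?thesis by (simp)
  qed
  have K_in: "K i s \<in> \<Omega>" if "i < m" for i s
  proof -
    have "K i s \<in> frontier \<Omega>" using that unfolding frontier_region curve_image_def by auto
    then show ?thesis using frontier_subset_closed[OF compact_imp_closed[OF compact_region]] by auto
  qed
  have left: "(\<lambda>n. (LINT x|lborel. f x * side_jump (h n *\<^sub>R w) x) / h n) \<longlonglongrightarrow> (LINT x|lborel. indicator \<Omega> x * (- D x w))"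
  proof -
    have "(\<lambda>n. LINT x|lborel. indicator \<Omega> x * ((f (x - h n *\<^sub>R w) - f x) / h n)) \<longlonglongrightarrow> (LINT x|lborel. indicator \<Omega> x * (- D x w))"
    proof (rule integral_dominated_convergence[where w = "\<lambda>x. G * indicator \<Omega> x"])
      show "(\<lambda>x. indicator \<Omega> x * - D x w) \<in> borel_measurable lborel"
        using borel_measurable_continuous_onI[OF Dc] by simp
      show "(\<lambda>x. indicator \<Omega> x * ((f (x - h n *\<^sub>R w) - f x) / h n)) \<in> borel_measurable lborel" for n
        by measurable
      show "integrable lborel (\<lambda>x. G * indicator \<Omega> x)"
        using emeasure_region_finite by simp
      have line: "((\<lambda>t. f (x - t *\<^sub>R w)) has_real_derivative - D (x - t *\<^sub>R w) w) (at t)" for x t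
      proof -
        have "((\<lambda>t. x - t *\<^sub>R w) has_derivative (\<lambda>t. - (t *\<^sub>R w))) (at t)"
          by (auto intro!: derivative_eq_intros)
        from has_derivative_compose[OF this der]
        have "((\<lambda>t. f (x - t *\<^sub>R w)) has_derivative (\<lambda>u. D (x - t *\<^sub>R w) (- (u *\<^sub>R w)))) (at t)" .
        moreover have "D (x - t *\<^sub>R w) (- (u *\<^sub>R w)) = - D (x - t *\<^sub>R w) w * u" for u
          using has_derivative_linear[OF der, of "x - t *\<^sub>R w"]
          by (simp add: linear_neg linear_scale[unfolded scaleR_conv_of_real])
        moreover have "(*) (- D (x - t *\<^sub>R w) w) = (\<lambda>u. - D (x - t *\<^sub>R w) w * u)" by (rule ext) simp
        ultimately show ?thesis by (simp only: has_field_derivative_def)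
      qed
      show "AE x in lborel. (\<lambda>n. indicator \<Omega> x * ((f (x - h n *\<^sub>R w) - f x) / h n)) \<longlonglongrightarrow> indicator \<Omega> x * - D x w"
      proof (intro AE_I2 tendsto_mult tendsto_const)
        fix x
        have "((\<lambda>t. (f (x - (0 + t) *\<^sub>R w) - f (x - 0 *\<^sub>R w)) / t) \<longlongrightarrow> - D (x - 0 *\<^sub>R w) w) (at 0)"
          using line[of x 0] unfolding DERIV_def by simp
        from filterlim_compose[OF this h_at]
        show "(\<lambda>n. (f (x - h n *\<^sub>R w) - f x) / h n) \<longlonglongrightarrow> - D x w" by simp
      qed
      show "AE x in lborel. norm (indicator \<Omega> x * ((f (x - h n *\<^sub>R w) - f x) / h n)) \<le> G * indicator \<Omega> x" for n
      proof (rule AE_I2)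
        fix x
        show "norm (indicator \<Omega> x * ((f (x - h n *\<^sub>R w) - f x) / h n)) \<le> G * indicator \<Omega> x"
        proof (cases "x \<in> \<Omega>")
          case True
          \<comment> \<open>The mean value theorem bounds the difference quotients by
            \<open>G\<close> uniformly in \<open>n\<close>, as dominated convergence
            requires.\<close>
          obtain z where z: "0 < z" "z < h n" "f (x - h n *\<^sub>R w) - f (x - 0 *\<^sub>R w) = (h n - 0) * (- D (x - z *\<^sub>R w) w)"
            using MVT2[OF h(1)[of n], of "\<lambda>t. f (x - t *\<^sub>R w)" "\<lambda>t. - D (x - t *\<^sub>R w) w"] line by blast
          have "norm (D (x - z *\<^sub>R w) w) \<le> G"
            using z h(2)[of n] by (intro G near True) auto
          then show ?thesis using True z h(1)[of n] by simp
        qed simp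
      qed
    qed
    moreover have "(LINT x|lborel. f x * side_jump (h n *\<^sub>R w) x) / h n = (LINT x|lborel. indicator \<Omega> x * ((f (x - h n *\<^sub>R w) - f x) / h n))" for n
      unfolding integral_side_jump[OF f] Bochner_Integration.integral_divide_zero[symmetric] by simp
    ultimately show ?thesis by (simp only:)
  qed
  have right: "(\<lambda>n. (LINT p|lborel. indicator (goodp i (h n *\<^sub>R w)) p * (f (sweep i (h n *\<^sub>R w) p) * cr (K' i (p$1)) (h n *\<^sub>R w))) / h n)
      \<longlonglongrightarrow> integral {0..1} (\<lambda>s. f (K i s) * cr (K' i s) w)" if i: "i < m" for i
  proof -
    note [measurable] = measurable_K'[OF i]
    let ?Q = "{p::real^2. 0 < p$1 \<and> p$1 < 1 \<and> 0 < p$2 \<and> p$2 < 1}"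
    have gm [measurable]: "goodp i v \<in> sets borel" for v using goodp_open[OF i] by auto
    have sm [measurable]: "sweep i v \<in> borel_measurable borel" for v
      using sweep_cont[OF i] by (rule borel_measurable_continuous_onI)
    have Km [measurable]: "K i \<in> borel_measurable borel"
      using K_cont[OF i] by (rule borel_measurable_continuous_onI)
    have Qm [measurable]: "?Q \<in> sets borel"
      by measurable
    obtain N where N: "\<And>s. s \<in> {0..1} \<Longrightarrow> norm (K' i s) \<le> N"
      using continuous_bounded_compact[OF K'_cont[OF i], of "{0..1}"] compact_Icc by blast
    have "(\<lambda>n. LINT p|lborel. indicator (goodp i (h n *\<^sub>R w)) p * (f (sweep i (h n *\<^sub>R w) p) * cr (K' i (p$1)) w))
      \<longlonglongrightarrow> (LINT p|lborel. indicator ?Q p * (f (K i (p$1)) * cr (K' i (p$1)) w))"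
    proof (rule integral_dominated_convergence[where w = "\<lambda>p. A' * (N * norm w) * indicator ?Q p"])
      show "(\<lambda>p. indicator ?Q p * (f (K i (p$1)) * cr (K' i (p$1)) w)) \<in> borel_measurable lborel"
        by measurable
      show "(\<lambda>p. indicator (goodp i (h n *\<^sub>R w)) p * (f (sweep i (h n *\<^sub>R w) p) * cr (K' i (p$1)) w)) \<in> borel_measurable lborel" for n
        by measurable
      have "bounded ?Q"
        by (rule bounded_subset[of "cbox (vec2 0 0) (vec2 1 1)"]) (auto simp: mem_box_cart forall_2 bounded_cbox)
      then have "emeasure lborel ?Q < \<infinity>" using emeasure_bounded_finite by auto
      then show "integrable lborel (\<lambda>p. A' * (N * norm w) * indicator ?Q p)" by simp
      show "AE p in lborel. (\<lambda>n. indicator (goodp i (h n *\<^sub>R w)) p * (f (sweep i (h n *\<^sub>R w) p) * cr (K' i (p$1)) w))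
        \<longlonglongrightarrow> indicator ?Q p * (f (K i (p$1)) * cr (K' i (p$1)) w)"
      proof (rule AE_I2)
        fix p :: "real^2"
        show "(\<lambda>n. indicator (goodp i (h n *\<^sub>R w)) p * (f (sweep i (h n *\<^sub>R w) p) * cr (K' i (p$1)) w))
          \<longlonglongrightarrow> indicator ?Q p * (f (K i (p$1)) * cr (K' i (p$1)) w)"
        \<comment> \<open>At a transversal parameter \<open>cr\<close> is linear in
          \<open>h n\<close> while the threshold in \<open>good\<close> is quadratic, so the
          parameter is eventually good. Where \<open>cr\<close> vanishes, so do both
          integrands.\<close>
        proof (cases "p \<in> ?Q \<and> cr (K' i (p$1)) w \<noteq> 0")
          case True
          have sym: "\<bar>cr (h n *\<^sub>R w) (K' i (p$1))\<bar> = h n * \<bar>cr (K' i (p$1)) w\<bar>" for n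
          proof -
            have "cr (h n *\<^sub>R w) (K' i (p$1)) = - (h n * cr (K' i (p$1)) w)"
              by (simp add: cr_def algebra_simps)
            then show ?thesis using h(1)[of n] by (simp add: abs_mult)
          qed
          have "(\<lambda>n. h n * (C0 * (norm w)\<^sup>2)) \<longlonglongrightarrow> 0 * (C0 * (norm w)\<^sup>2)"
            by (intro tendsto_mult h0 tendsto_const)
          then have "\<forall>\<^sub>F n in sequentially. h n * (C0 * (norm w)\<^sup>2) < \<bar>cr (K' i (p$1)) w\<bar>"
            using True by (intro order_tendstoD(2)) auto
          then have ev: "\<forall>\<^sub>F n in sequentially. indicator (goodp i (h n *\<^sub>R w)) p = (1::real)"
          proof eventually_elim
            case (elim n)
            have "h n * (h n * (C0 * (norm w)\<^sup>2)) < h n * \<bar>cr (K' i (p$1)) w\<bar>"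
              using elim h(1)[of n] by simp
            then have "p \<in> goodp i (h n *\<^sub>R w)"
              using True h(1)[of n] unfolding goodp_def good_def mem_Collect_eq sym
              by (simp add: power_mult_distrib power2_eq_square ac_simps)
            then show ?case by simp
          qed
          have "(\<lambda>n. sweep i (h n *\<^sub>R w) p) \<longlonglongrightarrow> K i (p$1) - (p$2) *\<^sub>R (0 *\<^sub>R w)"
            unfolding sweep_def by (intro tendsto_intros h0)
          then have "(\<lambda>n. sweep i (h n *\<^sub>R w) p) \<longlonglongrightarrow> K i (p$1)" by simp
          then have "(\<lambda>n. f (sweep i (h n *\<^sub>R w) p)) \<longlonglongrightarrow> f (K i (p$1))"
            by (rule isCont_tendsto_compose[rotated]) (use der has_derivative_continuous in blast)
          moreover have "(\<lambda>n. indicator (goodp i (h n *\<^sub>R w)) p) \<longlonglongrightarrow> (indicator ?Q p :: real)"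
            using True ev by (intro tendsto_eventually) simp
          ultimately show ?thesis by (intro tendsto_mult tendsto_const)
        next
          case False
          have "p \<notin> goodp i v" if "p \<notin> ?Q" for v using that by (auto simp: goodp_def good_def)
          with False show ?thesis by auto
        qed
      qed
      show "AE p in lborel. norm (indicator (goodp i (h n *\<^sub>R w)) p * (f (sweep i (h n *\<^sub>R w) p) * cr (K' i (p$1)) w))
        \<le> A' * (N * norm w) * indicator ?Q p" for n
      proof (rule AE_I2)
        fix p :: "real^2"
        show "norm (indicator (goodp i (h n *\<^sub>R w)) p * (f (sweep i (h n *\<^sub>R w) p) * cr (K' i (p$1)) w))
          \<le> A' * (N * norm w) * indicator ?Q p"
        proof (cases "p \<in> goodp i (h n *\<^sub>R w)")
          case True
          then have Q: "p \<in> ?Q" by (auto simp: goodp_def good_def)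
          have "p$2 * h n \<le> 1" "0 \<le> p$2 * h n" using Q h[of n] by (auto intro: mult_le_one)
          then have "K i (p$1) - (p$2 * h n) *\<^sub>R w \<in> ?B"
            by (intro near K_in i) auto
          then have "\<bar>f (sweep i (h n *\<^sub>R w) p)\<bar> \<le> A'"
            by (intro A') (simp add: sweep_def)
          moreover have "\<bar>cr (K' i (p$1)) w\<bar> \<le> N * norm w"
            using Q by (intro order_trans[OF abs_cr_le] mult_right_mono N) auto
          ultimately show ?thesis using True Q by (auto simp: abs_mult intro!: mult_mono)
        next
          case False
          have "0 \<le> N" using order_trans[OF norm_ge_zero N[of 0]] by simp
          then show ?thesis using False by (simp add: A'_def)
        qed
      qed
    qed
    also have "(LINT p|lborel. indicator ?Q p * (f (K i (p$1)) * cr (K' i (p$1)) w)) = integral {0..1} (\<lambda>s. f (K i s) * cr (K' i s) w)"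
      by (rule integral_unit_square) (intro continuous_intros K'_cont[OF i] continuous_on_compose2[OF f K_cont[OF i]], auto)
    moreover have "(LINT p|lborel. indicator (goodp i (h n *\<^sub>R w)) p * (f (sweep i (h n *\<^sub>R w) p) * cr (K' i (p$1)) (h n *\<^sub>R w))) / h n
      = (LINT p|lborel. indicator (goodp i (h n *\<^sub>R w)) p * (f (sweep i (h n *\<^sub>R w) p) * cr (K' i (p$1)) w))" for n
    proof -
      have "cr a (h n *\<^sub>R w) = h n * cr a w" for a by (simp add: cr_def algebra_simps)
      then show ?thesis
        unfolding Bochner_Integration.integral_divide_zero[symmetric] using h(1)[of n]
        by (intro Bochner_Integration.integral_cong) auto
    qed
    ultimately show ?thesis by simp
  qed
  let ?L = "\<lambda>n. (LINT x|lborel. f x * side_jump (h n *\<^sub>R w) x)"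
  let ?R = "\<lambda>n. (\<Sum>i<m. LINT p|lborel. indicator (goodp i (h n *\<^sub>R w)) p * (f (sweep i (h n *\<^sub>R w) p) * cr (K' i (p$1)) (h n *\<^sub>R w)))"
  have right': "(\<lambda>n. ?R n / h n) \<longlonglongrightarrow> (\<Sum>i<m. integral {0..1} (\<lambda>s. f (K i s) * cr (K' i s) w))"
    unfolding sum_divide_distrib by (intro tendsto_sum right) auto
  \<comment> \<open>The unswept part is of order \<open>(h n)^2\<close>; one factor
    \<open>h n\<close> survives the division.\<close>
  have err: "(\<lambda>n. ?L n / h n - ?R n / h n) \<longlonglongrightarrow> 0"
  proof (rule Lim_null_comparison)
    show "\<forall>\<^sub>F n in sequentially. norm (?L n / h n - ?R n / h n) \<le> h n * (A' * (m * (C0 * (norm w)\<^sup>2)))"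
    proof (intro always_eventually allI)
      fix n
      have "\<bar>?L n - ?R n\<bar> \<le> A' * (m * (C0 * (norm (h n *\<^sub>R w))\<^sup>2))"
      proof (rule side_jump_decomposition[OF h(3) f])
        fix x assume "(x \<in> \<Omega>) \<noteq> (x + h n *\<^sub>R w \<in> \<Omega>)"
        then have "x \<in> \<Omega> \<or> x + h n *\<^sub>R w \<in> \<Omega>" by auto
        then have "x \<in> ?B"
          using near[of x 0] near[of "x + h n *\<^sub>R w" "h n"] h[of n] by auto
        then show "\<bar>f x\<bar> \<le> A'" by (rule A')
      qed (simp add: A'_def)
      also have "\<dots> = h n * (h n * (A' * (m * (C0 * (norm w)\<^sup>2))))"
        using h(1)[of n] by (simp add: power2_eq_square)
      finally have "\<bar>?L n - ?R n\<bar> / h n \<le> h n * (A' * (m * (C0 * (norm w)\<^sup>2)))"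
        using h(1)[of n] by (simp add: pos_divide_le_eq mult.commute)
      then show "norm (?L n / h n - ?R n / h n) \<le> h n * (A' * (m * (C0 * (norm w)\<^sup>2)))"
        using h(1)[of n] by (simp add: diff_divide_distrib[symmetric])
    qed
    show "(\<lambda>n. h n * (A' * (m * (C0 * (norm w)\<^sup>2)))) \<longlonglongrightarrow> 0"
      using tendsto_mult[OF h0 tendsto_const] by simp
  qed
  have "(LINT x|lborel. indicator \<Omega> x * (- D x w)) - (\<Sum>i<m. integral {0..1} (\<lambda>s. f (K i s) * cr (K' i s) w)) = 0"
    using LIMSEQ_unique[OF tendsto_diff[OF left right'] err] .
  moreover have "(LINT x|lborel. indicator \<Omega> x * (- D x w)) = - (LINT x|lborel. indicator \<Omega> x * D x w)"
    by simp
  moreover have "integral {0..1} (\<lambda>s. f (K i s) * cr (K' i s) w) = - integral {0..1} (\<lambda>s. f (K i s) * cr w (K' i s))" for i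
    by (subst integral_neg[symmetric]) (simp add: cr_def algebra_simps)
  ultimately show ?thesis by (simp add: sum_negf)
qed

end

section \<open>Linking numbers of circles\<close>

definition dist3 :: "real^2 \<Rightarrow> real \<Rightarrow> real^2 \<Rightarrow> real" where
  "dist3 x z y = sqrt ((norm (x - y))\<^sup>2 + z\<^sup>2)"

text \<open>The normal component, up to sign, of the gradient of the Newton potential at height \<open>z\<close>: its integral
  over \<open>y \<in> \<Omega>\<close> is the solid angle of \<open>\<Omega>\<close> seen from \<open>(x, z)\<close>.\<close>

definition solid_density :: "real^2 \<Rightarrow> real \<Rightarrow> real^2 \<Rightarrow> real" where
  "solid_density x z y = z / dist3 x z y ^ 3"

text \<open>The rate of change of \<open>solid_density\<close> at a fixed \<open>y\<close> while the
  viewpoint \<open>(x, z)\<close> moves with velocity \<open>(g, g3)\<close>.\<close>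

definition solid_density_deriv :: "real^2 \<Rightarrow> real \<Rightarrow> real^2 \<Rightarrow> real \<Rightarrow> real^2 \<Rightarrow> real" where
  "solid_density_deriv x z g g3 y = g3 / dist3 x z y ^ 3 - 3 * z * (g \<bullet> (x - y) + g3 * z) / dist3 x z y ^ 5"

lemma dist3_pos: "z \<noteq> 0 \<or> x \<noteq> y \<Longrightarrow> dist3 x z y > 0"
  by (auto simp: dist3_def intro: add_nonneg_pos add_pos_nonneg)

lemma dist3_sq: "(dist3 x z y)\<^sup>2 = (norm (x - y))\<^sup>2 + z\<^sup>2"
  by (simp add: dist3_def)

lemma continuous_on_dist3 [continuous_intros]:
  assumes "continuous_on S f" "continuous_on S g" "continuous_on S h"
  shows "continuous_on S (\<lambda>x. dist3 (f x) (g x) (h x))"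
  unfolding dist3_def by (intro continuous_intros assms)

lemma inverse_sqrt_cube_deriv:
  fixes u :: real assumes "u > 0"
  shows "((\<lambda>u. 1 / sqrt u ^ 3) has_real_derivative - (3 / 2) / sqrt u ^ 5) (at u)"
proof -
  have "sqrt u > 0" using assms by simp
  have e: "u = sqrt u * sqrt u" using assms by simp
  have "((\<lambda>u. 1 / sqrt u ^ 3) has_real_derivative
      (0 * sqrt u ^ 3 - 1 * (real 3 * (inverse (sqrt u) / 2 * sqrt u ^ (3 - Suc 0)))) / (sqrt u ^ 3 * sqrt u ^ 3)) (at u)"
    using assms by (auto intro!: derivative_eq_intros)
  also have "(0 * sqrt u ^ 3 - 1 * (real 3 * (inverse (sqrt u) / 2 * sqrt u ^ (3 - Suc 0)))) / (sqrt u ^ 3 * sqrt u ^ 3) = - (3 / 2) / sqrt u ^ 5"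
    using \<open>sqrt u > 0\<close> by (simp add: divide_simps power_numeral_reduce)
  finally show ?thesis .
qed

lemma inverse_dist3_cube_deriv:
  assumes "z \<noteq> 0"
  shows "((\<lambda>y. 1 / dist3 x z y ^ 3) has_derivative (\<lambda>h. 3 * (h \<bullet> (x - y)) / dist3 x z y ^ 5)) (at y)"
proof -
  let ?N = "\<lambda>y. (x - y) \<bullet> (x - y) + z\<^sup>2"
  have "((\<lambda>y. x - y) has_derivative (\<lambda>h. - h)) (at y)" by (auto intro!: derivative_eq_intros)
  then have N: "(?N has_derivative (\<lambda>h. - 2 * (h \<bullet> (x - y)))) (at y)"
    by (auto intro!: derivative_eq_intros simp: inner_commute)
  have pos: "?N y > 0" using assms by (auto intro: add_nonneg_pos)
  have "((\<lambda>u. 1 / sqrt u ^ 3) has_derivative (\<lambda>h. (- (3 / 2) / sqrt (?N y) ^ 5) * h)) (at (?N y))"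
    using inverse_sqrt_cube_deriv[OF pos] unfolding has_field_derivative_def .
  from has_derivative_compose[OF N this]
  show ?thesis
    by (simp add: dist3_def power2_norm_eq_inner)
qed

lemma solid_density_has_derivative:
  assumes X: "(X has_vector_derivative g) (at s)" and z: "(z has_real_derivative g3) (at s)"
    and nz: "z s \<noteq> 0"
  shows "((\<lambda>s. solid_density (X s) (z s) y) has_real_derivative solid_density_deriv (X s) (z s) g g3 y) (at s)"
proof -
  let ?N = "\<lambda>s. (X s - y) \<bullet> (X s - y) + (z s)\<^sup>2"
  have Xd: "((\<lambda>s. X s - y) has_vector_derivative g) (at s)"
    using X by (auto intro!: derivative_eq_intros)
  have "((\<lambda>s. (X s - y) \<bullet> (X s - y)) has_vector_derivative ((X s - y) \<bullet> g + g \<bullet> (X s - y))) (at s)"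
    by (rule bounded_bilinear.has_vector_derivative[OF bounded_bilinear_inner Xd Xd])
  then have N1: "((\<lambda>s. (X s - y) \<bullet> (X s - y)) has_real_derivative 2 * (g \<bullet> (X s - y))) (at s)"
    by (simp add: has_real_derivative_iff_has_vector_derivative inner_commute)
  have N: "(?N has_real_derivative 2 * (g \<bullet> (X s - y)) + 2 * z s * g3) (at s)"
    by (rule derivative_eq_intros N1 z refl | simp)+
  have pos: "?N s > 0" using nz by (auto intro: add_nonneg_pos)
  have "((\<lambda>s. 1 / sqrt (?N s) ^ 3) has_real_derivative (- (3 / 2) / sqrt (?N s) ^ 5) * (2 * (g \<bullet> (X s - y)) + 2 * z s * g3)) (at s)"
    by (rule DERIV_chain2[OF inverse_sqrt_cube_deriv[OF pos] N])
  from DERIV_mult[OF z this]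
  have "((\<lambda>s. z s * (1 / sqrt (?N s) ^ 3)) has_real_derivative
    g3 * (1 / sqrt (?N s) ^ 3) + (- (3 / 2) / sqrt (?N s) ^ 5) * (2 * (g \<bullet> (X s - y)) + 2 * z s * g3) * z s) (at s)" .
  moreover have "g3 * (1 / sqrt (?N s) ^ 3) + (- (3 / 2) / sqrt (?N s) ^ 5) * (2 * (g \<bullet> (X s - y)) + 2 * z s * g3) * z s
    = g3 / sqrt (?N s) ^ 3 - 3 * z s * (g \<bullet> (X s - y) + g3 * z s) / sqrt (?N s) ^ 5"
    using pos by (simp add: field_simps)
  ultimately show ?thesis
    by (simp add: solid_density_def[abs_def] solid_density_deriv_def dist3_def power2_norm_eq_inner)
qed

text \<open>The integrand of the Gauss integral, for the curve point \<open>(x, z)\<close> with velocity \<open>(g, g3)\<close> and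
  the planar point \<open>y\<close> with velocity \<open>k\<close>.\<close>

definition gauss :: "real^2 \<Rightarrow> real \<Rightarrow> real^2 \<Rightarrow> real \<Rightarrow> real^2 \<Rightarrow> real^2 \<Rightarrow> real" where
  "gauss x z g g3 y k =
     (((x$2 - y$2) * g3 - z * g$2) * k$1 + (z * g$1 - (x$1 - y$1) * g3) * k$2) / dist3 x z y ^ 3"

lemma embed_plane_vec3: "embed_plane y = vec3 y 0"
  by (simp add: embed_plane_def vec3_def)

lemma norm_vec3: "norm (vec3 a b) = sqrt ((norm a)\<^sup>2 + b\<^sup>2)"
  unfolding norm_sq2 by (simp add: norm_vec_def L2_set_def sum_3)

lemma gauss_eq:
  "(vec3 x z - vec3 y 0) \<bullet> cross3 (vec3 g g3) (vec3 k 0) / norm (vec3 x z - vec3 y 0) ^ 3 = gauss x z g g3 y k"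
proof -
  have "vec3 x z - vec3 y 0 = vec3 (x - y) z" by (simp add: vec_eq_iff forall_3)
  then show ?thesis
    by (simp add: norm_vec3 gauss_def dist3_def)
       (simp add: cross3_def inner_vec_def sum_3 algebra_simps)
qed

context planar_domain
begin

text \<open>For a fixed velocity of the viewpoint the Gauss integrand is a planar field
  \<open>(P, Q)\<close> applied to the tangent of \<open>K\<close>, so Green's theorem yields the
  area integral of its curl. As the Newton potential is harmonic away from its source, this curl is
  minus the derivative of the solid angle density along the velocity. The condition
  \<open>z \<noteq> 0\<close> keeps the field differentiable on the whole plane.\<close>

lemma gauss_inner_integral:
  assumes z: "z \<noteq> 0"
  shows "(\<Sum>i<m. integral {0..1} (\<lambda>t. gauss x z g g3 (K i t) (K' i t)))
    = - (LINT y|lborel. indicator \<Omega> y * solid_density_deriv x z g g3 y)"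
proof -
  let ?d = "\<lambda>y. dist3 x z y"
  have dpos: "?d y > 0" for y using z by (simp add: dist3_pos)
  have dne: "?d y \<noteq> 0" for y using dpos[of y] by simp
  define P where "P y = ((x$2 - y$2) * g3 - z * g$2) * (1 / ?d y ^ 3)" for y
  define Q where "Q y = (z * g$1 - (x$1 - y$1) * g3) * (1 / ?d y ^ 3)" for y
  define DP where "DP y h = ((x$2 - y$2) * g3 - z * g$2) * (3 * (h \<bullet> (x - y)) / ?d y ^ 5) + (- h$2 * g3) * (1 / ?d y ^ 3)" for y h
  define DQ where "DQ y h = (z * g$1 - (x$1 - y$1) * g3) * (3 * (h \<bullet> (x - y)) / ?d y ^ 5) + (h$1 * g3) * (1 / ?d y ^ 3)" for y h
  have nth: "((\<lambda>p. p $ j) has_derivative (\<lambda>h. h $ j)) (at y)" for j :: 2 and y :: "real^2"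
    by (intro bounded_linear_imp_has_derivative bounded_linear_vec_nth)
  have derP: "(P has_derivative DP y) (at y)" for y
  proof -
    have "((\<lambda>y. (x$2 - y$2) * g3 - z * g$2) has_derivative (\<lambda>h. - h$2 * g3)) (at y)"
      by (auto intro!: derivative_eq_intros nth)
    from has_derivative_mult[OF this inverse_dist3_cube_deriv[OF z]]
    show ?thesis unfolding P_def[abs_def] DP_def[abs_def] .
  qed
  have derQ: "(Q has_derivative DQ y) (at y)" for y
  proof -
    have "((\<lambda>y. z * g$1 - (x$1 - y$1) * g3) has_derivative (\<lambda>h. h$1 * g3)) (at y)"
      by (auto intro!: derivative_eq_intros nth)
    from has_derivative_mult[OF this inverse_dist3_cube_deriv[OF z]]
    show ?thesis unfolding Q_def[abs_def] DQ_def[abs_def] .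
  qed
  have cP: "continuous_on UNIV P" and cQ: "continuous_on UNIV Q"
    and cDP: "continuous_on UNIV (\<lambda>y. DP y h)" and cDQ: "continuous_on UNIV (\<lambda>y. DQ y h)" for h
    unfolding P_def[abs_def] Q_def[abs_def] DP_def[abs_def] DQ_def[abs_def] by (intro continuous_intros dne; simp add: dne)+
  have gP: "(LINT y|lborel. indicator \<Omega> y * DP y (axis 2 1)) = (\<Sum>i<m. integral {0..1} (\<lambda>t. - (P (K i t) * K' i t $ 1)))"
    using green[OF derP cDP, of "axis 2 1"] by (simp add: cr_def axis_def)
  have gQ: "(LINT y|lborel. indicator \<Omega> y * DQ y (axis 1 1)) = (\<Sum>i<m. integral {0..1} (\<lambda>t. Q (K i t) * K' i t $ 2))"
    using green[OF derQ cDQ, of "axis 1 1"] by (simp add: cr_def axis_def)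
  have iP: "integrable lborel (\<lambda>y. indicator \<Omega> y * DP y (axis 2 1))"
    using integrable_region[OF cDP[of "axis 2 1"], of 0] by (simp add: mult.commute)
  have iQ: "integrable lborel (\<lambda>y. indicator \<Omega> y * DQ y (axis 1 1))"
    using integrable_region[OF cDQ[of "axis 1 1"], of 0] by (simp add: mult.commute)
  have pt: "DQ y (axis 1 1) - DP y (axis 2 1) = - solid_density_deriv x z g g3 y" for y
  proof -
    let ?a = "x$1 - y$1" and ?b = "x$2 - y$2"
    have sq: "?a\<^sup>2 + ?b\<^sup>2 + z\<^sup>2 = (?d y)\<^sup>2" unfolding dist3_sq norm_sq2 by simp
    have gi: "g \<bullet> (x - y) = g$1 * ?a + g$2 * ?b" by (simp add: inner_vec_def sum_2)
    have "DQ y (axis 1 1) - DP y (axis 2 1)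
      = 2 * g3 * (1 / ?d y ^ 3) + 3 * (z * (g$1 * ?a + g$2 * ?b) - g3 * (?a\<^sup>2 + ?b\<^sup>2)) * (1 / ?d y ^ 5)"
      by (simp add: DQ_def DP_def inner_axis' axis_def inner_vec_def sum_2 power2_eq_square algebra_simps diff_divide_distrib add_divide_distrib)
    \<comment> \<open>Eliminating the horizontal distance reduces the terms in \<open>g3\<close> to
      powers of the full distance, which then combine as in
      \<open>solid_density_deriv\<close>.\<close>
    also have "?a\<^sup>2 + ?b\<^sup>2 = (?d y)\<^sup>2 - z\<^sup>2" using sq by simp
    also have "2 * g3 * (1 / ?d y ^ 3) + 3 * (z * (g$1 * ?a + g$2 * ?b) - g3 * ((?d y)\<^sup>2 - z\<^sup>2)) * (1 / ?d y ^ 5)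
      = 2 * g3 * (1 / ?d y ^ 3) - 3 * g3 * ((?d y)\<^sup>2 * (1 / ?d y ^ 5)) + 3 * z * (g$1 * ?a + g$2 * ?b + g3 * z) * (1 / ?d y ^ 5)"
      by (simp add: algebra_simps power2_eq_square)
    also have "(?d y)\<^sup>2 * (1 / ?d y ^ 5) = 1 / ?d y ^ 3"
      using dne[of y] by (simp add: power_numeral_reduce)
    finally show ?thesis unfolding solid_density_deriv_def gi by simp
  qed
  have "(\<Sum>i<m. integral {0..1} (\<lambda>t. gauss x z g g3 (K i t) (K' i t)))
    = (\<Sum>i<m. integral {0..1} (\<lambda>t. Q (K i t) * K' i t $ 2) - integral {0..1} (\<lambda>t. - (P (K i t) * K' i t $ 1)))"
  proof (intro sum.cong refl)
    fix i assume "i \<in> {..<m}"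
    then have i: "i < m" by simp
    have "(\<lambda>t. gauss x z g g3 (K i t) (K' i t)) = (\<lambda>t. Q (K i t) * K' i t $ 2 - - (P (K i t) * K' i t $ 1))"
      by (rule ext) (simp add: gauss_def P_def Q_def add_divide_distrib)
    then show "integral {0..1} (\<lambda>t. gauss x z g g3 (K i t) (K' i t))
      = integral {0..1} (\<lambda>t. Q (K i t) * K' i t $ 2) - integral {0..1} (\<lambda>t. - (P (K i t) * K' i t $ 1))"
      by (simp only:) (intro Henstock_Kurzweil_Integration.integral_diff integrable_continuous_real continuous_intros
            continuous_on_compose2[OF cP K_cont[OF i]] continuous_on_compose2[OF cQ K_cont[OF i]] K'_cont[OF i], auto)
  qed
  also have "\<dots> = (LINT y|lborel. indicator \<Omega> y * DQ y (axis 1 1)) - (LINT y|lborel. indicator \<Omega> y * DP y (axis 2 1))"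
    unfolding gP gQ sum_subtractf ..
  also have "\<dots> = (LINT y|lborel. indicator \<Omega> y * (DQ y (axis 1 1) - DP y (axis 2 1)))"
    by (subst Bochner_Integration.integral_diff[OF iQ iP, symmetric]) (simp add: right_diff_distrib)
  also have "\<dots> = - (LINT y|lborel. indicator \<Omega> y * solid_density_deriv x z g g3 y)"
    unfolding pt by simp
  finally show ?thesis .
qed

definition solid_angle :: "real^2 \<Rightarrow> real \<Rightarrow> real" where
  "solid_angle x z = (LINT y|lborel. indicator \<Omega> y * solid_density x z y)"

text \<open>Fubini moves the integral over the parameter inside the area integral, where the
  fundamental theorem of calculus evaluates it for each \<open>y\<close>. A nonzero height makes the
  integrand continuous on the compact product of \<open>{a..b}\<close> and the region.\<close>

lemma integral_solid_angle:
  assumes ab: "a \<le> b" and X: "\<And>s. (X has_vector_derivative X' s) (at s)" and z: "\<And>s. (z has_real_derivative z' s) (at s)"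
    and X'c: "continuous_on UNIV X'" and z'c: "continuous_on UNIV z'"
    and nz: "\<And>s. s \<in> {a..b} \<Longrightarrow> z s \<noteq> 0"
  shows "integral {a..b} (\<lambda>s. \<Sum>i<m. integral {0..1} (\<lambda>t. gauss (X s) (z s) (X' s) (z' s) (K i t) (K' i t)))
    = solid_angle (X a) (z a) - solid_angle (X b) (z b)"
proof -
  have Xc: "continuous_on UNIV X"
    using X by (intro continuous_at_imp_continuous_on) (auto intro: has_vector_derivative_continuous)
  have zc: "continuous_on UNIV z"
    using z by (intro continuous_at_imp_continuous_on) (auto intro: DERIV_isCont)
  let ?F = "\<lambda>s y. solid_density_deriv (X s) (z s) (X' s) (z' s) y"
  have dne: "dist3 (X s) (z s) y \<noteq> 0" if "s \<in> {a..b}" for s y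
    using dist3_pos[of "z s" "X s" y] nz[OF that] by auto
  have cF: "continuous_on ({a..b} \<times> UNIV) (\<lambda>p. ?F (fst p) (snd p))"
    unfolding solid_density_deriv_def
    by (intro continuous_intros continuous_on_compose2[OF Xc] continuous_on_compose2[OF zc]
         continuous_on_compose2[OF X'c] continuous_on_compose2[OF z'c]) (auto simp: dne)
  have "integrable lborel (\<lambda>p. indicator ({a..b} \<times> \<Omega>) p *\<^sub>R ?F (fst p) (snd p))"
    by (intro borel_integrable_compact compact_Times compact_region continuous_on_subset[OF cF]) auto
  then have int: "integrable (lborel \<Otimes>\<^sub>M lborel) (case_prod (\<lambda>s y. indicator {a..b} s * (indicator \<Omega> y * ?F s y)))"
    unfolding lborel_prod by (rule Bochner_Integration.integrable_cong[OF refl, THEN iffD1, rotated]) (auto simp: indicator_def)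
  have gs: "(\<Sum>i<m. integral {0..1} (\<lambda>t. gauss (X s) (z s) (X' s) (z' s) (K i t) (K' i t))) = - (LINT y|lborel. indicator \<Omega> y * ?F s y)"
    if "s \<in> {a..b}" for s
    by (rule gauss_inner_integral[OF nz[OF that]])
  have fst_int: "set_integrable lborel {a..b} (\<lambda>s. LINT y|lborel. indicator \<Omega> y * ?F s y)"
    using lborel_pair.integrable_fst[OF int] by (simp add: set_integrable_def)
  have "integral {a..b} (\<lambda>s. \<Sum>i<m. integral {0..1} (\<lambda>t. gauss (X s) (z s) (X' s) (z' s) (K i t) (K' i t)))
    = integral {a..b} (\<lambda>s. - (LINT y|lborel. indicator \<Omega> y * ?F s y))"
    by (rule integral_cong) (rule gs)
  also have "\<dots> = - (LINT s:{a..b}|lborel. LINT y|lborel. indicator \<Omega> y * ?F s y)"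
    by (simp add: set_borel_integral_eq_integral(2)[OF fst_int])
  also have "(LINT s:{a..b}|lborel. LINT y|lborel. indicator \<Omega> y * ?F s y)
    = (LINT s|lborel. LINT y|lborel. indicator {a..b} s * (indicator \<Omega> y * ?F s y))"
    by (simp add: set_lebesgue_integral_def)
  also have "\<dots> = (LINT y|lborel. LINT s|lborel. indicator {a..b} s * (indicator \<Omega> y * ?F s y))"
    by (rule lborel_pair.Fubini_integral[OF int, symmetric])
  also have "\<dots> = (LINT y|lborel. indicator \<Omega> y * (solid_density (X b) (z b) y - solid_density (X a) (z a) y))"
  proof (rule Bochner_Integration.integral_cong[OF refl])
    fix y
    have c: "continuous_on {a..b} (\<lambda>s. ?F s y)"
      by (rule continuous_on_compose2[OF cF, of _ "\<lambda>s. (s, y)", simplified]) (intro continuous_intros, auto)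
    have si: "set_integrable lborel {a..b} (\<lambda>s. ?F s y)"
      using borel_integrable_compact[OF compact_Icc c] by (simp add: set_integrable_def)

    have "((\<lambda>s. ?F s y) has_integral solid_density (X b) (z b) y - solid_density (X a) (z a) y) {a..b}"
    proof (rule fundamental_theorem_of_calculus[OF ab])
      fix s assume "s \<in> {a..b}"
      then show "((\<lambda>s. solid_density (X s) (z s) y) has_vector_derivative ?F s y) (at s within {a..b})"
        using solid_density_has_derivative[OF X z nz, of s y]
        by (simp add: has_real_derivative_iff_has_vector_derivative has_vector_derivative_at_within)
    qed
    then have "(LINT s:{a..b}|lborel. ?F s y) = solid_density (X b) (z b) y - solid_density (X a) (z a) y"
      using set_borel_integral_eq_integral(2)[OF si] by (simp add: integral_unique)
    then show "(LINT s|lborel. indicator {a..b} s * (indicator \<Omega> y * ?F s y)) = indicator \<Omega> y * (solid_density (X b) (z b) y - solid_density (X a) (z a) y)"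
      by (simp add: set_lebesgue_integral_def mult.left_commute)
  qed
  also have "\<dots> = solid_angle (X b) (z b) - solid_angle (X a) (z a)"
  proof -
    have "continuous_on UNIV (solid_density (X s) (z s))" if "s \<in> {a..b}" for s
      unfolding solid_density_def[abs_def] by (intro continuous_intros) (auto simp: dne[OF that])
    then have "integrable lborel (\<lambda>y. indicator \<Omega> y * solid_density (X s) (z s) y)" if "s \<in> {a..b}" for s
      using integrable_region[of "solid_density (X s) (z s)" 0] that by (simp add: mult.commute)
    then show ?thesis
      unfolding solid_angle_def right_diff_distrib using ab by (intro Bochner_Integration.integral_diff) auto
  qed
  finally show ?thesis by simp
qed

text \<open>Substituting \<open>y = x + z *\<^sub>R u\<close> leaves a fixed integrable kernel and
  moves the viewpoint into the indicator, which prepares the limit of vanishing height.\<close>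

lemma solid_angle_scaled:
  assumes "z > 0"
  shows "solid_angle x z = (LINT u|lborel. indicator \<Omega> (x + z *\<^sub>R u) * (1 / sqrt (1 + (norm u)\<^sup>2) ^ 3))"
proof -
  have [measurable]: "solid_density x z \<in> borel_measurable borel"
    unfolding solid_density_def dist3_def by measurable
  have "solid_angle x z = (LINT y|density (distr lborel borel (\<lambda>u. x + z *\<^sub>R u)) (\<lambda>_. ennreal (\<bar>z\<bar> ^ DIM(real^2))). indicator \<Omega> y * solid_density x z y)"
    unfolding solid_angle_def using assms by (subst lborel_affine[of z x]) (simp_all add: ennreal_power)
  also have "\<dots> = (LINT y|distr lborel borel (\<lambda>u. x + z *\<^sub>R u). z\<^sup>2 * (indicator \<Omega> y * solid_density x z y))"
    by (subst integral_density) auto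
  also have "\<dots> = (LINT u|lborel. z\<^sup>2 * (indicator \<Omega> (x + z *\<^sub>R u) * solid_density x z (x + z *\<^sub>R u)))"
    by (rule integral_distr) measurable
  also have "\<dots> = (LINT u|lborel. indicator \<Omega> (x + z *\<^sub>R u) * (1 / sqrt (1 + (norm u)\<^sup>2) ^ 3))"
  proof (rule Bochner_Integration.integral_cong[OF refl])
    fix u :: "real^2"
    have "dist3 x z (x + z *\<^sub>R u) = sqrt (z\<^sup>2 * (1 + (norm u)\<^sup>2))"
      by (simp add: dist3_def power_mult_distrib algebra_simps)
    also have "\<dots> = z * sqrt (1 + (norm u)\<^sup>2)" using assms by (simp add: real_sqrt_mult)
    finally have d: "dist3 x z (x + z *\<^sub>R u) = z * sqrt (1 + (norm u)\<^sup>2)" .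
    have "z\<^sup>2 * solid_density x z (x + z *\<^sub>R u) = 1 / sqrt (1 + (norm u)\<^sup>2) ^ 3"
      unfolding solid_density_def d using assms by (simp add: power_mult_distrib power_numeral_reduce)
    then show "z\<^sup>2 * (indicator \<Omega> (x + z *\<^sub>R u) * solid_density x z (x + z *\<^sub>R u)) = indicator \<Omega> (x + z *\<^sub>R u) * (1 / sqrt (1 + (norm u)\<^sup>2) ^ 3)"
      by (metis mult.left_commute)
  qed
  finally show ?thesis .
qed

lemma solid_angle_neg: "solid_angle x (- z) = - solid_angle x z"
  unfolding solid_angle_def solid_density_def dist3_def by simp

text \<open>Off the curve the indicator of the region is locally constant, so the rescaled
  integrands converge pointwise. The kernel dominates them, and its integral is
  \<open>2 * pi\<close>.\<close>

lemma solid_angle_tendsto: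
  assumes xs: "xs \<longlonglongrightarrow> p" and zs: "zs \<longlonglongrightarrow> 0" and pos: "\<And>n::nat. zs n > 0" and p: "p \<notin> curve_image m K"
  shows "(\<lambda>n. solid_angle (xs n) (zs n)) \<longlonglongrightarrow> 2 * pi * indicator \<Omega> p"
proof -
  let ?k = "\<lambda>u::real^2. 1 / sqrt (1 + (norm u)\<^sup>2) ^ 3"
  have k0: "?k u \<ge> 0" for u by (simp add: add_nonneg_nonneg)
  have ki: "integrable lborel ?k" and kI: "(LINT u|lborel. ?k u) = 2 * pi"
  proof -
    show "integrable lborel ?k"
      using k0 nn_integral_norm_cube by (intro integrableI_nonneg) auto
    show "(LINT u|lborel. ?k u) = 2 * pi"
      using k0 nn_integral_norm_cube by (subst integral_eq_nn_integral) auto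
  qed
  have ev: "\<forall>\<^sub>F y in nhds p. indicator \<Omega> y = (indicator \<Omega> p :: real)"
  proof (cases "p \<in> \<Omega>")
    case True
    then have "p \<in> interior \<Omega>"
      using p frontier_region closure_subset[of \<Omega>] by (auto simp: frontier_def)
    then have "\<forall>\<^sub>F y in nhds p. y \<in> interior \<Omega>" by (intro eventually_nhds_in_open) auto
    then show ?thesis by eventually_elim (use True interior_subset[of \<Omega>] in auto)
  next
    case False
    then have "\<forall>\<^sub>F y in nhds p. y \<in> - \<Omega>"
      using compact_imp_closed[OF compact_region] by (intro eventually_nhds_in_open) auto
    then show ?thesis by eventually_elim (use False in auto)
  qed
  have "(\<lambda>n. LINT u|lborel. indicator \<Omega> (xs n + zs n *\<^sub>R u) * ?k u) \<longlonglongrightarrow> (LINT u|lborel. indicator \<Omega> p * ?k u)"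
  proof (rule integral_dominated_convergence[where w = ?k])
    show "AE u in lborel. (\<lambda>n. indicator \<Omega> (xs n + zs n *\<^sub>R u) * ?k u) \<longlonglongrightarrow> indicator \<Omega> p * ?k u"
    proof (rule AE_I2)
      fix u
      have "(\<lambda>n. xs n + zs n *\<^sub>R u) \<longlonglongrightarrow> p + 0 *\<^sub>R u" by (intro tendsto_intros xs zs)
      then have "filterlim (\<lambda>n. xs n + zs n *\<^sub>R u) (nhds p) sequentially" by simp
      from eventually_compose_filterlim[OF ev this]
      show "(\<lambda>n. indicator \<Omega> (xs n + zs n *\<^sub>R u) * ?k u) \<longlonglongrightarrow> indicator \<Omega> p * ?k u"
        by (intro tendsto_eventually) (auto elim: eventually_mono)
    qed
    show "AE u in lborel. norm (indicator \<Omega> (xs n + zs n *\<^sub>R u) * ?k u) \<le> ?k u" for n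
      using k0 by (auto simp: indicator_def)
  qed (use ki in auto)
  also have "(LINT u|lborel. indicator \<Omega> p * ?k u) = 2 * pi * indicator \<Omega> p"
    unfolding Bochner_Integration.integral_mult_right_zero kI by simp
  finally show ?thesis
    using pos by (simp add: solid_angle_scaled)
qed


text \<open>The Gauss integrals of all components, taken over the parameter of \<open>K\<close>
  only; the parameter \<open>s\<close> of the space curve stays free.\<close>

definition flux :: "(real \<Rightarrow> real^2) \<Rightarrow> (real \<Rightarrow> real) \<Rightarrow> (real \<Rightarrow> real^2) \<Rightarrow> (real \<Rightarrow> real) \<Rightarrow> real \<Rightarrow> real" where
  "flux X z X' z' s = (\<Sum>i<m. integral {0..1} (\<lambda>t. gauss (X s) (z s) (X' s) (z' s) (K i t) (K' i t)))"

end

text \<open>The curve is split into its horizontal part \<open>X\<close> and its height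
  \<open>z\<close>, because the linking number is read off from the points where the height
  vanishes.\<close>

locale closed_space_curve = planar_domain m K K' K'' \<Omega>
  for m :: nat and K K' K'' :: "nat \<Rightarrow> real \<Rightarrow> real^2" and \<Omega> :: "(real^2) set" +
  fixes X X' :: "real \<Rightarrow> real^2" and z z' :: "real \<Rightarrow> real"
  assumes X_deriv: "\<And>s. (X has_vector_derivative X' s) (at s)"
    and z_deriv: "\<And>s. (z has_real_derivative z' s) (at s)"
    and X'_cont: "continuous_on UNIV X'" and z'_cont: "continuous_on UNIV z'"
    and X_per: "\<And>s. X (s + 1) = X s" and X'_per: "\<And>s. X' (s + 1) = X' s"
    and z_per: "\<And>s. z (s + 1) = z s" and z'_per: "\<And>s. z' (s + 1) = z' s"
    and avoids: "\<And>s. z s = 0 \<Longrightarrow> X s \<notin> curve_image m K"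
begin

abbreviation "J \<equiv> flux X z X' z'"

lemma X_cont: "continuous_on S X"
  using X_deriv by (intro continuous_at_imp_continuous_on) (auto intro: has_vector_derivative_continuous)

lemma z_cont: "continuous_on S z"
  using z_deriv by (intro continuous_at_imp_continuous_on) (auto intro: DERIV_isCont)

lemma avoids_dist3:
  assumes "i < m"
  shows "dist3 (X s) (z s) (K i t) \<noteq> 0"
proof -
  have "K i t \<in> curve_image m K" using assms by (auto simp: curve_image_def)
  then have "z s \<noteq> 0 \<or> X s \<noteq> K i t" using avoids[of s] by metis
  from dist3_pos[OF this] show ?thesis by simp
qed

lemma gauss_continuous:
  assumes i: "i < m"
  shows "continuous_on S (\<lambda>p. gauss (X (fst p)) (z (fst p)) (X' (fst p)) (z' (fst p)) (K i (snd p)) (K' i (snd p)))"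
  unfolding gauss_def
  by (intro continuous_intros continuous_on_compose2[OF X_cont[of UNIV]] continuous_on_compose2[OF z_cont[of UNIV]]
       continuous_on_compose2[OF X'_cont] continuous_on_compose2[OF z'_cont]
       continuous_on_compose2[OF K_cont[OF i, of UNIV]] continuous_on_compose2[OF K'_cont[OF i, of UNIV]])
     (auto simp: avoids_dist3[OF i])

lemma J_piece_cont:
  assumes i: "i < m"
  shows "continuous_on S (\<lambda>s. integral {0..1} (\<lambda>t. gauss (X s) (z s) (X' s) (z' s) (K i t) (K' i t)))"
proof -
  have "continuous_on (S \<times> cbox 0 1) (\<lambda>(s, t). gauss (X s) (z s) (X' s) (z' s) (K i t) (K' i t))"
    using gauss_continuous[OF i] by (simp add: case_prod_beta')
  from integral_continuous_on_param[OF this] show ?thesis by simp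
qed

lemma J_cont: "continuous_on S J"
  unfolding flux_def by (intro continuous_intros J_piece_cont) auto

lemma J_per: "J (s + 1) = J s"
  unfolding flux_def by (simp add: X_per X'_per z_per z'_per)

lemma J_integrable: "J integrable_on {a..b}"
  by (rule integrable_continuous_real[OF J_cont])

lemma sum_linking_number:
  assumes \<gamma>: "\<And>s. \<gamma> s = vec3 (X s) (z s)"
  shows "(\<Sum>i<m. linking_number \<gamma> (\<lambda>t. embed_plane (K i t))) = 1 / (4 * pi) * integral {0..1} J"
proof -
  have d3: "((\<lambda>s. vec3 (f s) (h s)) has_vector_derivative vec3 f' h') (at s)"
    if f: "(f has_vector_derivative f') (at s)" and h: "(h has_real_derivative h') (at s)" for f h f' h' s
  proof -
    have "vec3 (f s) (h s) = (f s $ 1) *\<^sub>R axis 1 1 + (f s $ 2) *\<^sub>R axis 2 1 + h s *\<^sub>R axis 3 1"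
      "vec3 f' h' = (f' $ 1) *\<^sub>R axis 1 1 + (f' $ 2) *\<^sub>R axis 2 1 + h' *\<^sub>R axis 3 1" for s
      by (simp_all add: vec_eq_iff forall_3 axis_def)
    moreover have "((\<lambda>s. f s $ j) has_real_derivative f' $ j) (at s)" for j
      using bounded_linear.has_vector_derivative[OF bounded_linear_vec_nth f]
      by (simp add: has_real_derivative_iff_has_vector_derivative)
    ultimately show ?thesis
      using h by (auto intro!: derivative_eq_intros)
  qed
  have \<gamma>_eq: "\<gamma> = (\<lambda>s. vec3 (X s) (z s))" using \<gamma> by blast
  have vd\<gamma>: "vector_derivative \<gamma> (at s) = vec3 (X' s) (z' s)" for s
    unfolding \<gamma>_eq by (rule vector_derivative_at, rule d3[OF X_deriv z_deriv])
  have "linking_number \<gamma> (\<lambda>t. embed_plane (K i t))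
    = 1 / (4 * pi) * integral {0..1} (\<lambda>s. integral {0..1} (\<lambda>t. gauss (X s) (z s) (X' s) (z' s) (K i t) (K' i t)))"
    if i: "i < m" for i
  proof -
    have vdK: "vector_derivative (\<lambda>t. embed_plane (K i t)) (at t) = vec3 (K' i t) 0" for t
      unfolding embed_plane_vec3 using d3[OF K_deriv[OF i], of "\<lambda>_. 0" 0 t] by (intro vector_derivative_at) simp
    have "integral ({0..1} \<times> {0..1}) (\<lambda>(s, t). (\<gamma> s - embed_plane (K i t)) \<bullet>
        cross3 (vector_derivative \<gamma> (at s)) (vector_derivative (\<lambda>t. embed_plane (K i t)) (at t)) / norm (\<gamma> s - embed_plane (K i t)) ^ 3)
      = integral (cbox (0, 0) (1, 1)) (\<lambda>p. gauss (X (fst p)) (z (fst p)) (X' (fst p)) (z' (fst p)) (K i (snd p)) (K' i (snd p)))"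
      unfolding vd\<gamma> vdK unfolding embed_plane_vec3 \<gamma> gauss_eq by (simp add: cbox_Pair_eq case_prod_beta')
    also have "\<dots> = integral (cbox 0 1) (\<lambda>s. integral (cbox 0 1) (\<lambda>t. gauss (X s) (z s) (X' s) (z' s) (K i t) (K' i t)))"
      by (subst integral_prod_continuous[OF gauss_continuous[OF i]]) simp
    finally show ?thesis unfolding linking_number_def by simp
  qed
  then have "(\<Sum>i<m. linking_number \<gamma> (\<lambda>t. embed_plane (K i t)))
    = (\<Sum>i<m. 1 / (4 * pi) * integral {0..1} (\<lambda>s. integral {0..1} (\<lambda>t. gauss (X s) (z s) (X' s) (z' s) (K i t) (K' i t))))"
    by simp
  also have "\<dots> = 1 / (4 * pi) * integral {0..1} J"
    unfolding flux_def sum_distrib_left[symmetric]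
    by (subst integral_sum) (auto intro!: integrable_continuous_real J_piece_cont)
  finally show ?thesis .
qed

lemma integral_J_off_plane:
  assumes "a \<le> b" "\<And>s. s \<in> {a..b} \<Longrightarrow> z s \<noteq> 0"
  shows "integral {a..b} J = solid_angle (X a) (z a) - solid_angle (X b) (z b)"
  unfolding flux_def using assms X_deriv z_deriv X'_cont z'_cont by (intro integral_solid_angle)

text \<open>At its ends the arc lies in the plane, where the formula for arcs off the plane breaks
  down. The ends are approached from inside: there the solid angle tends to
  \<open>2 * pi * \<sigma>\<close> times the indicator, while the integral of \<open>J\<close>
  depends continuously on its limits.\<close>

lemma integral_J_arc:
  assumes ab: "a < b" and \<sigma>: "\<sigma> = 1 \<or> \<sigma> = -1" and pos: "\<And>s. a < s \<Longrightarrow> s < b \<Longrightarrow> \<sigma> * z s > 0"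
    and za: "z a = 0" and zb: "z b = 0"
  shows "integral {a..b} J = 2 * pi * \<sigma> * (indicator \<Omega> (X a) - indicator \<Omega> (X b))"
proof -
  \<comment> \<open>The shift \<open>n + 3\<close> gives \<open>2 * h n < b - a\<close> for every
    \<open>n\<close>, so that \<open>an n < bn n\<close> from the start.\<close>
  define h where "h n = (b - a) / real (n + 3)" for n
  have h: "0 < h n" "2 * h n < b - a" for n
  proof -
    show "0 < h n" using ab by (simp add: h_def)
    have "(b - a) * 2 < (b - a) * real (n + 3)" using ab by (intro mult_strict_left_mono) auto
    then show "2 * h n < b - a" by (simp add: h_def divide_less_eq mult.commute)
  qed
  have h0: "h \<longlonglongrightarrow> 0"
  proof -
    have "(\<lambda>n. (b - a) / real (n + 3)) \<longlonglongrightarrow> 0" by real_asymp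
    then show ?thesis unfolding h_def .
  qed
  define an bn where "an n = a + h n" and "bn n = b - h n" for n
  have an: "an \<longlonglongrightarrow> a" and bn: "bn \<longlonglongrightarrow> b"
    unfolding an_def bn_def using tendsto_add[OF tendsto_const h0] tendsto_diff[OF tendsto_const h0] by auto
  have abn: "a < an n" "an n < bn n" "bn n < b" for n using h[of n] by (auto simp: an_def bn_def)
  have Xz: "isCont X s" "isCont z s" for s
    using X_deriv z_deriv has_vector_derivative_continuous DERIV_isCont by blast+
  have lim: "(\<lambda>n. solid_angle (X (cn n)) (z (cn n))) \<longlonglongrightarrow> 2 * pi * \<sigma> * indicator \<Omega> (X c)"
    if c: "cn \<longlonglongrightarrow> c" and zc: "z c = 0" and in_ab: "\<And>n::nat. a < cn n \<and> cn n < b" for cn c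
  proof -
    have "(\<lambda>n. \<sigma> * z (cn n)) \<longlonglongrightarrow> \<sigma> * z c"
      by (intro tendsto_intros isCont_tendsto_compose[OF Xz(2) c])
    then have z0: "(\<lambda>n. \<sigma> * z (cn n)) \<longlonglongrightarrow> 0" using zc by simp
    have "(\<lambda>n. solid_angle (X (cn n)) (\<sigma> * z (cn n))) \<longlonglongrightarrow> 2 * pi * indicator \<Omega> (X c)"
      using in_ab by (intro solid_angle_tendsto isCont_tendsto_compose[OF Xz(1) c] z0 avoids zc pos) auto
    then have "(\<lambda>n. \<sigma> * solid_angle (X (cn n)) (\<sigma> * z (cn n))) \<longlonglongrightarrow> \<sigma> * (2 * pi * indicator \<Omega> (X c))"
      by (intro tendsto_intros)
    moreover have "\<sigma> * solid_angle x (\<sigma> * y) = solid_angle x y" for x y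
      using \<sigma> solid_angle_neg[of x y] by auto
    ultimately show ?thesis by (simp add: ac_simps)
  qed
  have "(\<lambda>n. solid_angle (X (an n)) (z (an n)) - solid_angle (X (bn n)) (z (bn n)))
    \<longlonglongrightarrow> 2 * pi * \<sigma> * indicator \<Omega> (X a) - 2 * pi * \<sigma> * indicator \<Omega> (X b)"
    using abn less_trans by (intro tendsto_diff lim an bn za zb) blast+
  moreover have "solid_angle (X (an n)) (z (an n)) - solid_angle (X (bn n)) (z (bn n)) = integral {a..bn n} J - integral {a..an n} J" for n
  proof -
    have "integral {an n..bn n} J = solid_angle (X (an n)) (z (an n)) - solid_angle (X (bn n)) (z (bn n))"
    proof (rule integral_J_off_plane)
      fix s assume "s \<in> {an n..bn n}"
      then show "z s \<noteq> 0" using pos[of s] abn[of n] by auto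
    qed (use abn[of n] in auto)
    moreover have "integral {a..an n} J + integral {an n..bn n} J = integral {a..bn n} J"
      using abn[of n] by (intro Henstock_Kurzweil_Integration.integral_combine J_integrable) auto
    ultimately show ?thesis by simp
  qed
  moreover have "(\<lambda>n. integral {a..bn n} J - integral {a..an n} J) \<longlonglongrightarrow> integral {a..b} J - integral {a..a} J"
  proof -
    have c: "continuous_on {a..b} (\<lambda>t. integral {a..t} J)"
      by (rule indefinite_integral_continuous_1[OF J_integrable])
    have ends: "a \<in> {a..b}" "b \<in> {a..b}" using ab by auto
    have "an n \<in> {a..b}" "bn n \<in> {a..b}" for n using abn[of n] by auto
    then have "\<forall>\<^sub>F n in sequentially. an n \<in> {a..b}" "\<forall>\<^sub>F n in sequentially. bn n \<in> {a..b}" by simp_all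
    then show ?thesis
      by (intro tendsto_diff continuous_on_tendsto_compose[OF c bn ends(2)] continuous_on_tendsto_compose[OF c an ends(1)])
  qed
  ultimately have "integral {a..b} J - integral {a..a} J = 2 * pi * \<sigma> * indicator \<Omega> (X a) - 2 * pi * \<sigma> * indicator \<Omega> (X b)"
    by (simp add: LIMSEQ_unique)
  then show ?thesis by (simp add: algebra_simps)
qed

lemma integral_J_shift:
  assumes "0 \<le> a" "a \<le> 1"
  shows "integral {0..1} J = integral {a..a + 1} J"
proof -
  have "integral {1..a + 1} J = integral {0..a} (\<lambda>s. J (s + 1))"
    using integral_shift_real_ivl[of 1 1 "a + 1" J] by simp
  then have "integral {1..a + 1} J = integral {0..a} J" by (simp add: J_per)
  moreover have "integral {0..a} J + integral {a..1} J = integral {0..1} J"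
    "integral {a..1} J + integral {1..a + 1} J = integral {a..a + 1} J"
    using assms by (intro Henstock_Kurzweil_Integration.integral_combine J_integrable; simp)+
  ultimately show ?thesis by simp
qed

text \<open>Both arcs contribute equally: on the second one the sign of the solid angle is reversed,
  and so is the order of the end points. Starting the period at a crossing makes each arc a single
  interval.\<close>

lemma integral_J_two_crossings:
  assumes a: "0 \<le> a" "a < b" "b < a + 1" "a \<le> 1" and z0: "z a = 0" "z b = 0"
    and up: "\<And>s. a < s \<Longrightarrow> s < b \<Longrightarrow> z s > 0" and down: "\<And>s. b < s \<Longrightarrow> s < a + 1 \<Longrightarrow> z s < 0"
  shows "integral {0..1} J = 4 * pi * (indicator \<Omega> (X a) - indicator \<Omega> (X b))"
proof -
  have "integral {a..b} J = 2 * pi * 1 * (indicator \<Omega> (X a) - indicator \<Omega> (X b))"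
    using a up z0 by (intro integral_J_arc) auto
  moreover have "integral {b..a + 1} J = 2 * pi * (-1) * (indicator \<Omega> (X b) - indicator \<Omega> (X (a + 1)))"
    using a down z0 z_per[of a] by (intro integral_J_arc) auto
  moreover have "integral {a..b} J + integral {b..a + 1} J = integral {a..a + 1} J"
    using a by (intro Henstock_Kurzweil_Integration.integral_combine J_integrable) auto
  ultimately show ?thesis
    using integral_J_shift[OF a(1,4)] unfolding X_per by (simp add: algebra_simps)
qed

lemma integral_J_no_crossing:
  assumes "\<And>s. z s \<noteq> 0"
  shows "integral {0..1} J = 0"
  using integral_J_off_plane[of 0 1] assms X_per[of 0] z_per[of 0] by simp

end

text \<open>Write \<open>sin x - sin (arcsin t)\<close> as a product of a sine and a cosine of half
  angles; both factors are positive in the given range.\<close>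

lemma sin_gt_arcsin:
  assumes "- 1 < t" "t < 1" "arcsin t < x" "x < pi - arcsin t"
  shows "sin x > t"
proof -
  have b: "- (pi/2) < arcsin t" "arcsin t < pi/2" using arcsin_lt_bounded[OF assms(1,2)] by auto
  have "sin x - sin (arcsin t) = 2 * sin ((x - arcsin t) / 2) * cos ((x + arcsin t) / 2)" by (rule sin_diff_sin)
  moreover have "sin ((x - arcsin t) / 2) > 0"
  proof (rule sin_gt_zero)
    show "0 < (x - arcsin t) / 2" using assms(3) by simp
    have "x - arcsin t < 2 * pi" using assms(4) b by linarith
    then show "(x - arcsin t) / 2 < pi" by simp
  qed
  moreover have "cos ((x + arcsin t) / 2) > 0"
  proof (rule cos_gt_zero_pi)
    have "- pi < x + arcsin t" "x + arcsin t < pi" using assms(3,4) b by linarith+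
    then show "- (pi / 2) < (x + arcsin t) / 2" "(x + arcsin t) / 2 < pi / 2" by simp_all
  qed
  ultimately have "sin x - sin (arcsin t) > 0" by simp
  then show ?thesis using assms by simp
qed

lemma sin_lt_arcsin:
  assumes "- 1 < t" "t < 1" "pi - arcsin t < x" "x < arcsin t + 2 * pi"
  shows "sin x < t"
proof -
  have "sin (x - pi) > - t"
    using assms by (intro sin_gt_arcsin) (auto simp: arcsin_minus)
  then show ?thesis by (simp add: sin_diff)
qed

text \<open>The horizontal part of the second frame vector at
  \<open>sphere_chart (\<phi>, \<theta>)\<close>, whose vertical part is
  \<open>- sin \<phi>\<close>. The first frame vector is horizontal, namely
  \<open>dirv \<theta>\<close>.\<close>

definition circle_frame :: "real \<Rightarrow> real \<Rightarrow> real^2" where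
  "circle_frame \<phi> \<theta> = vec2 (cos \<phi> * cos \<theta>) (cos \<phi> * sin \<theta>)"

abbreviation circ :: "real \<Rightarrow> real^2 \<Rightarrow> real \<Rightarrow> real \<Rightarrow> real \<Rightarrow> real^2" where
  "circ r c \<phi> \<theta> \<equiv> \<lambda>s. c + (r * cos (2 * pi * s)) *\<^sub>R dirv \<theta> + (r * sin (2 * pi * s)) *\<^sub>R circle_frame \<phi> \<theta>"

abbreviation circ' :: "real \<Rightarrow> real \<Rightarrow> real \<Rightarrow> real \<Rightarrow> real^2" where
  "circ' r \<phi> \<theta> \<equiv> \<lambda>s. (- (r * sin (2 * pi * s) * (2 * pi))) *\<^sub>R dirv \<theta> + (r * cos (2 * pi * s) * (2 * pi)) *\<^sub>R circle_frame \<phi> \<theta>"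

text \<open>Away from the poles the default case of \<open>frame1\<close> does not occur and its
  value is horizontal, so the height along the circle varies with the sine alone.\<close>

lemma circle_param_eq:
  assumes "0 < \<phi>" "\<phi> < pi"
  shows "circle_param (r, vec3 c c3, sphere_chart (\<phi>, \<theta>)) s =
    vec3 (circ r c \<phi> \<theta> s)
         (c3 - r * sin \<phi> * sin (2 * pi * s))"
proof -
  let ?n = "sphere_chart (\<phi>, \<theta>)"
  have sp: "sin \<phi> > 0" using assms by (rule sin_gt_zero)
  have n: "?n $ 1 = sin \<phi> * cos \<theta>" "?n $ 2 = sin \<phi> * sin \<theta>" "?n $ 3 = cos \<phi>"
    by (simp_all add: sphere_chart_def)
  have c: "cross3 ?n (axis 3 1) = sin \<phi> *\<^sub>R vec3 (dirv \<theta>) 0"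
    by (simp add: cross3_def vec_eq_iff forall_3 axis_def n dirv_def)
  have nv: "norm (vec3 (dirv \<theta>) 0) = 1" by (simp add: norm_vec3)
  then have "vec3 (dirv \<theta>) 0 \<noteq> 0" by force
  then have f1: "frame1 ?n = vec3 (dirv \<theta>) 0"
    using sp nv by (simp add: frame1_def c sgn_div_norm)
  have "sin \<phi> * cos \<theta> * cos \<theta> + sin \<phi> * sin \<theta> * sin \<theta> = sin \<phi> * ((cos \<theta>)\<^sup>2 + (sin \<theta>)\<^sup>2)"
    by algebra
  then have key: "sin \<phi> * cos \<theta> * cos \<theta> + sin \<phi> * sin \<theta> * sin \<theta> = sin \<phi>" by simp
  have f2: "frame2 ?n = vec3 (circle_frame \<phi> \<theta>) (- sin \<phi>)"
    unfolding frame2_def f1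
    by (simp add: cross3_def vec_eq_iff forall_3 n dirv_def circle_frame_def) (use key in linarith)
  show ?thesis
    by (simp add: f1 f2 vec_eq_iff forall_3)
qed

context planar_domain
begin

lemma circle_linking_eq:
  assumes r: "0 < r" and \<phi>: "0 < \<phi>" "\<phi> < pi" and avoid: "\<And>s. c3 = r * sin \<phi> * sin (2 * pi * s) \<Longrightarrow>
      circ r c \<phi> \<theta> s \<notin> curve_image m K"
  defines "X \<equiv> circ r c \<phi> \<theta>"
    and "X' \<equiv> circ' r \<phi> \<theta>"
    and "z \<equiv> \<lambda>s. c3 - r * sin \<phi> * sin (2 * pi * s)"
    and "z' \<equiv> \<lambda>s. - (r * sin \<phi> * cos (2 * pi * s) * (2 * pi))"
  shows "closed_space_curve m K K' K'' \<Omega> X X' z z'"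
    and "circle_linking (r, vec3 c c3, sphere_chart (\<phi>, \<theta>)) m (\<lambda>i t. embed_plane (K i t))
      = 1 / (4 * pi) * integral {0..1} (flux X z X' z')"
proof -
  have per: "sin (2 * pi * (s + 1)) = sin (2 * pi * s)" "cos (2 * pi * (s + 1)) = cos (2 * pi * s)" for s
    using sin_periodic[of "2 * pi * s"] cos_periodic[of "2 * pi * s"] by (simp_all add: distrib_left)
  show A: "closed_space_curve m K K' K'' \<Omega> X X' z z'"
  proof (unfold_locales)
    show "(X has_vector_derivative X' s) (at s)" for s
      unfolding X_def X'_def by (auto intro!: derivative_eq_intros simp: mult_ac)
    show "(z has_real_derivative z' s) (at s)" for s
      unfolding z_def z'_def by (auto intro!: derivative_eq_intros)
    show "continuous_on UNIV X'" unfolding X'_def by (intro continuous_intros)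
    show "continuous_on UNIV z'" unfolding z'_def by (intro continuous_intros)
    show "X s \<notin> curve_image m K" if "z s = 0" for s
      using avoid[of s] that by (simp add: X_def z_def)
  qed (simp_all add: X_def X'_def z_def z'_def per)
  interpret closed_space_curve m K K' K'' \<Omega> X X' z z' by (rule A)
  have g: "circle_param (r, vec3 c c3, sphere_chart (\<phi>, \<theta>)) s = vec3 (X s) (z s)" for s
    unfolding X_def z_def by (rule circle_param_eq[OF \<phi>])
  have "range (circle_param (r, vec3 c c3, sphere_chart (\<phi>, \<theta>))) \<inter> curve_image m (\<lambda>i t. embed_plane (K i t)) = {}"
  proof -
    have "vec3 (X s) (z s) \<noteq> vec3 (K i t) 0" if "i < m" for i s t
    proof
      assume e: "vec3 (X s) (z s) = vec3 (K i t) 0"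
      then have "z s = 0" "X s = K i t" by (auto simp: vec_eq_iff forall_2 forall_3)
      with avoids[of s] that show False by (auto simp: curve_image_def)
    qed
    then show ?thesis by (auto simp: curve_image_def g embed_plane_vec3 simp del: circle_param.simps)
  qed
  then show "circle_linking (r, vec3 c c3, sphere_chart (\<phi>, \<theta>)) m (\<lambda>i t. embed_plane (K i t)) = 1 / (4 * pi) * integral {0..1} J"
    unfolding circle_linking_def using sum_linking_number[OF g] by (simp del: circle_param.simps)
qed

lemma circle_linking_disjoint_plane:
  assumes r: "0 < r" and \<phi>: "0 < \<phi>" "\<phi> < pi" and far: "r * sin \<phi> < \<bar>c3\<bar>"
  shows "circle_linking (r, vec3 c c3, sphere_chart (\<phi>, \<theta>)) m (\<lambda>i t. embed_plane (K i t)) = 0"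
proof -
  have sp: "r * sin \<phi> > 0" using r sin_gt_zero[OF \<phi>] by simp
  have nz: "c3 \<noteq> r * sin \<phi> * sin (2 * pi * s)" for s
  proof
    assume "c3 = r * sin \<phi> * sin (2 * pi * s)"
    then have "\<bar>c3\<bar> = \<bar>r * sin \<phi>\<bar> * \<bar>sin (2 * pi * s)\<bar>" by (simp only: abs_mult)
    also have "\<dots> = r * sin \<phi> * \<bar>sin (2 * pi * s)\<bar>" by (simp only: abs_of_pos[OF sp])
    also have "\<dots> \<le> r * sin \<phi> * 1" using sp by (intro mult_left_mono) auto
    finally show False using far by simp
  qed
  note * = circle_linking_eq[OF r \<phi>, of c3 c \<theta>]
  show ?thesis
    using closed_space_curve.integral_J_no_crossing[OF *(1)] *(2) nz by simp
qed

text \<open>With center at height \<open>r * sin \<phi> * t\<close> the circle meets the plane where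
  the sine equals \<open>t\<close>, at \<open>p\<close> and \<open>q\<close>; it is above the plane
  while the sine is smaller and below while it is larger. The factor \<open>4 * pi\<close> of the
  two arcs cancels that of Gauss.\<close>

lemma circle_linking_crossing:
  fixes r \<phi> \<theta> t :: real and c :: "real^2"
  assumes r: "0 < r" and \<phi>: "0 < \<phi>" "\<phi> < pi" and t: "\<bar>t\<bar> < 1"
  defines "a \<equiv> r * sqrt (1 - t\<^sup>2)"
  defines "p \<equiv> c + (r * t) *\<^sub>R circle_frame \<phi> \<theta> - a *\<^sub>R dirv \<theta>"
    and "q \<equiv> c + (r * t) *\<^sub>R circle_frame \<phi> \<theta> + a *\<^sub>R dirv \<theta>"
  assumes p: "p \<notin> curve_image m K" and q: "q \<notin> curve_image m K"
  shows "circle_linking (r, vec3 c (r * sin \<phi> * t), sphere_chart (\<phi>, \<theta>)) m (\<lambda>i t. embed_plane (K i t))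
    = indicator \<Omega> p - indicator \<Omega> q"
proof -
  let ?c3 = "r * sin \<phi> * t"
  have sp: "r * sin \<phi> > 0" using r sin_gt_zero[OF \<phi>] by simp
  have t': "-1 < t" "t < 1" using t by auto
  have zero: "?c3 = r * sin \<phi> * sin u \<longleftrightarrow> sin u = t" for u using sp by auto
  have av: "circ r c \<phi> \<theta> s \<notin> curve_image m K"
    if "?c3 = r * sin \<phi> * sin (2 * pi * s)" for s
  proof -
    have st: "sin (2 * pi * s) = t" using that zero by simp
    have "(cos (2 * pi * s))\<^sup>2 = 1 - t\<^sup>2" using cos_squared_eq[of "2 * pi * s"] st by simp
    then have "\<bar>cos (2 * pi * s)\<bar> = sqrt (1 - t\<^sup>2)" by (metis real_sqrt_abs)
    then have "cos (2 * pi * s) = sqrt (1 - t\<^sup>2) \<or> cos (2 * pi * s) = - sqrt (1 - t\<^sup>2)" by linarith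
    then have "circ r c \<phi> \<theta> s \<in> {p, q}"
      unfolding st p_def q_def a_def by auto
    then show ?thesis using p q by auto
  qed
  note * = circle_linking_eq[OF r \<phi>, of ?c3 c \<theta>, OF av]
  define \<alpha> where "\<alpha> = arcsin t"
  have \<alpha>: "- (pi/2) < \<alpha>" "\<alpha> < pi/2" "sin \<alpha> = t" "cos \<alpha> = sqrt (1 - t\<^sup>2)"
    using arcsin_lt_bounded[OF t'] t' by (auto simp: \<alpha>_def cos_arcsin)
  \<comment> \<open>The solutions of \<open>sin u = t\<close>, the second one advanced by
    \<open>2 * pi\<close> so that it follows the first within one period. The signs of the cosine
    identify \<open>s1\<close> with \<open>p\<close> and \<open>s2\<close> with
    \<open>q\<close>.\<close>
  define s1 s2 where "s1 = (pi - \<alpha>) / (2 * pi)" and "s2 = (\<alpha> + 2 * pi) / (2 * pi)"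
  have s: "2 * pi * s1 = pi - \<alpha>" "2 * pi * s2 = \<alpha> + 2 * pi" by (simp_all add: s1_def s2_def)
  have ord: "0 \<le> s1" "s1 < s2" "s2 < s1 + 1" "s1 \<le> 1"
  proof -
    have cmp: "u < v" if "2 * pi * u < 2 * pi * v" for u v :: real using that by simp
    have "2 * pi * 0 < 2 * pi * s1" "2 * pi * s1 < 2 * pi * s2" "2 * pi * s2 < 2 * pi * (s1 + 1)" "2 * pi * s1 < 2 * pi * 1"
      unfolding distrib_left s using \<alpha>(1,2) pi_gt_zero by simp_all
    from this[THEN cmp] show "0 \<le> s1" "s1 < s2" "s2 < s1 + 1" "s1 \<le> 1" by simp_all
  qed
  have sc: "sin (2 * pi * s1) = t" "cos (2 * pi * s1) = - sqrt (1 - t\<^sup>2)"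
    "sin (2 * pi * s2) = t" "cos (2 * pi * s2) = sqrt (1 - t\<^sup>2)"
    unfolding s by (simp_all add: \<alpha>)
  have scale: "2 * pi * u < 2 * pi * v" if "u < v" for u v :: real using that by simp
  have up: "?c3 - r * sin \<phi> * sin (2 * pi * u) > 0" if "s1 < u" "u < s2" for u
  proof -
    have "sin (2 * pi * u) < t"
      using scale[OF that(1)] scale[OF that(2)] unfolding s \<alpha>_def by (intro sin_lt_arcsin t')
    from mult_strict_left_mono[OF this sp] show ?thesis by simp
  qed
  have down: "?c3 - r * sin \<phi> * sin (2 * pi * u) < 0" if "s2 < u" "u < s1 + 1" for u
  proof -
    have "sin (2 * pi * u - 2 * pi) > t"
      using scale[OF that(1)] scale[OF that(2)] unfolding distrib_left s \<alpha>_def by (intro sin_gt_arcsin t') simp_all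
    then have "t < sin (2 * pi * u)" by (simp add: sin_diff)
    from mult_strict_left_mono[OF this sp] show ?thesis by simp
  qed
  have "integral {0..1} (flux (circ r c \<phi> \<theta>)
      (\<lambda>s. ?c3 - r * sin \<phi> * sin (2 * pi * s))
      (circ' r \<phi> \<theta>)
      (\<lambda>s. - (r * sin \<phi> * cos (2 * pi * s) * (2 * pi))))
    = 4 * pi * (indicator \<Omega> (circ r c \<phi> \<theta> s1)
       - indicator \<Omega> (circ r c \<phi> \<theta> s2))"
    using ord up down sc by (intro closed_space_curve.integral_J_two_crossings[OF *(1)]) auto
  also have "\<dots> = 4 * pi * (indicator \<Omega> p - indicator \<Omega> q)"
    unfolding sc p_def q_def a_def by (simp add: algebra_simps)
  finally have I: "1 / (4 * pi) * integral {0..1} (flux (circ r c \<phi> \<theta>)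
      (\<lambda>s. ?c3 - r * sin \<phi> * sin (2 * pi * s))
      (circ' r \<phi> \<theta>)
      (\<lambda>s. - (r * sin \<phi> * cos (2 * pi * s) * (2 * pi)))) = indicator \<Omega> p - indicator \<Omega> q"
    by simp
  show ?thesis by (rule trans[OF *(2) I])
qed

end

section \<open>Measurability\<close>

lemma ennreal_mult3:
  "0 \<le> a \<Longrightarrow> 0 \<le> b \<Longrightarrow> ennreal a * (ennreal b * (ennreal c * e)) = ennreal (a * (b * c)) * e"
  by (simp add: ennreal_mult' mult.assoc)

lemma measurable_cross3 [measurable (raw)]:
  assumes [measurable]: "f \<in> borel_measurable M" "g \<in> borel_measurable M"
  shows "(\<lambda>x. cross3 (f x) (g x)) \<in> borel_measurable M"
proof -
  have "(\<lambda>p. cross3 (fst p) (snd p)) \<in> borel_measurable borel"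
    by (intro borel_measurable_continuous_onI continuous_on_cross continuous_intros)
  then have "(\<lambda>x. (\<lambda>p. cross3 (fst p) (snd p)) (f x, g x)) \<in> borel_measurable M"
    by (rule measurable_compose[rotated]) measurable
  then show ?thesis by simp
qed

lemma measurable_frame1 [measurable]: "frame1 \<in> borel_measurable borel"
  unfolding frame1_def sgn_div_norm by measurable

lemma measurable_frame2 [measurable]: "frame2 \<in> borel_measurable borel"
  unfolding frame2_def by measurable

lemma measurable_sphere_chart [measurable]: "sphere_chart \<in> borel_measurable borel"
proof -
  have eq: "sphere_chart p = vec3 (vec2 (sin (fst p) * cos (snd p)) (sin (fst p) * sin (snd p))) (cos (fst p))" for p
    by (simp add: sphere_chart_def vec_eq_iff forall_3 case_prod_beta')
  have "continuous_on UNIV sphere_chart"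
    unfolding eq[abs_def] by (intro continuous_intros)
  then show ?thesis by (rule borel_measurable_continuous_onI)
qed

lemma norm_sphere_chart: "norm (sphere_chart (\<phi>, \<theta>)) = 1"
proof -
  have "(norm (sphere_chart (\<phi>, \<theta>)))\<^sup>2 = (sin \<phi>)\<^sup>2 * ((cos \<theta>)\<^sup>2 + (sin \<theta>)\<^sup>2) + (cos \<phi>)\<^sup>2"
    unfolding power2_norm_eq_inner inner_vec_def
    by (simp add: sum_3 sphere_chart_def power2_eq_square algebra_simps del: sin_cos_squared_add sin_cos_squared_add2 sin_cos_squared_add3)
  also have "\<dots> = 1" by simp
  finally show ?thesis by (simp add: power2_eq_1_iff) (use norm_ge_zero[of "sphere_chart (\<phi>, \<theta>)"] in linarith)
qed

lemma sets_sphere_measure [simp, measurable_cong]: "sets sphere_measure = sets borel"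
  by (simp add: sphere_measure_def)

lemma nn_integral_sphere_measure:
  assumes [measurable]: "h \<in> borel_measurable borel"
  shows "(\<integral>\<^sup>+n. h n \<partial>sphere_measure) =
    (\<integral>\<^sup>+\<phi>. \<integral>\<^sup>+\<theta>. indicator {0..pi} \<phi> * indicator {0..2*pi} \<theta> * ennreal (sin \<phi>) * h (sphere_chart (\<phi>, \<theta>)) \<partial>lborel \<partial>lborel)"
proof -
  let ?d = "\<lambda>p. ennreal (indicator ({0..pi} \<times> {0..2*pi}) p * sin (fst p))"
  have [measurable]: "{0..pi} \<times> {0..2*pi} \<in> sets (borel \<Otimes>\<^sub>M borel)"
    by (intro pair_measureI) auto
  have "?d \<in> borel_measurable (borel \<Otimes>\<^sub>M borel)" by measurable
  then have [measurable]: "?d \<in> borel_measurable borel" by (simp add: borel_prod)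
  have "(\<integral>\<^sup>+n. h n \<partial>sphere_measure) = (\<integral>\<^sup>+p. ?d p * h (sphere_chart p) \<partial>(lborel \<Otimes>\<^sub>M lborel))"
    unfolding sphere_measure_def case_prod_beta' lborel_prod
    by (subst nn_integral_distr, simp, simp, subst nn_integral_density) simp_all
  also have "\<dots> = (\<integral>\<^sup>+\<phi>. \<integral>\<^sup>+\<theta>. ?d (\<phi>, \<theta>) * h (sphere_chart (\<phi>, \<theta>)) \<partial>lborel \<partial>lborel)"
    by (rule lborel.nn_integral_fst[symmetric]) (simp add: lborel_prod)
  also have "\<dots> = (\<integral>\<^sup>+\<phi>. \<integral>\<^sup>+\<theta>. indicator {0..pi} \<phi> * indicator {0..2*pi} \<theta> * ennreal (sin \<phi>) * h (sphere_chart (\<phi>, \<theta>)) \<partial>lborel \<partial>lborel)"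
    by (rule nn_integral_cong, rule nn_integral_cong) (auto simp: indicator_def)
  finally show ?thesis .
qed

text \<open>Gives the sigma-finiteness under which the integrals over radius, center and normal can
  be reordered.\<close>

lemma finite_sphere_measure: "finite_measure sphere_measure"
proof
  have "emeasure sphere_measure (space sphere_measure) = (\<integral>\<^sup>+n. 1 \<partial>sphere_measure)" by simp
  also have "\<dots> = (\<integral>\<^sup>+\<phi>. \<integral>\<^sup>+\<theta>. indicator {0..pi} \<phi> * indicator {0..2*pi} \<theta> * ennreal (sin \<phi>) * 1 \<partial>lborel \<partial>lborel)"
    by (rule nn_integral_sphere_measure) simp
  also have "\<dots> \<le> (\<integral>\<^sup>+\<phi>. \<integral>\<^sup>+\<theta>. indicator {0..pi} \<phi> * indicator {0..2*pi} \<theta> \<partial>lborel \<partial>lborel)"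
    by (intro nn_integral_mono) (auto simp: indicator_def)
  also have "\<dots> = ennreal (2 * pi) * ennreal pi"
    by (simp add: nn_integral_cmult nn_integral_multc mult.commute)
  finally show "emeasure sphere_measure (space sphere_measure) \<noteq> \<infinity>"
    by (auto simp: top_unique ennreal_mult_eq_top_iff)
qed

text \<open>The center is integrated innermost, because for fixed radius and normal the linking
  number is controlled by translations.\<close>

lemma nn_integral_circle_measure:
  assumes [measurable]: "G \<in> borel_measurable borel"
  shows "(\<integral>\<^sup>+\<gamma>. G \<gamma> \<partial>circle_measure) =
    (\<integral>\<^sup>+r. \<integral>\<^sup>+\<phi>. \<integral>\<^sup>+\<theta>. indicator {0..pi} \<phi> * indicator {0..2*pi} \<theta> * ennreal (sin \<phi>) *
       (ennreal (1 / r ^ 4) * (\<integral>\<^sup>+c. G (r, c, sphere_chart (\<phi>, \<theta>)) \<partial>lborel)) \<partial>lborel \<partial>lborel \<partial>lborel)"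
proof -
  interpret S: finite_measure sphere_measure by (rule finite_sphere_measure)
  interpret P: pair_sigma_finite "lborel :: (real^3) measure" sphere_measure
    by (rule pair_sigma_finite.intro) unfold_locales
  have sets_eq: "sets (lborel \<Otimes>\<^sub>M sphere_measure) = sets (borel :: ((real^3) \<times> (real^3)) measure)"
    by (rule trans[OF sets_pair_measure_cong[OF sets_lborel sets_sphere_measure]]) (simp only: borel_prod)
  have sets_eq3: "sets (lborel \<Otimes>\<^sub>M (lborel \<Otimes>\<^sub>M sphere_measure)) = sets (borel :: oriented_circle measure)"
    by (rule trans[OF sets_pair_measure_cong[OF sets_lborel sets_eq]]) (simp only: borel_prod)
  have Gm [measurable]: "G \<in> borel_measurable (lborel \<Otimes>\<^sub>M (lborel \<Otimes>\<^sub>M sphere_measure))"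
    by (subst measurable_cong_sets[OF sets_eq3 refl]) (rule assms)
  have "(\<integral>\<^sup>+\<gamma>. G \<gamma> \<partial>circle_measure) = (\<integral>\<^sup>+\<gamma>. ennreal (1 / (fst \<gamma>) ^ 4) * G \<gamma> \<partial>(lborel \<Otimes>\<^sub>M (lborel \<Otimes>\<^sub>M sphere_measure)))"
    unfolding circle_measure_def by (subst nn_integral_density) (auto simp: case_prod_beta')
  also have "\<dots> = (\<integral>\<^sup>+r. \<integral>\<^sup>+p. ennreal (1 / r ^ 4) * G (r, p) \<partial>(lborel \<Otimes>\<^sub>M sphere_measure) \<partial>lborel)"
    by (subst P.nn_integral_fst[symmetric]) auto
  also have "\<dots> = (\<integral>\<^sup>+r. \<integral>\<^sup>+n. \<integral>\<^sup>+c. ennreal (1 / r ^ 4) * G (r, c, n) \<partial>lborel \<partial>sphere_measure \<partial>lborel)"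
    by (intro nn_integral_cong, subst P.nn_integral_snd[symmetric]) auto
  also have "\<dots> = (\<integral>\<^sup>+r. \<integral>\<^sup>+n. ennreal (1 / r ^ 4) * (\<integral>\<^sup>+c. G (r, c, n) \<partial>lborel) \<partial>sphere_measure \<partial>lborel)"
    by (intro nn_integral_cong nn_integral_cmult) measurable
  also have "\<dots> = (\<integral>\<^sup>+r. \<integral>\<^sup>+\<phi>. \<integral>\<^sup>+\<theta>. indicator {0..pi} \<phi> * indicator {0..2*pi} \<theta> * ennreal (sin \<phi>) *
       (ennreal (1 / r ^ 4) * (\<integral>\<^sup>+c. G (r, c, sphere_chart (\<phi>, \<theta>)) \<partial>lborel)) \<partial>lborel \<partial>lborel \<partial>lborel)"
  proof (rule nn_integral_cong, rule nn_integral_sphere_measure)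
    fix r :: real
    have "(\<lambda>p. G (r, snd p, fst p)) \<in> borel_measurable (borel \<Otimes>\<^sub>M lborel)"
    proof -
      have "(\<lambda>p::(real^3) \<times> (real^3). (r, snd p, fst p)) \<in> (borel \<Otimes>\<^sub>M lborel) \<rightarrow>\<^sub>M borel"
        by (simp add: borel_prod[symmetric])
      from measurable_compose[OF this assms] show ?thesis .
    qed
    then have "(\<lambda>n. \<integral>\<^sup>+c. G (r, c, n) \<partial>lborel) \<in> borel_measurable borel"
      using lborel.borel_measurable_nn_integral_fst[of "\<lambda>p. G (r, snd p, fst p)" borel] by simp
    then show "(\<lambda>n. ennreal (1 / r ^ 4) * (\<integral>\<^sup>+c. G (r, c, n) \<partial>lborel)) \<in> borel_measurable borel"
      by measurable
  qed
  finally show ?thesis .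
qed

section \<open>Elementary integrals over the tilt and the height\<close>

lemma nn_integral_sin_squared: "(\<integral>\<^sup>+\<phi>. indicator {0..pi} \<phi> * ennreal ((sin \<phi>)\<^sup>2) \<partial>lborel) = ennreal (pi / 2)"
proof -
  have "((\<lambda>\<phi>. (sin \<phi>)\<^sup>2) has_integral ((pi - sin pi * cos pi) / 2 - (0 - sin 0 * cos 0) / 2)) {0..pi}"
  proof (rule fundamental_theorem_of_calculus)
    fix x :: real
    have "((\<lambda>x. (x - sin x * cos x) / 2) has_real_derivative (sin x)\<^sup>2) (at x)"
    proof -
      have "((\<lambda>x. (x - sin x * cos x) / 2) has_real_derivative (1 - (cos x * cos x + sin x * (- sin x))) / 2) (at x)"
        by (auto intro!: derivative_eq_intros)
      also have "(1 - (cos x * cos x + sin x * (- sin x))) / 2 = (sin x)\<^sup>2"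
        using sin_cos_squared_add[of x] by (simp add: power2_eq_square)
      finally show ?thesis .
    qed
    then show "((\<lambda>x. (x - sin x * cos x) / 2) has_vector_derivative (sin x)\<^sup>2) (at x within {0..pi})"
      by (simp add: has_real_derivative_iff_has_vector_derivative has_vector_derivative_at_within)
  qed simp
  then have "((\<lambda>\<phi>. indicator {0..pi} \<phi> * (sin \<phi>)\<^sup>2) has_integral (pi / 2)) UNIV"
    by (subst (asm) has_integral_restrict_UNIV[symmetric]) (auto elim!: has_integral_eq[rotated] simp: indicator_def)
  then have "(\<integral>\<^sup>+\<phi>. ennreal (indicator {0..pi} \<phi> * (sin \<phi>)\<^sup>2) \<partial>lborel) = ennreal (pi / 2)"
    by (intro nn_integral_has_integral_lborel) (auto simp: indicator_def)
  then show ?thesis by (simp add: ennreal_mult' ennreal_indicator)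
qed

lemma integral_semicircle: "((\<lambda>t. sqrt (1 - t\<^sup>2)) has_integral (pi / 2)) {-1..1}"
proof -
  let ?F = "\<lambda>t. (t * sqrt (1 - t\<^sup>2) + arcsin t) / 2"
  have "((\<lambda>t. sqrt (1 - t\<^sup>2)) has_integral (?F 1 - ?F (-1))) {-1..1}"
  \<comment> \<open>The summands of \<open>?F\<close> are differentiable only in the interior; at
    the ends continuity is enough.\<close>
  proof (rule fundamental_theorem_of_calculus_interior)
    show "continuous_on {-1..1} ?F" by (intro continuous_intros) auto
    fix t :: real assume t: "t \<in> {-1<..<1}"
    have p: "1 - t\<^sup>2 > 0" using t by (simp add: abs_square_less_1 abs_less_iff)
    have "(?F has_real_derivative (sqrt (1 - t\<^sup>2) + t * ((- (2 * t)) * (inverse (sqrt (1 - t\<^sup>2)) / 2)) + inverse (sqrt (1 - t\<^sup>2))) / 2) (at t)"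
      using t p by (auto intro!: derivative_eq_intros)
    also have "(sqrt (1 - t\<^sup>2) + t * ((- (2 * t)) * (inverse (sqrt (1 - t\<^sup>2)) / 2)) + inverse (sqrt (1 - t\<^sup>2))) / 2
      = (sqrt (1 - t\<^sup>2) + (1 - t\<^sup>2) * inverse (sqrt (1 - t\<^sup>2))) / 2"
      by (simp add: power2_eq_square algebra_simps)
    also have "(1 - t\<^sup>2) * inverse (sqrt (1 - t\<^sup>2)) = sqrt (1 - t\<^sup>2)"
      using p by (simp add: field_simps)
    finally show "(?F has_vector_derivative sqrt (1 - t\<^sup>2)) (at t)"
      by (simp add: has_real_derivative_iff_has_vector_derivative)
  qed simp
  then show ?thesis by (simp add: arcsin_minus)
qed

lemma integral_parabola: "((\<lambda>t. 1 - t\<^sup>2) has_integral (4 / 3 :: real)) {-1..1}"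
proof -
  have "((\<lambda>t. 1 - t\<^sup>2) has_integral ((1 - 1 ^ 3 / 3) - (- 1 - (- 1) ^ 3 / 3))) {-1..1::real}"
    by (rule fundamental_theorem_of_calculus)
       (auto intro!: derivative_eq_intros simp: has_real_derivative_iff_has_vector_derivative[symmetric] power2_eq_square)
  then show ?thesis by simp
qed

section \<open>Measurability of the linking number\<close>

context planar_domain
begin

abbreviation "linking \<gamma> \<equiv> circle_linking \<gamma> m (\<lambda>i t. embed_plane (K i t))"

lemma vector_derivative_embed:
  assumes "i < m"
  shows "vector_derivative (\<lambda>t. embed_plane (K i t)) (at t) = embed_plane (K' i t)"
proof (rule vector_derivative_at)
  have "linear embed_plane"
    by (rule linearI) (simp_all add: embed_plane_vec3 vec_eq_iff forall_3)
  then have "bounded_linear embed_plane" by (simp add: linear_conv_bounded_linear)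
  from bounded_linear.has_vector_derivative[OF this K_deriv[OF assms]]
  show "((\<lambda>t. embed_plane (K i t)) has_vector_derivative embed_plane (K' i t)) (at t)" .
qed

lemma continuous_on_embed_plane: "continuous_on S f \<Longrightarrow> continuous_on S (\<lambda>x. embed_plane (f x))"
  for f :: "'a::topological_space \<Rightarrow> real^2"
  unfolding embed_plane_vec3 by (intro continuous_intros)

lemma measurable_embed_plane [measurable]: "embed_plane \<in> borel_measurable borel"
  by (intro borel_measurable_continuous_onI continuous_on_embed_plane continuous_on_id)

lemma circle_param_deriv:
  "(circle_param (r, c, n) has_vector_derivative
     (- (r * sin (2 * pi * s) * (2 * pi))) *\<^sub>R frame1 n + (r * cos (2 * pi * s) * (2 * pi)) *\<^sub>R frame2 n) (at s)"
proof -
  have eq: "circle_param (r, c, n) = (\<lambda>t. c + (r * cos (2 * pi * t)) *\<^sub>R frame1 n + (r * sin (2 * pi * t)) *\<^sub>R frame2 n)"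
    by (rule ext) simp
  show ?thesis unfolding eq by (auto intro!: derivative_eq_intros simp: mult_ac)
qed

text \<open>The velocities are written out explicitly, which makes the joint measurability in the
  circle and both parameters visible.\<close>

definition gauss_kernel :: "nat \<Rightarrow> oriented_circle \<Rightarrow> real \<times> real \<Rightarrow> real" where
  "gauss_kernel i \<gamma> p = (circle_param \<gamma> (fst p) - embed_plane (K i (snd p))) \<bullet>
     cross3 ((- (fst \<gamma> * sin (2 * pi * fst p) * (2 * pi))) *\<^sub>R frame1 (snd (snd \<gamma>)) + (fst \<gamma> * cos (2 * pi * fst p) * (2 * pi)) *\<^sub>R frame2 (snd (snd \<gamma>)))
       (embed_plane (K' i (snd p))) / norm (circle_param \<gamma> (fst p) - embed_plane (K i (snd p))) ^ 3"

lemma circle_param_eq': "circle_param \<gamma> s =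
   fst (snd \<gamma>) + (fst \<gamma> * cos (2 * pi * s)) *\<^sub>R frame1 (snd (snd \<gamma>)) + (fst \<gamma> * sin (2 * pi * s)) *\<^sub>R frame2 (snd (snd \<gamma>))"
  by (cases \<gamma>) auto

lemma measurable_gauss_kernel:
  assumes i: "i < m"
  shows "(\<lambda>(\<gamma>, p). gauss_kernel i \<gamma> p) \<in> borel_measurable (borel \<Otimes>\<^sub>M lborel)"
proof -
  note [measurable] = measurable_K'[OF i]
  have [measurable]: "K i \<in> borel_measurable borel"
    using K_cont[OF i] by (rule borel_measurable_continuous_onI)
  have eq: "f \<in> borel_measurable (borel \<Otimes>\<^sub>M lborel) \<longleftrightarrow> f \<in> borel_measurable borel"
    for f :: "oriented_circle \<times> (real \<times> real) \<Rightarrow> 'b::topological_space"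
  proof -
    have "sets (borel \<Otimes>\<^sub>M lborel) = sets (borel :: (oriented_circle \<times> (real \<times> real)) measure)"
      by (rule trans[OF sets_pair_measure_cong[OF refl sets_lborel]]) (simp only: borel_prod)
    then show ?thesis by (subst measurable_cong_sets[OF _ refl]) auto
  qed
  have [measurable]: "(\<lambda>x. fst (fst x)) \<in> borel_measurable (borel :: (oriented_circle \<times> (real \<times> real)) measure)"
    "(\<lambda>x. fst (snd (fst x))) \<in> borel_measurable (borel :: (oriented_circle \<times> (real \<times> real)) measure)"
    "(\<lambda>x. snd (snd (fst x))) \<in> borel_measurable (borel :: (oriented_circle \<times> (real \<times> real)) measure)"
    "(\<lambda>x. fst (snd x)) \<in> borel_measurable (borel :: (oriented_circle \<times> (real \<times> real)) measure)"
    "(\<lambda>x. snd (snd x)) \<in> borel_measurable (borel :: (oriented_circle \<times> (real \<times> real)) measure)"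
    by (intro borel_measurable_continuous_onI continuous_intros)+
  show ?thesis
    unfolding eq gauss_kernel_def circle_param_eq' case_prod_beta' by measurable
qed

text \<open>If the frame is treated as independent data, the incidence condition is closed, and its
  projection along the compact parameter square is closed too. The frame is a Borel function of the
  normal, so substituting it preserves measurability.\<close>

lemma measurable_meets_curve: "{\<gamma>. range (circle_param \<gamma>) \<inter> curve_image m (\<lambda>i t. embed_plane (K i t)) \<noteq> {}} \<in> sets borel"
proof -
  define T where "T i = {x :: (real \<times> real) \<times> (real \<times> (real^3) \<times> (real^3) \<times> (real^3)).
     fst (snd (snd x)) + (fst (snd x) * cos (2 * pi * fst (fst x))) *\<^sub>R fst (snd (snd (snd x)))
       + (fst (snd x) * sin (2 * pi * fst (fst x))) *\<^sub>R snd (snd (snd (snd x))) = embed_plane (K i (snd (fst x)))}" for i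
  define C where "C i = {y. \<exists>x. x \<in> {0..1} \<times> {0..1} \<and> (x, y) \<in> T i}" for i
  have "closed (T i)" if "i < m" for i
    unfolding T_def
    by (intro closed_Collect_eq continuous_intros continuous_on_embed_plane continuous_on_compose2[OF K_cont[OF that, of UNIV]]) auto
  then have "closed (C i)" if "i < m" for i
    unfolding C_def using that by (intro closed_compact_projection compact_Times) auto
  then have [measurable]: "(\<Union>i<m. C i) \<in> sets borel" by (intro borel_closed closed_UN) auto
  have [measurable]: "(\<lambda>x. fst x) \<in> borel_measurable (borel :: oriented_circle measure)"
    "(\<lambda>x. fst (snd x)) \<in> borel_measurable (borel :: oriented_circle measure)"
    "(\<lambda>x. snd (snd x)) \<in> borel_measurable (borel :: oriented_circle measure)"
    by (intro borel_measurable_continuous_onI continuous_intros)+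
  have "(\<lambda>\<gamma>::oriented_circle. (fst \<gamma>, fst (snd \<gamma>), frame1 (snd (snd \<gamma>)), frame2 (snd (snd \<gamma>)))) \<in> borel_measurable borel"
    by (intro borel_measurable_Pair) measurable
  from measurable_sets_borel[OF this, of "\<Union>i<m. C i"]
  have "(\<lambda>\<gamma>::oriented_circle. (fst \<gamma>, fst (snd \<gamma>), frame1 (snd (snd \<gamma>)), frame2 (snd (snd \<gamma>)))) -` (\<Union>i<m. C i) \<in> sets borel"
    by simp
  moreover have "(\<lambda>\<gamma>::oriented_circle. (fst \<gamma>, fst (snd \<gamma>), frame1 (snd (snd \<gamma>)), frame2 (snd (snd \<gamma>)))) -` (\<Union>i<m. C i)
    = {\<gamma>. range (circle_param \<gamma>) \<inter> curve_image m (\<lambda>i t. embed_plane (K i t)) \<noteq> {}}"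
  proof -
    have "range (circle_param \<gamma>) = circle_param \<gamma> ` {0..1}" for \<gamma>
    proof -
      have "circle_param \<gamma> s = circle_param \<gamma> (frac s)" for s
      proof -
        have "2 * pi * s = 2 * pi * frac s + 2 * pi * of_int \<lfloor>s\<rfloor>" by (simp add: frac_def algebra_simps)
        then have "sin (2 * pi * s) = sin (2 * pi * frac s)" "cos (2 * pi * s) = cos (2 * pi * frac s)"
          using sin_cos_eq_iff[of "2 * pi * s" "2 * pi * frac s"] by (metis mult.commute)+
        then show ?thesis unfolding circle_param_eq' by simp
      qed
      then show ?thesis using frac_ge_0 frac_lt_1 by (force simp: image_iff intro: less_imp_le)
    qed
    note rng = this
    have cim: "curve_image m (\<lambda>i t. embed_plane (K i t)) = (\<Union>i<m. (\<lambda>t. embed_plane (K i t)) ` {0..1})"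
      using arg_cong[OF curve_image_eq, of "image embed_plane"] by (simp add: curve_image_def image_UN image_image)
    show ?thesis
    proof (rule set_eqI)
      fix \<gamma> :: oriented_circle
      have "\<gamma> \<in> (\<lambda>\<gamma>. (fst \<gamma>, fst (snd \<gamma>), frame1 (snd (snd \<gamma>)), frame2 (snd (snd \<gamma>)))) -` (\<Union>i<m. C i)
        \<longleftrightarrow> (\<exists>i<m. \<exists>s\<in>{0..1}. \<exists>t\<in>{0..1}. circle_param \<gamma> s = embed_plane (K i t))"
        unfolding circle_param_eq' C_def T_def by (auto simp: Bex_def simp del: atLeastAtMost_iff)
      also have "\<dots> \<longleftrightarrow> \<gamma> \<in> {\<gamma>. range (circle_param \<gamma>) \<inter> curve_image m (\<lambda>i t. embed_plane (K i t)) \<noteq> {}}"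
        unfolding rng cim by blast
      finally show "\<gamma> \<in> (\<lambda>\<gamma>. (fst \<gamma>, fst (snd \<gamma>), frame1 (snd (snd \<gamma>)), frame2 (snd (snd \<gamma>)))) -` (\<Union>i<m. C i)
        \<longleftrightarrow> \<gamma> \<in> {\<gamma>. range (circle_param \<gamma>) \<inter> curve_image m (\<lambda>i t. embed_plane (K i t)) \<noteq> {}}" .
    qed
  qed
  ultimately show ?thesis by simp
qed

text \<open>For a circle off the curve the kernel is continuous on the parameter square, so the
  gauge integral in \<open>linking_number\<close> is a Lebesgue integral and depends measurably on
  the circle. The remaining circles form a Borel set with value \<open>0\<close>.\<close>

lemma measurable_linking: "linking \<in> borel_measurable borel"
proof -
  let ?M = "{\<gamma>. range (circle_param \<gamma>) \<inter> curve_image m (\<lambda>i t. embed_plane (K i t)) \<noteq> {}}"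
  note measurable_meets_curve [measurable]
  have eq: "linking \<gamma> = (if \<gamma> \<in> ?M then 0 else (\<Sum>i<m. 1 / (4 * pi) * (LINT p|lborel. indicator ({0..1} \<times> {0..1}) p * gauss_kernel i \<gamma> p)))" for \<gamma>
  proof (cases "\<gamma> \<in> ?M")
    case False
    obtain r c n where g: "\<gamma> = (r, c, n)" by (cases \<gamma>) auto
    have "linking_number (circle_param \<gamma>) (\<lambda>t. embed_plane (K i t)) = 1 / (4 * pi) * (LINT p|lborel. indicator ({0..1} \<times> {0..1}) p * gauss_kernel i \<gamma> p)"
      if i: "i < m" for i
    proof -
      have "embed_plane (K i t) \<in> curve_image m (\<lambda>i t. embed_plane (K i t))" for t using i by (auto simp: curve_image_def)
      moreover have "circle_param \<gamma> s \<notin> curve_image m (\<lambda>i t. embed_plane (K i t))" for s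
        using False rangeI[of "circle_param \<gamma>" s] by blast
      ultimately have ne: "circle_param \<gamma> s - embed_plane (K i t) \<noteq> 0" for s t
        by (metis right_minus_eq)
      have cont: "continuous_on ({0..1} \<times> {0..1}) (gauss_kernel i \<gamma>)"
        using ne unfolding gauss_kernel_def circle_param_eq'
        by (intro continuous_intros continuous_on_cross continuous_on_embed_plane
            continuous_on_compose2[OF K_cont[OF i, of UNIV]] continuous_on_compose2[OF K'_cont[OF i, of UNIV]]) auto
      have int: "set_integrable lborel ({0..1} \<times> {0..1}) (gauss_kernel i \<gamma>)"
        using borel_integrable_compact[OF compact_Times[OF compact_Icc compact_Icc] cont] by (simp add: set_integrable_def)
      have "linking_number (circle_param \<gamma>) (\<lambda>t. embed_plane (K i t)) = 1 / (4 * pi) * integral ({0..1} \<times> {0..1}) (gauss_kernel i \<gamma>)"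
        unfolding linking_number_def vector_derivative_embed[OF i] g vector_derivative_at[OF circle_param_deriv]
        by (simp add: gauss_kernel_def[abs_def] case_prod_beta' del: circle_param.simps)
      also have "integral ({0..1} \<times> {0..1}) (gauss_kernel i \<gamma>) = (LINT p|lborel. indicator ({0..1} \<times> {0..1}) p * gauss_kernel i \<gamma> p)"
        using set_borel_integral_eq_integral(2)[OF int] by (simp add: set_lebesgue_integral_def)
      finally show ?thesis .
    qed
    with False show ?thesis by (simp add: circle_linking_def del: circle_param.simps)
  qed (simp add: circle_linking_def)
  have [measurable]: "(\<lambda>\<gamma>. LINT p|lborel. indicator ({0..1} \<times> {0..1}) p * gauss_kernel i \<gamma> p) \<in> borel_measurable borel" if "i < m" for i
  proof (rule lborel.borel_measurable_lebesgue_integral)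
    have [measurable]: "(\<lambda>p. gauss_kernel i (fst p) (snd p)) \<in> borel_measurable (borel \<Otimes>\<^sub>M lborel)"
      using measurable_gauss_kernel[OF that] by (simp add: case_prod_beta')
    have "{0..1} \<times> {0..1} \<in> sets (lborel :: (real \<times> real) measure)"
      unfolding sets_lborel by (intro borel_closed closed_Times) auto
    then have "(indicator ({0..1} \<times> {0..1}) :: real \<times> real \<Rightarrow> real) \<in> borel_measurable lborel"
      by (rule borel_measurable_indicator)
    from measurable_compose[OF measurable_snd this]
    show "(\<lambda>(\<gamma>, p). indicator ({0..1} \<times> {0..1}) p * gauss_kernel i \<gamma> p) \<in> borel_measurable (borel \<Otimes>\<^sub>M lborel)"
      unfolding case_prod_beta' by (rule borel_measurable_times) measurable
  qed
  show ?thesis unfolding eq[abs_def] by measurable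
qed


text \<open>The curve is covered by \<open>sweep\<close> with \<open>v = 0\<close>, whose Jacobian
  vanishes.\<close>

lemma AE_not_curve: "AE x in lborel. x \<notin> curve_image m K"
proof -
  let ?Q = "{p::real^2. p$1 \<in> {0..1} \<and> p$2 \<in> {0..1}}"
  have Q: "compact ?Q"
  proof -
    have "?Q = cbox (vec2 0 0) (vec2 1 1)" by (auto simp: mem_box_cart forall_2)
    then show ?thesis by simp
  qed
  have "sweep i 0 ` ?Q \<in> null_sets lborel" if i: "i < m" for i
  proof (rule null_setsI)
    show "sweep i 0 ` ?Q \<in> sets lborel"
      using compact_continuous_image[OF sweep_cont[OF i] Q] by (simp add: borel_closed compact_imp_closed)
    have "emeasure lborel (sweep i 0 ` ?Q) \<le> (\<integral>\<^sup>+p\<in>?Q. ennreal \<bar>cr 0 (K' i (p$1))\<bar> \<partial>lborel)"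
      by (rule emeasure_differentiable_image_le[OF Q sweep_deriv[OF i] sweep_det])
         (intro continuous_intros continuous_on_compose2[OF K'_cont[OF i, of UNIV]], auto)
    then show "emeasure lborel (sweep i 0 ` ?Q) = 0" by (simp add: cr_def)
  qed
  then have "(\<Union>i\<in>{..<m}. sweep i 0 ` ?Q) \<in> null_sets lborel" by (intro null_sets_UN') auto
  then have "AE x in lborel. x \<notin> (\<Union>i\<in>{..<m}. sweep i 0 ` ?Q)" by (rule AE_not_in)
  moreover have "curve_image m K \<subseteq> (\<Union>i\<in>{..<m}. sweep i 0 ` ?Q)"
  proof
    fix x assume "x \<in> curve_image m K"
    then obtain i s where "i < m" "s \<in> {0..1}" "x = K i s" unfolding curve_image_eq by blast
    then show "x \<in> (\<Union>i\<in>{..<m}. sweep i 0 ` ?Q)"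
      by (intro UN_I[of i] image_eqI[of _ _ "vec2 s 0"]) (auto simp: sweep_def)
  qed
  ultimately show ?thesis by (auto elim!: eventually_mono)
qed

lemma AE_not_curve_translate: "AE x in lborel. a + x \<notin> curve_image m K"
proof -
  have "AE x in distr lborel borel ((+) a). x \<notin> curve_image m K"
    unfolding lborel_distr_plus by (rule AE_not_curve)
  then show ?thesis by (rule AE_distrD[rotated]) simp
qed

end

section \<open>Integration over circles\<close>

lemma measurable_vec3_comp [measurable (raw)]:
  assumes [measurable]: "f \<in> borel_measurable M" "g \<in> borel_measurable M"
  shows "(\<lambda>x. vec3 (f x) (g x)) \<in> borel_measurable M"
proof -
  have "(\<lambda>x. case_prod vec3 (f x, g x)) \<in> borel_measurable M"
    by (rule measurable_compose[OF _ measurable_vec3]) measurable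
  then show ?thesis by simp
qed

context planar_domain
begin

text \<open>When the center moves horizontally, the two points in the plane move along and their
  difference \<open>v\<close> stays the same. Up to the null set of centers for which one of them
  lies on the curve, the squared linking number is a translate of the indicator of
  \<open>separated v\<close>. The tangential heights \<open>t = 1\<close> and \<open>t = -1\<close>
  are left out.\<close>

lemma nn_integral_linking_horizontal:
  assumes r: "0 < r" and \<phi>: "0 < \<phi>" "\<phi> < pi" and t: "\<bar>t\<bar> \<noteq> 1"
  shows "(\<integral>\<^sup>+x. ennreal ((linking (r, vec3 x (r * sin \<phi> * t), sphere_chart (\<phi>, \<theta>)))\<^sup>2) \<partial>lborel)
    = indicator {-1<..<1} t * (2 * escape ((2 * r * sqrt (1 - t\<^sup>2)) *\<^sub>R dirv \<theta>))"
proof (cases "\<bar>t\<bar> < 1")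
  case True
  define a where "a = r * sqrt (1 - t\<^sup>2)"
  define b where "b = (r * t) *\<^sub>R circle_frame \<phi> \<theta> - a *\<^sub>R dirv \<theta>"
  define v where "v = (2 * a) *\<^sub>R dirv \<theta>"
  let ?D = "separated v"
  have v: "v = a *\<^sub>R dirv \<theta> + a *\<^sub>R dirv \<theta>"
    unfolding v_def by (simp only: mult_2 scaleR_add_left)
  have p: "x + (r * t) *\<^sub>R circle_frame \<phi> \<theta> - a *\<^sub>R dirv \<theta> = b + x"
    and q: "x + (r * t) *\<^sub>R circle_frame \<phi> \<theta> + a *\<^sub>R dirv \<theta> = (b + v) + x" for x
    unfolding b_def v by (simp_all only: add_diff_eq diff_add_eq add.assoc[symmetric] add_diff_cancel_right' add.commute[of _ x] diff_add_cancel)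
  have "(\<integral>\<^sup>+x. ennreal ((linking (r, vec3 x (r * sin \<phi> * t), sphere_chart (\<phi>, \<theta>)))\<^sup>2) \<partial>lborel)
    = (\<integral>\<^sup>+x. indicator ?D (b + x) \<partial>lborel)"
  proof (rule nn_integral_cong_AE)
    show "AE x in lborel. ennreal ((linking (r, vec3 x (r * sin \<phi> * t), sphere_chart (\<phi>, \<theta>)))\<^sup>2) = indicator ?D (b + x)"
      using AE_not_curve_translate[of b] AE_not_curve_translate[of "b + v"]
    proof eventually_elim
      case (elim x)
      have "linking (r, vec3 x (r * sin \<phi> * t), sphere_chart (\<phi>, \<theta>)) = indicator \<Omega> (b + x) - indicator \<Omega> ((b + v) + x)"
        using circle_linking_crossing[OF r \<phi> True, of x \<theta>] elim unfolding a_def[symmetric] p q by simp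
      also have "(b + v) + x = (b + x) + v" by (simp add: add.assoc add.commute)
      finally show ?case
        by (cases "b + x \<in> \<Omega>"; cases "b + x + v \<in> \<Omega>") simp_all
    qed
  qed
  also have "\<dots> = (\<integral>\<^sup>+x. indicator ?D x \<partial>lborel)"
    using measurable_sides_differ by (intro nn_integral_lborel_translate) auto
  also have "\<dots> = 2 * escape v"
    unfolding emeasure_sides_differ[symmetric]
    by (rule nn_integral_indicator) (simp only: sets_lborel measurable_sides_differ)
  moreover have "t \<in> {-1<..<1}" using True by auto
  ultimately show ?thesis by (simp add: v_def a_def mult.assoc)
next
  case False
  then have "\<bar>t\<bar> > 1" using t by simp
  have sp: "r * sin \<phi> > 0" using r sin_gt_zero[OF \<phi>] by simp
  have "r * sin \<phi> < r * sin \<phi> * \<bar>t\<bar>" using mult_strict_left_mono[OF \<open>\<bar>t\<bar> > 1\<close> sp] by simp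
  also have "\<dots> = \<bar>r * sin \<phi>\<bar> * \<bar>t\<bar>" by (simp only: abs_of_pos[OF sp])
  also have "\<dots> = \<bar>r * sin \<phi> * t\<bar>" by (simp only: abs_mult)
  finally have "linking (r, vec3 x (r * sin \<phi> * t), sphere_chart (\<phi>, \<theta>)) = 0" for x
    by (rule circle_linking_disjoint_plane[OF r \<phi>])
  then show ?thesis using False by (auto simp: indicator_def)
qed

lemma measurable_linking_center:
  "(\<lambda>c. ennreal ((linking (r, c, n))\<^sup>2)) \<in> borel_measurable borel"
proof -
  have "(\<lambda>c::real^3. (r, c, n)) \<in> borel_measurable borel"
    by (intro borel_measurable_continuous_onI continuous_intros)
  from measurable_compose[OF this measurable_linking]
  have "(\<lambda>c. linking (r, c, n)) \<in> borel_measurable borel" .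
  then show ?thesis by measurable
qed

text \<open>\<open>t\<close> is the height of the center in units of \<open>r * sin \<phi>\<close>,
  the largest height from which the circle still reaches the plane; this unit is the
  Jacobian.\<close>

lemma nn_integral_linking_center:
  assumes r: "0 < r" and \<phi>: "0 < \<phi>" "\<phi> < pi"
  shows "(\<integral>\<^sup>+c. ennreal ((linking (r, c, sphere_chart (\<phi>, \<theta>)))\<^sup>2) \<partial>lborel)
    = ennreal (r * sin \<phi>) * (\<integral>\<^sup>+t. indicator {-1<..<1} t * (2 * escape ((2 * r * sqrt (1 - t\<^sup>2)) *\<^sub>R dirv \<theta>)) \<partial>lborel)"
proof -
  define g where "g c = ennreal ((linking (r, c, sphere_chart (\<phi>, \<theta>)))\<^sup>2)" for c
  have gm [measurable]: "g \<in> borel_measurable borel"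
    unfolding g_def[abs_def] by (rule measurable_linking_center)
  have sp: "r * sin \<phi> > 0" using r sin_gt_zero[OF \<phi>] by simp
  have "(\<integral>\<^sup>+c. g c \<partial>lborel) = (\<integral>\<^sup>+y. \<integral>\<^sup>+x. g (vec3 x y) \<partial>lborel \<partial>lborel)"
    by (rule nn_integral_vec3) measurable
  also have "\<dots> = ennreal \<bar>r * sin \<phi>\<bar> * (\<integral>\<^sup>+t. \<integral>\<^sup>+x. g (vec3 x (0 + r * sin \<phi> * t)) \<partial>lborel \<partial>lborel)"
    by (rule nn_integral_real_affine) (measurable, use sp in linarith)
  also have "(\<integral>\<^sup>+t. \<integral>\<^sup>+x. g (vec3 x (0 + r * sin \<phi> * t)) \<partial>lborel \<partial>lborel)
    = (\<integral>\<^sup>+t. indicator {-1<..<1} t * (2 * escape ((2 * r * sqrt (1 - t\<^sup>2)) *\<^sub>R dirv \<theta>)) \<partial>lborel)"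
  proof (rule nn_integral_cong_AE)
    show "AE t in lborel. (\<integral>\<^sup>+x. g (vec3 x (0 + r * sin \<phi> * t)) \<partial>lborel)
      = indicator {-1<..<1} t * (2 * escape ((2 * r * sqrt (1 - t\<^sup>2)) *\<^sub>R dirv \<theta>))"
      using AE_lborel_singleton[of "1::real"] AE_lborel_singleton[of "-1::real"]
    proof eventually_elim
      case (elim t)
      then have "\<bar>t\<bar> \<noteq> 1" by auto
      then show ?case using nn_integral_linking_horizontal[OF r \<phi>] by (simp add: g_def)
    qed
  qed
  finally show ?thesis using sp by (simp add: g_def)
qed

text \<open>Substitute \<open>\<rho> = \<kappa> * r\<close>: the density gives
  \<open>\<kappa>^3 / \<rho>^3\<close>, the measure \<open>1 / \<kappa>\<close>. Since
  \<open>1 / \<rho>^3 = \<rho> * (1 / \<rho>^4)\<close>, polar coordinates read backwards yield the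
  planar integral with cut-off \<open>\<kappa> * \<epsilon>\<close>.\<close>

lemma nn_integral_escape_radial:
  assumes \<epsilon>: "\<epsilon> > 0" and \<kappa>: "\<kappa> > 0"
  shows "(\<integral>\<^sup>+r. \<integral>\<^sup>+\<theta>. indicator {\<epsilon><..} r * ennreal (1 / r ^ 3) * (indicator {0..2*pi} \<theta> * (2 * escape ((\<kappa> * r) *\<^sub>R dirv \<theta>))) \<partial>lborel \<partial>lborel)
    = ennreal (2 * \<kappa>\<^sup>2 * planar_integral (\<kappa> * \<epsilon>))"
proof -
  let ?f = "\<lambda>r. \<integral>\<^sup>+\<theta>. indicator {\<epsilon><..} r * ennreal (1 / r ^ 3) * (indicator {0..2*pi} \<theta> * (2 * escape ((\<kappa> * r) *\<^sub>R dirv \<theta>))) \<partial>lborel"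
  let ?g = "\<lambda>\<rho>. \<integral>\<^sup>+\<theta>. indicator {0<..} \<rho> * indicator {0..2*pi} \<theta> * (ennreal \<rho> * (indicator {\<kappa> * \<epsilon><..} (norm (\<rho> *\<^sub>R dirv \<theta>)) * ennreal (1 / norm (\<rho> *\<^sub>R dirv \<theta>) ^ 4) * escape (\<rho> *\<^sub>R dirv \<theta>))) \<partial>lborel"
  have ke: "\<kappa> * \<epsilon> > 0" using assms by simp
  have polar: "ennreal (planar_integral (\<kappa> * \<epsilon>)) = (\<integral>\<^sup>+\<rho>. ?g \<rho> \<partial>lborel)"
    unfolding nn_integral_escape[OF ke, symmetric] by (rule nn_integral_polar) measurable
  have "(\<integral>\<^sup>+r. ?f r \<partial>lborel) = ennreal \<bar>1 / \<kappa>\<bar> * (\<integral>\<^sup>+\<rho>. ?f (0 + 1 / \<kappa> * \<rho>) \<partial>lborel)"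
    by (rule nn_integral_real_affine) (measurable, use \<kappa> in simp)
  also have "(\<integral>\<^sup>+\<rho>. ?f (0 + 1 / \<kappa> * \<rho>) \<partial>lborel) = (\<integral>\<^sup>+\<rho>. ennreal (2 * \<kappa> ^ 3) * ?g \<rho> \<partial>lborel)"
  proof (rule nn_integral_cong)
    fix \<rho> :: real
    have "?f (0 + 1 / \<kappa> * \<rho>) = (\<integral>\<^sup>+\<theta>. ennreal (2 * \<kappa> ^ 3) * (indicator {0<..} \<rho> * indicator {0..2*pi} \<theta> * (ennreal \<rho> * (indicator {\<kappa> * \<epsilon><..} (norm (\<rho> *\<^sub>R dirv \<theta>)) * ennreal (1 / norm (\<rho> *\<^sub>R dirv \<theta>) ^ 4) * escape (\<rho> *\<^sub>R dirv \<theta>)))) \<partial>lborel)"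
    proof (rule nn_integral_cong)
      fix \<theta> :: real
      show "indicator {\<epsilon><..} (0 + 1 / \<kappa> * \<rho>) * ennreal (1 / (0 + 1 / \<kappa> * \<rho>) ^ 3) * (indicator {0..2*pi} \<theta> * (2 * escape ((\<kappa> * (0 + 1 / \<kappa> * \<rho>)) *\<^sub>R dirv \<theta>)))
        = ennreal (2 * \<kappa> ^ 3) * (indicator {0<..} \<rho> * indicator {0..2*pi} \<theta> * (ennreal \<rho> * (indicator {\<kappa> * \<epsilon><..} (norm (\<rho> *\<^sub>R dirv \<theta>)) * ennreal (1 / norm (\<rho> *\<^sub>R dirv \<theta>) ^ 4) * escape (\<rho> *\<^sub>R dirv \<theta>))))"
      proof (cases "\<rho> > \<kappa> * \<epsilon>")
        case True
        then have \<rho>: "\<rho> > 0" using ke by linarith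
        have gt: "\<epsilon> < \<rho> / \<kappa>" using True \<kappa> by (simp add: pos_less_divide_eq mult.commute)
        have "ennreal (2 * \<kappa> ^ 3) * (ennreal \<rho> * (ennreal (1 / \<rho> ^ 4) * e)) = ennreal (1 / (\<rho> / \<kappa>) ^ 3) * (2 * e)" for e
        proof -
          have "ennreal (2 * \<kappa> ^ 3) * (ennreal \<rho> * (ennreal (1 / \<rho> ^ 4) * e)) = ennreal (2 * \<kappa> ^ 3 * (\<rho> * (1 / \<rho> ^ 4))) * e"
            using \<kappa> \<rho> by (subst ennreal_mult3) (simp_all add: mult.assoc)
          also have "2 * \<kappa> ^ 3 * (\<rho> * (1 / \<rho> ^ 4)) = 1 / (\<rho> / \<kappa>) ^ 3 * 2"
            using \<kappa> \<rho> by (simp add: power_divide power_numeral_reduce)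
          also have "ennreal (1 / (\<rho> / \<kappa>) ^ 3 * 2) * e = ennreal (1 / (\<rho> / \<kappa>) ^ 3) * (2 * e)"
            using \<kappa> \<rho> by (subst ennreal_mult') (simp_all add: mult.assoc)
          finally show ?thesis .
        qed
        then show ?thesis using True \<rho> gt \<kappa> by (simp add: indicator_def)
      next
        case False
        then have "\<not> \<epsilon> < \<rho> / \<kappa>" using \<kappa> by (simp add: pos_less_divide_eq mult.commute)
        then show ?thesis using False by (auto simp: indicator_def)
      qed
    qed
    also have "\<dots> = ennreal (2 * \<kappa> ^ 3) * ?g \<rho>"
      by (rule nn_integral_cmult) measurable
    finally show "?f (0 + 1 / \<kappa> * \<rho>) = ennreal (2 * \<kappa> ^ 3) * ?g \<rho>" .
  qed
  also have "\<dots> = ennreal (2 * \<kappa> ^ 3) * ennreal (planar_integral (\<kappa> * \<epsilon>))"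
    unfolding polar by (rule nn_integral_cmult) measurable
  also have "ennreal \<bar>1 / \<kappa>\<bar> * (ennreal (2 * \<kappa> ^ 3) * ennreal (planar_integral (\<kappa> * \<epsilon>))) = ennreal (\<bar>1 / \<kappa>\<bar> * (2 * \<kappa> ^ 3 * planar_integral (\<kappa> * \<epsilon>)))"
  proof -
    have "ennreal (2 * \<kappa> ^ 3) * ennreal (planar_integral (\<kappa> * \<epsilon>)) = ennreal (2 * \<kappa> ^ 3 * planar_integral (\<kappa> * \<epsilon>))"
      by (rule ennreal_mult'[symmetric]) (use \<kappa> in simp)
    then show ?thesis by (simp only: ennreal_mult'[OF abs_ge_zero])
  qed
  also have "\<bar>1 / \<kappa>\<bar> * (2 * \<kappa> ^ 3 * planar_integral (\<kappa> * \<epsilon>)) = 2 * \<kappa>\<^sup>2 * planar_integral (\<kappa> * \<epsilon>)"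
    using \<kappa> by (simp add: power_numeral_reduce)
  finally show ?thesis .
qed

lemma measurable_planar_integral [measurable]: "planar_integral \<in> borel_measurable borel"
proof -
  \<comment> \<open>Written with a conditional, the integrand is visibly measurable in
    \<open>\<epsilon>\<close> and \<open>v\<close> jointly.\<close>
  have "planar_integral \<epsilon> = enn2real (\<integral>\<^sup>+v. (if \<epsilon> < norm v then ennreal (1 / norm v ^ 4) * escape v else 0) \<partial>lborel)" for \<epsilon>
    unfolding planar_integral_def
    by (rule arg_cong[where f = enn2real], rule nn_integral_cong) (auto simp: indicator_def)
  then have eq: "planar_integral = (\<lambda>\<epsilon>. enn2real (\<integral>\<^sup>+v. (if \<epsilon> < norm v then ennreal (1 / norm v ^ 4) * escape v else 0) \<partial>lborel))"
    by blast
  show ?thesis unfolding eq by measurable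
qed

lemma measurable_circles_gt [measurable]: "circles_gt \<epsilon> \<in> sets borel"
proof -
  have "circles_gt \<epsilon> = {\<gamma>. \<epsilon> < fst \<gamma>} \<inter> {\<gamma>. norm (snd (snd \<gamma>)) = 1}"
    by (auto simp: circles_gt_def)
  moreover have "open {\<gamma> :: oriented_circle. \<epsilon> < fst \<gamma>}"
    by (intro open_Collect_less continuous_intros)
  moreover have "closed {\<gamma> :: oriented_circle. norm (snd (snd \<gamma>)) = 1}"
    by (intro closed_Collect_eq continuous_intros)
  ultimately show ?thesis by (auto intro: borel_open borel_closed)
qed

text \<open>The density \<open>1 / r^4\<close>, the area factor \<open>sin \<phi>\<close> and the
  Jacobian \<open>r * sin \<phi>\<close> of the height combine to
  \<open>(sin \<phi>)^2 / r^3\<close>. The tilt therefore separates with integral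
  \<open>pi / 2\<close>, and \<open>nn_integral_escape_radial\<close> with
  \<open>\<kappa> = 2 * sqrt (1 - t^2)\<close> supplies \<open>8 * (1 - t^2)\<close>.\<close>

lemma nn_integral_linking:
  assumes \<epsilon>: "\<epsilon> > 0"
  shows "(\<integral>\<^sup>+\<gamma>. indicator (circles_gt \<epsilon>) \<gamma> * ennreal ((linking \<gamma>)\<^sup>2) \<partial>circle_measure)
    = (\<integral>\<^sup>+t. indicator {-1<..<1} t * ennreal (4 * pi * (1 - t\<^sup>2) * planar_integral (2 * sqrt (1 - t\<^sup>2) * \<epsilon>)) \<partial>lborel)"
proof -
  define B where "B r \<theta> t = indicator {\<epsilon><..} r * ennreal (1 / r ^ 3) *
    (indicator {0..2*pi} \<theta> * (indicator {-1<..<1} t * (2 * escape ((2 * r * sqrt (1 - t\<^sup>2)) *\<^sub>R dirv \<theta>))))" for r \<theta> t :: real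
  define A where "A \<phi> = indicator {0..pi} \<phi> * ennreal ((sin \<phi>)\<^sup>2)" for \<phi> :: real
  have [measurable]: "A \<in> borel_measurable borel" unfolding A_def by measurable
  have Bm [measurable]: "(\<lambda>x. B (f x) (g x) (h x)) \<in> borel_measurable M"
    if [measurable]: "f \<in> borel_measurable M" "g \<in> borel_measurable M" "h \<in> borel_measurable M" for f g h M
    unfolding B_def by measurable
  have Gm: "(\<lambda>\<gamma>. indicator (circles_gt \<epsilon>) \<gamma> * ennreal ((linking \<gamma>)\<^sup>2)) \<in> borel_measurable borel"
    using measurable_linking by measurable
  have "(\<integral>\<^sup>+\<gamma>. indicator (circles_gt \<epsilon>) \<gamma> * ennreal ((linking \<gamma>)\<^sup>2) \<partial>circle_measure)
    = (\<integral>\<^sup>+r. \<integral>\<^sup>+\<phi>. \<integral>\<^sup>+\<theta>. indicator {0..pi} \<phi> * indicator {0..2*pi} \<theta> * ennreal (sin \<phi>) *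
       (ennreal (1 / r ^ 4) * (\<integral>\<^sup>+c. indicator (circles_gt \<epsilon>) (r, c, sphere_chart (\<phi>, \<theta>)) * ennreal ((linking (r, c, sphere_chart (\<phi>, \<theta>)))\<^sup>2) \<partial>lborel)) \<partial>lborel \<partial>lborel \<partial>lborel)"
    by (rule nn_integral_circle_measure[OF Gm])
  also have "\<dots> = (\<integral>\<^sup>+r. \<integral>\<^sup>+\<phi>. \<integral>\<^sup>+\<theta>. A \<phi> * (\<integral>\<^sup>+t. B r \<theta> t \<partial>lborel) \<partial>lborel \<partial>lborel \<partial>lborel)"
  proof (rule nn_integral_cong, rule nn_integral_cong_AE)
    fix r :: real
    \<comment> \<open>The tilts \<open>0\<close> and \<open>pi\<close>, where the frame takes its
      default value, are removed as a null set.\<close>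
    show "AE \<phi> in lborel. (\<integral>\<^sup>+\<theta>. indicator {0..pi} \<phi> * indicator {0..2*pi} \<theta> * ennreal (sin \<phi>) *
       (ennreal (1 / r ^ 4) * (\<integral>\<^sup>+c. indicator (circles_gt \<epsilon>) (r, c, sphere_chart (\<phi>, \<theta>)) * ennreal ((linking (r, c, sphere_chart (\<phi>, \<theta>)))\<^sup>2) \<partial>lborel)) \<partial>lborel)
      = (\<integral>\<^sup>+\<theta>. A \<phi> * (\<integral>\<^sup>+t. B r \<theta> t \<partial>lborel) \<partial>lborel)"
      using AE_lborel_singleton[of "0::real"] AE_lborel_singleton[of pi]
    proof eventually_elim
      case (elim \<phi>)
      show ?case
      proof (rule nn_integral_cong)
        fix \<theta> :: real
        show "indicator {0..pi} \<phi> * indicator {0..2*pi} \<theta> * ennreal (sin \<phi>) *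
          (ennreal (1 / r ^ 4) * (\<integral>\<^sup>+c. indicator (circles_gt \<epsilon>) (r, c, sphere_chart (\<phi>, \<theta>)) * ennreal ((linking (r, c, sphere_chart (\<phi>, \<theta>)))\<^sup>2) \<partial>lborel))
          = A \<phi> * (\<integral>\<^sup>+t. B r \<theta> t \<partial>lborel)"
        proof (cases "\<epsilon> < r \<and> 0 < \<phi> \<and> \<phi> < pi")
          case True
          then have r: "0 < r" and \<phi>: "0 < \<phi>" "\<phi> < pi" using \<epsilon> by auto
          have sp: "sin \<phi> > 0" using sin_gt_zero[OF \<phi>] .
          let ?I = "\<integral>\<^sup>+t. indicator {-1<..<1} t * (2 * escape ((2 * r * sqrt (1 - t\<^sup>2)) *\<^sub>R dirv \<theta>)) \<partial>lborel"
          have Im: "(\<lambda>t. indicator {-1<..<1} t * (2 * escape ((2 * r * sqrt (1 - t\<^sup>2)) *\<^sub>R dirv \<theta>))) \<in> borel_measurable lborel"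
            by measurable
          have "(\<integral>\<^sup>+t. B r \<theta> t \<partial>lborel) = ennreal (1 / r ^ 3) * (indicator {0..2*pi} \<theta> * ?I)"
            using True Im unfolding B_def by (simp add: nn_integral_cmult)
          moreover have "(\<integral>\<^sup>+c. indicator (circles_gt \<epsilon>) (r, c, sphere_chart (\<phi>, \<theta>)) * ennreal ((linking (r, c, sphere_chart (\<phi>, \<theta>)))\<^sup>2) \<partial>lborel)
            = ennreal (r * sin \<phi>) * ?I"
          proof -
            have "(r, c, sphere_chart (\<phi>, \<theta>)) \<in> circles_gt \<epsilon>" for c
              using True by (simp add: circles_gt_def norm_sphere_chart)
            then show ?thesis using nn_integral_linking_center[OF r \<phi>] by simp
          qed
          moreover have "ennreal (sin \<phi>) * (ennreal (1 / r ^ 4) * (ennreal (r * sin \<phi>) * e)) = ennreal ((sin \<phi>)\<^sup>2) * (ennreal (1 / r ^ 3) * e)" for e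
          proof -
            have "ennreal (sin \<phi>) * (ennreal (1 / r ^ 4) * (ennreal (r * sin \<phi>) * e)) = ennreal (sin \<phi> * (1 / r ^ 4 * (r * sin \<phi>))) * e"
              using r sp by (intro ennreal_mult3) auto
            also have "sin \<phi> * (1 / r ^ 4 * (r * sin \<phi>)) = (sin \<phi>)\<^sup>2 * (1 / r ^ 3)"
              using r by (simp add: power_numeral_reduce)
            also have "ennreal ((sin \<phi>)\<^sup>2 * (1 / r ^ 3)) * e = ennreal ((sin \<phi>)\<^sup>2) * (ennreal (1 / r ^ 3) * e)"
              by (subst ennreal_mult') (simp_all add: mult.assoc)
            finally show ?thesis .
          qed
          ultimately show ?thesis
            using True by (simp add: A_def indicator_def)
        next
          case False
          then have "\<not> \<epsilon> < r \<or> \<phi> \<notin> {0..pi}" using elim by auto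
          then show ?thesis
            by (auto simp: A_def B_def circles_gt_def indicator_def)
        qed
      qed
    qed
  qed
  also have "\<dots> = (\<integral>\<^sup>+r. \<integral>\<^sup>+\<phi>. A \<phi> * (\<integral>\<^sup>+\<theta>. \<integral>\<^sup>+t. B r \<theta> t \<partial>lborel \<partial>lborel) \<partial>lborel \<partial>lborel)"
    by (rule nn_integral_cong, rule nn_integral_cong, rule nn_integral_cmult) measurable
  also have "\<dots> = (\<integral>\<^sup>+r. ennreal (pi / 2) * (\<integral>\<^sup>+\<theta>. \<integral>\<^sup>+t. B r \<theta> t \<partial>lborel \<partial>lborel) \<partial>lborel)"
  proof (rule nn_integral_cong)
    fix r :: real
    have "integral\<^sup>N lborel A = ennreal (pi / 2)"
      unfolding A_def[abs_def] by (rule nn_integral_sin_squared)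
    then show "(\<integral>\<^sup>+\<phi>. A \<phi> * (\<integral>\<^sup>+\<theta>. \<integral>\<^sup>+t. B r \<theta> t \<partial>lborel \<partial>lborel) \<partial>lborel) = ennreal (pi / 2) * (\<integral>\<^sup>+\<theta>. \<integral>\<^sup>+t. B r \<theta> t \<partial>lborel \<partial>lborel)"
      by (subst nn_integral_multc) simp_all
  qed
  also have "\<dots> = ennreal (pi / 2) * (\<integral>\<^sup>+r. \<integral>\<^sup>+\<theta>. \<integral>\<^sup>+t. B r \<theta> t \<partial>lborel \<partial>lborel \<partial>lborel)"
    by (rule nn_integral_cmult) measurable
  also have "(\<integral>\<^sup>+r. \<integral>\<^sup>+\<theta>. \<integral>\<^sup>+t. B r \<theta> t \<partial>lborel \<partial>lborel \<partial>lborel) = (\<integral>\<^sup>+r. \<integral>\<^sup>+t. \<integral>\<^sup>+\<theta>. B r \<theta> t \<partial>lborel \<partial>lborel \<partial>lborel)"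
    by (rule nn_integral_cong, rule lborel_pair.Fubini') measurable
  also have "\<dots> = (\<integral>\<^sup>+t. \<integral>\<^sup>+r. \<integral>\<^sup>+\<theta>. B r \<theta> t \<partial>lborel \<partial>lborel \<partial>lborel)"
    by (rule lborel_pair.Fubini') measurable
  also have "\<dots> = (\<integral>\<^sup>+t. indicator {-1<..<1} t * ennreal (8 * (1 - t\<^sup>2) * planar_integral (2 * sqrt (1 - t\<^sup>2) * \<epsilon>)) \<partial>lborel)"
  proof (rule nn_integral_cong)
    fix t :: real
    show "(\<integral>\<^sup>+r. \<integral>\<^sup>+\<theta>. B r \<theta> t \<partial>lborel \<partial>lborel) = indicator {-1<..<1} t * ennreal (8 * (1 - t\<^sup>2) * planar_integral (2 * sqrt (1 - t\<^sup>2) * \<epsilon>))"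
    proof (cases "\<bar>t\<bar> < 1")
      case True
      then have t1: "-1 < t" "t < 1" by auto
      have p: "1 - t\<^sup>2 > 0" using True by (simp add: abs_square_less_1)
      then have \<kappa>: "2 * sqrt (1 - t\<^sup>2) > 0" by simp
      have "(\<integral>\<^sup>+r. \<integral>\<^sup>+\<theta>. B r \<theta> t \<partial>lborel \<partial>lborel) = ennreal (2 * (2 * sqrt (1 - t\<^sup>2))\<^sup>2 * planar_integral (2 * sqrt (1 - t\<^sup>2) * \<epsilon>))"
        unfolding nn_integral_escape_radial[OF \<epsilon> \<kappa>, symmetric] B_def using t1 by (simp add: indicator_def mult_ac)
      also have "(2 * sqrt (1 - t\<^sup>2))\<^sup>2 = 4 * (1 - t\<^sup>2)" using p by (simp add: power_mult_distrib)
      finally show ?thesis using t1 by simp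
    next
      case False
      then show ?thesis by (auto simp: B_def indicator_def)
    qed
  qed
  also have "ennreal (pi / 2) * \<dots> = (\<integral>\<^sup>+t. ennreal (pi / 2) * (indicator {-1<..<1} t * ennreal (8 * (1 - t\<^sup>2) * planar_integral (2 * sqrt (1 - t\<^sup>2) * \<epsilon>))) \<partial>lborel)"
    by (rule nn_integral_cmult[symmetric]) measurable
  also have "\<dots> = (\<integral>\<^sup>+t. indicator {-1<..<1} t * ennreal (4 * pi * (1 - t\<^sup>2) * planar_integral (2 * sqrt (1 - t\<^sup>2) * \<epsilon>)) \<partial>lborel)"
  proof (rule nn_integral_cong)
    fix t :: real
    have "ennreal (pi / 2) * ennreal (8 * (1 - t\<^sup>2) * planar_integral (2 * sqrt (1 - t\<^sup>2) * \<epsilon>)) = ennreal (4 * pi * (1 - t\<^sup>2) * planar_integral (2 * sqrt (1 - t\<^sup>2) * \<epsilon>))"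
    proof -
      have "pi / 2 * (8 * x * y) = 4 * pi * x * y" for x y :: real by simp
      then show ?thesis by (subst ennreal_mult'[symmetric]) (simp, simp only:)
    qed
    then show "ennreal (pi / 2) * (indicator {-1<..<1} t * ennreal (8 * (1 - t\<^sup>2) * planar_integral (2 * sqrt (1 - t\<^sup>2) * \<epsilon>))) = indicator {-1<..<1} t * ennreal (4 * pi * (1 - t\<^sup>2) * planar_integral (2 * sqrt (1 - t\<^sup>2) * \<epsilon>))"
      by (subst mult.left_commute) (simp only:)
  qed
  finally show ?thesis .
qed

end

section \<open>The two energies\<close>

context planar_domain
begin

lemma set_integrable_planar:
  assumes \<epsilon>: "\<epsilon> > 0"
  shows "set_integrable lborel ((\<Omega> \<times> - \<Omega>) - Delta \<epsilon>) (\<lambda>(w, z). 1 / norm (z - w) ^ 4)"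
    and "set_lebesgue_integral lborel ((\<Omega> \<times> - \<Omega>) - Delta \<epsilon>) (\<lambda>(w, z). 1 / norm (z - w) ^ 4) = planar_integral \<epsilon>"
proof -
  let ?S = "(\<Omega> \<times> - \<Omega>) - Delta \<epsilon>"
  let ?f = "\<lambda>p. indicator ?S p *\<^sub>R (case p of (w, z) \<Rightarrow> 1 / norm (z - w) ^ 4)"
  have "closed (Delta \<epsilon>)"
    unfolding Delta_def case_prod_beta' by (intro closed_Collect_le continuous_intros)
  moreover have "\<Omega> \<times> - \<Omega> \<in> sets (borel :: ((real^2) \<times> (real^2)) measure)"
    unfolding borel_prod[symmetric] by (intro pair_measureI) auto
  ultimately have S: "?S \<in> sets borel" by (auto intro: borel_closed)
  have "(\<lambda>p. 1 / norm (snd p - fst p) ^ 4) \<in> borel_measurable (borel :: ((real^2) \<times> (real^2)) measure)"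
    unfolding borel_prod[symmetric] by measurable
  then have "(\<lambda>p. indicator ?S p * (1 / norm (snd p - fst p) ^ 4)) \<in> borel_measurable lborel"
    using S by (intro borel_measurable_times borel_measurable_indicator) simp_all
  moreover have "?f = (\<lambda>p. indicator ?S p * (1 / norm (snd p - fst p) ^ 4))"
    by (rule ext) (simp add: case_prod_beta')
  ultimately have m: "?f \<in> borel_measurable lborel" by simp
  have I: "(\<integral>\<^sup>+p. ennreal (?f p) \<partial>lborel) = ennreal (planar_integral \<epsilon>)"
    unfolding nn_integral_escape[OF \<epsilon>, symmetric] nn_integral_pairs[symmetric]
    by (rule nn_integral_cong) (auto simp: indicator_def)
  have pos: "?f p \<ge> 0" for p by (auto simp: indicator_def split: prod.splits)
  show "set_integrable lborel ?S (\<lambda>(w, z). 1 / norm (z - w) ^ 4)"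
    unfolding set_integrable_def using pos I m by (intro integrableI_nonneg) auto
  show "set_lebesgue_integral lborel ?S (\<lambda>(w, z). 1 / norm (z - w) ^ 4) = planar_integral \<epsilon>"
    unfolding set_lebesgue_integral_def using pos I m planar_integral_nonneg
    by (subst integral_eq_nn_integral) auto
qed

text \<open>
  The circles of radius greater than \<open>\<epsilon>\<close> see the planar integral averaged over the cut-offs
  \<open>2 \<epsilon> \<surd>(1 - t\<^sup>2)\<close>; since \<open>energy\<close> is monotone, the average lies between its value at \<open>2 \<epsilon>\<close> and its limit.
\<close>

lemma spatial_integral_bounds:
  assumes \<epsilon>: "\<epsilon> > 0" and E: "\<And>\<delta>. 0 < \<delta> \<Longrightarrow> energy \<delta> \<le> E"
  shows "set_integrable circle_measure (circles_gt \<epsilon>) (\<lambda>\<gamma>. (linking \<gamma>)\<^sup>2)"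
    and "3 * pi * arclength / (8 * \<epsilon>) - 3 / (16 * pi) * set_lebesgue_integral circle_measure (circles_gt \<epsilon>) (\<lambda>\<gamma>. (linking \<gamma>)\<^sup>2)
      \<in> {energy (2 * \<epsilon>)..E}"
proof -
  define f where "f t = indicator {-1<..<1} t * (4 * pi * (1 - t\<^sup>2) * planar_integral (2 * sqrt (1 - t\<^sup>2) * \<epsilon>))" for t :: real
  \<comment> \<open>This is \<open>f\<close> with the varying energy replaced by a constant: by
    monotonicity \<open>a = energy (2 * \<epsilon>)\<close> gives an upper bound and
    \<open>a = E\<close> a lower one.\<close>
  define g where "g a t = indicator {-1..1} t * (4 * pi * arclength / \<epsilon> * sqrt (1 - t\<^sup>2) - 4 * pi * a * (1 - t\<^sup>2))" for a t :: real
  have fm [measurable]: "f \<in> borel_measurable borel" unfolding f_def by measurable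
  have f0: "f t \<ge> 0" for t
    by (auto simp: f_def indicator_def abs_square_le_1 abs_le_iff intro!: mult_nonneg_nonneg planar_integral_nonneg)
  have g: "integrable lborel (g a)" "(LINT t|lborel. g a t) = 2 * pi\<^sup>2 * arclength / \<epsilon> - 16 * pi / 3 * a" for a
  proof -
    let ?h = "\<lambda>t. 4 * pi * arclength / \<epsilon> * sqrt (1 - t\<^sup>2) - 4 * pi * a * (1 - t\<^sup>2)"
    have c: "continuous_on {-1..1} ?h" by (intro continuous_intros)
    have int: "set_integrable lborel {-1..1} ?h"
      using borel_integrable_compact[OF compact_Icc c] by (simp add: set_integrable_def)
    then show "integrable lborel (g a)" by (simp add: set_integrable_def g_def[abs_def])
    have "(?h has_integral (4 * pi * arclength / \<epsilon> * (pi / 2) - 4 * pi * a * (4 / 3))) {-1..1}"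
      by (intro has_integral_diff has_integral_mult_right integral_semicircle integral_parabola)
    then have "(LINT t:{-1..1}|lborel. ?h t) = 4 * pi * arclength / \<epsilon> * (pi / 2) - 4 * pi * a * (4 / 3)"
      using set_borel_integral_eq_integral(2)[OF int] by (simp add: integral_unique)
    then show "(LINT t|lborel. g a t) = 2 * pi\<^sup>2 * arclength / \<epsilon> - 16 * pi / 3 * a"
      by (simp add: set_lebesgue_integral_def g_def power2_eq_square)
  qed
  have pt: "4 * pi * (1 - t\<^sup>2) * planar_integral (2 * sqrt (1 - t\<^sup>2) * \<epsilon>)
      = 4 * pi * arclength / \<epsilon> * sqrt (1 - t\<^sup>2) - 4 * pi * energy (2 * sqrt (1 - t\<^sup>2) * \<epsilon>) * (1 - t\<^sup>2)"
    and le: "energy (2 * \<epsilon>) \<le> energy (2 * sqrt (1 - t\<^sup>2) * \<epsilon>)" "energy (2 * sqrt (1 - t\<^sup>2) * \<epsilon>) \<le> E"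
    and p: "1 - t\<^sup>2 > 0"
    if t: "t \<in> {-1<..<1}" for t
  proof -
    show p: "1 - t\<^sup>2 > 0" using t by (simp add: abs_square_less_1 abs_less_iff)
    define s where "s = sqrt (1 - t\<^sup>2)"
    have s: "s > 0" "1 - t\<^sup>2 = s * s" "s \<le> 1" using p by (auto simp: s_def)
    have "planar_integral (2 * s * \<epsilon>) = 2 * arclength / (2 * s * \<epsilon>) - energy (2 * s * \<epsilon>)"
      by (simp add: energy_def)
    moreover have "4 * pi * (s * s) * (2 * arclength / (2 * s * \<epsilon>) - e) = 4 * pi * arclength / \<epsilon> * s - 4 * pi * e * (s * s)" for e
      using s(1) \<epsilon> by (simp add: field_simps)
    ultimately have "4 * pi * (s * s) * planar_integral (2 * s * \<epsilon>) = 4 * pi * arclength / \<epsilon> * s - 4 * pi * energy (2 * s * \<epsilon>) * (s * s)"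
      by simp
    then show "4 * pi * (1 - t\<^sup>2) * planar_integral (2 * sqrt (1 - t\<^sup>2) * \<epsilon>)
      = 4 * pi * arclength / \<epsilon> * sqrt (1 - t\<^sup>2) - 4 * pi * energy (2 * sqrt (1 - t\<^sup>2) * \<epsilon>) * (1 - t\<^sup>2)"
      unfolding s(2)[symmetric] unfolding s_def .
    have "s * \<epsilon> \<le> 1 * \<epsilon>" using s \<epsilon> by (intro mult_right_mono) auto
    then show "energy (2 * \<epsilon>) \<le> energy (2 * sqrt (1 - t\<^sup>2) * \<epsilon>)"
      unfolding s_def[symmetric] using s \<epsilon> by (intro energy_antimono) (auto simp: mult.assoc)
    show "energy (2 * sqrt (1 - t\<^sup>2) * \<epsilon>) \<le> E"
      unfolding s_def[symmetric] using s \<epsilon> by (intro E) auto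
  qed
  have upper: "f t \<le> g (energy (2 * \<epsilon>)) t" for t
  proof (cases "t \<in> {-1<..<1}")
    case True
    have "energy (2 * \<epsilon>) * (1 - t\<^sup>2) \<le> energy (2 * sqrt (1 - t\<^sup>2) * \<epsilon>) * (1 - t\<^sup>2)"
      using le(1)[OF True] p[OF True] by (intro mult_right_mono) auto
    then have "4 * pi * (energy (2 * \<epsilon>) * (1 - t\<^sup>2)) \<le> 4 * pi * (energy (2 * sqrt (1 - t\<^sup>2) * \<epsilon>) * (1 - t\<^sup>2))"
      by (intro mult_left_mono) auto
    then show ?thesis using True pt[OF True] by (simp add: f_def g_def mult.assoc)
  next
    case False
    then have "f t = 0" by (simp add: f_def)
    \<comment> \<open>At \<open>t = 1\<close> and \<open>t = -1\<close>, included in the support of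
      \<open>g\<close> but not of \<open>f\<close>, both terms of \<open>g\<close> vanish.\<close>
    moreover have "g a t = 0" for a
      using False by (auto simp: g_def indicator_def abs_square_eq_1 power2_eq_1_iff not_less)
    ultimately show ?thesis by simp
  qed
  have lower: "g E t \<le> f t" for t
  proof (cases "t \<in> {-1<..<1}")
    case True
    have "energy (2 * sqrt (1 - t\<^sup>2) * \<epsilon>) * (1 - t\<^sup>2) \<le> E * (1 - t\<^sup>2)"
      using le(2)[OF True] p[OF True] by (intro mult_right_mono) auto
    then have "4 * pi * (energy (2 * sqrt (1 - t\<^sup>2) * \<epsilon>) * (1 - t\<^sup>2)) \<le> 4 * pi * (E * (1 - t\<^sup>2))"
      by (intro mult_left_mono) auto
    then show ?thesis using True pt[OF True] by (simp add: f_def g_def mult.assoc)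
  next
    case False
    then have "f t = 0" by (simp add: f_def)
    moreover have "g a t = 0" for a
      using False by (auto simp: g_def indicator_def abs_square_eq_1 power2_eq_1_iff not_less)
    ultimately show ?thesis by simp
  qed
  have fi: "integrable lborel f"
    by (rule Bochner_Integration.integrable_bound[OF g(1)[of "energy (2 * \<epsilon>)"]]) (use f0 upper in \<open>auto intro!: AE_I2 order_trans[OF _ abs_ge_self]\<close>)
  define I where "I = (LINT t|lborel. f t)"
  have I1: "I \<le> 2 * pi\<^sup>2 * arclength / \<epsilon> - 16 * pi / 3 * energy (2 * \<epsilon>)"
    unfolding I_def g(2)[symmetric] using upper by (intro integral_mono fi g(1))
  have I2: "2 * pi\<^sup>2 * arclength / \<epsilon> - 16 * pi / 3 * E \<le> I"
    unfolding I_def g(2)[symmetric] using lower by (intro integral_mono fi g(1))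
  have sets_eq: "sets circle_measure = sets (borel :: oriented_circle measure)"
  proof -
    have "sets (lborel \<Otimes>\<^sub>M sphere_measure) = sets (borel :: ((real^3) \<times> (real^3)) measure)"
      by (rule trans[OF sets_pair_measure_cong[OF sets_lborel sets_sphere_measure]]) (simp only: borel_prod)
    from sets_pair_measure_cong[OF sets_lborel this]
    have "sets (lborel \<Otimes>\<^sub>M (lborel \<Otimes>\<^sub>M sphere_measure)) = sets (borel :: oriented_circle measure)"
      by (rule trans) (simp only: borel_prod)
    then show ?thesis by (simp only: circle_measure_def sets_density)
  qed
  let ?F = "\<lambda>\<gamma>. indicator (circles_gt \<epsilon>) \<gamma> *\<^sub>R (linking \<gamma>)\<^sup>2"
  have "?F \<in> borel_measurable borel"
    using measurable_linking by measurable
  then have Fm: "?F \<in> borel_measurable circle_measure"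
    by (subst measurable_cong_sets[OF sets_eq refl])
  have nn: "(\<integral>\<^sup>+\<gamma>. ennreal (?F \<gamma>) \<partial>circle_measure) = ennreal I"
  proof -
    have "(\<integral>\<^sup>+\<gamma>. ennreal (?F \<gamma>) \<partial>circle_measure) = (\<integral>\<^sup>+\<gamma>. indicator (circles_gt \<epsilon>) \<gamma> * ennreal ((linking \<gamma>)\<^sup>2) \<partial>circle_measure)"
      by (rule nn_integral_cong) (auto simp: indicator_def)
    also have "\<dots> = (\<integral>\<^sup>+t. ennreal (f t) \<partial>lborel)"
      unfolding nn_integral_linking[OF \<epsilon>] by (rule nn_integral_cong) (auto simp: f_def indicator_def)
    also have "\<dots> = ennreal I"
      unfolding I_def using fi f0 by (intro nn_integral_eq_integral) auto
    finally show ?thesis .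
  qed
  have F0: "?F \<gamma> \<ge> 0" for \<gamma> by simp
  show "set_integrable circle_measure (circles_gt \<epsilon>) (\<lambda>\<gamma>. (linking \<gamma>)\<^sup>2)"
    unfolding set_integrable_def using nn Fm F0 by (intro integrableI_nonneg) auto
  have "I \<ge> 0" unfolding I_def using f0 by simp
  have S: "set_lebesgue_integral circle_measure (circles_gt \<epsilon>) (\<lambda>\<gamma>. (linking \<gamma>)\<^sup>2) = I"
    unfolding set_lebesgue_integral_def using nn Fm F0 \<open>I \<ge> 0\<close> by (subst integral_eq_nn_integral) auto
  \<comment> \<open>Normalizes the weight of the average to one and turns the length term into the
    counterterm of the spatial energy.\<close>
  have k: "3 / (16 * pi) * (2 * pi\<^sup>2 * arclength / \<epsilon> - 16 * pi / 3 * a) = 3 * pi * arclength / (8 * \<epsilon>) - a" for a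
    using \<epsilon> by (simp add: field_simps power2_eq_square)
  have pp: "0 \<le> 3 / (16 * pi)" by simp
  show "3 * pi * arclength / (8 * \<epsilon>) - 3 / (16 * pi) * set_lebesgue_integral circle_measure (circles_gt \<epsilon>) (\<lambda>\<gamma>. (linking \<gamma>)\<^sup>2)
      \<in> {energy (2 * \<epsilon>)..E}"
    using mult_left_mono[OF I1 pp] mult_left_mono[OF I2 pp] unfolding S k by simp
qed

lemma planar_eq_spatial:
  "(\<forall>\<epsilon>>0.
      set_integrable lborel ((\<Omega> \<times> - \<Omega>) - Delta \<epsilon>) (\<lambda>(w, z). 1 / norm (z - w) ^ 4)
    \<and> set_integrable circle_measure (circles_gt \<epsilon>) (\<lambda>\<gamma>. (linking \<gamma>)\<^sup>2))
  \<and> (\<exists>E.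
      ((\<lambda>\<epsilon>. 2 * curve_length m K / \<epsilon>
          - set_lebesgue_integral lborel ((\<Omega> \<times> - \<Omega>) - Delta \<epsilon>) (\<lambda>(w, z). 1 / norm (z - w) ^ 4)) \<longlongrightarrow> E) (at_right 0)
    \<and> ((\<lambda>\<epsilon>. 3 * pi * curve_length m K / (8 * \<epsilon>)
          - 3 / (16 * pi) * set_lebesgue_integral circle_measure (circles_gt \<epsilon>) (\<lambda>\<gamma>. (linking \<gamma>)\<^sup>2)) \<longlongrightarrow> E) (at_right 0))"
proof -
  obtain E where E: "(energy \<longlongrightarrow> E) (at_right 0)" "\<And>\<delta>. 0 < \<delta> \<Longrightarrow> energy \<delta> \<le> E"
    using energy_tendsto by blast
  let ?P = "\<lambda>\<epsilon>. 2 * arclength / \<epsilon> - set_lebesgue_integral lborel ((\<Omega> \<times> - \<Omega>) - Delta \<epsilon>) (\<lambda>(w, z). 1 / norm (z - w) ^ 4)"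
  let ?S = "\<lambda>\<epsilon>. 3 * pi * arclength / (8 * \<epsilon>) - 3 / (16 * pi) * set_lebesgue_integral circle_measure (circles_gt \<epsilon>) (\<lambda>\<gamma>. (linking \<gamma>)\<^sup>2)"
  have pos: "\<forall>\<^sub>F \<epsilon> in at_right (0::real). \<epsilon> > 0" by (rule eventually_at_right_less)
  have "\<forall>\<^sub>F \<epsilon> in at_right 0. energy \<epsilon> = ?P \<epsilon>"
    using pos by eventually_elim (simp add: energy_def set_integrable_planar(2))
  from tendsto_cong[OF this] E(1) have P: "(?P \<longlongrightarrow> E) (at_right 0)" by simp
  have "filterlim (\<lambda>\<epsilon>::real. 2 * \<epsilon>) (at_right 0) (at_right 0)"
    by real_asymp
  from filterlim_compose[OF E(1) this] have E2: "((\<lambda>\<epsilon>. energy (2 * \<epsilon>)) \<longlongrightarrow> E) (at_right 0)" .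
  have S: "(?S \<longlongrightarrow> E) (at_right 0)"
  proof (rule tendsto_sandwich[OF _ _ E2 tendsto_const])
    show "\<forall>\<^sub>F \<epsilon> in at_right 0. energy (2 * \<epsilon>) \<le> ?S \<epsilon>"
      using pos by eventually_elim (use spatial_integral_bounds(2)[OF _ E(2)] in auto)
    show "\<forall>\<^sub>F \<epsilon> in at_right 0. ?S \<epsilon> \<le> E"
      using pos by eventually_elim (use spatial_integral_bounds(2)[OF _ E(2)] in auto)
  qed
  show ?thesis
    unfolding curve_length_eq using P S set_integrable_planar(1) spatial_integral_bounds(1)[OF _ E(2)] by blast
qed

end

theorem corollary5p8:
  fixes m :: nat and K :: "nat \<Rightarrow> real \<Rightarrow> real^2" and \<Omega> :: "(real^2) set"
  assumes "smooth_compact_curve m K"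
    and "bounds_region m K \<Omega>"
  shows "(\<forall>\<epsilon>>0.
            set_integrable lborel ((\<Omega> \<times> - \<Omega>) - Delta \<epsilon>) (\<lambda>(w, z). 1 / norm (z - w) ^ 4)
          \<and> set_integrable circle_measure (circles_gt \<epsilon>)
              (\<lambda>\<gamma>. (circle_linking \<gamma> m (\<lambda>i t. embed_plane (K i t)))\<^sup>2))
    \<and> (\<exists>E.
        ((\<lambda>\<epsilon>. 2 * curve_length m K / \<epsilon>
              - set_lebesgue_integral lborel ((\<Omega> \<times> - \<Omega>) - Delta \<epsilon>)
                  (\<lambda>(w, z). 1 / norm (z - w) ^ 4)) \<longlongrightarrow> E) (at_right 0)
      \<and> ((\<lambda>\<epsilon>. 3 * pi * curve_length m K / (8 * \<epsilon>)
              - 3 / (16 * pi) * set_lebesgue_integral circle_measure (circles_gt \<epsilon>)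
                  (\<lambda>\<gamma>. (circle_linking \<gamma> m (\<lambda>i t. embed_plane (K i t)))\<^sup>2)) \<longlongrightarrow> E) (at_right 0))"
proof -
  define K' where "K' i t = vector_derivative (K i) (at t)" for i t
  define K'' where "K'' i t = vector_derivative (K' i) (at t)" for i t
  have smooth: "(K i has_vector_derivative K' i t) (at t) \<and> (K' i has_vector_derivative K'' i t) (at t) \<and> continuous_on UNIV (K'' i)"
    if i: "i < m" for i t
  proof -
    obtain D where D: "D 0 = K i" "\<And>k t. (D k has_vector_derivative D (Suc k) t) (at t)"
      using assms(1) i unfolding smooth_compact_curve_def smooth_def by blast
    have 1: "K' i = D (Suc 0)"
      using vector_derivative_at[OF D(2)[of 0]] by (auto simp: K'_def D(1))
    have 2: "K'' i = D (Suc (Suc 0))"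
      using vector_derivative_at[OF D(2)[of "Suc 0"]] by (auto simp: K''_def 1)
    \<comment> \<open>The second derivative is continuous because it is itself
      differentiable.\<close>
    have "continuous_on UNIV (D (Suc (Suc 0)))"
      by (rule continuous_at_imp_continuous_on) (auto intro: has_vector_derivative_continuous D(2))
    then show ?thesis using D(2)[of 0] D(2)[of "Suc 0"] by (simp add: 1 2 D(1))
  qed
  interpret planar_domain m K K' K'' \<Omega>
  proof
    show "K i (t + 1) = K i t" if "i < m" for i t
      using assms(1) that by (simp add: smooth_compact_curve_def)
    show "K' i t \<noteq> 0" if "i < m" for i t
      using assms(1) that by (simp add: smooth_compact_curve_def K'_def)
    show "inj_on (\<lambda>(i, t). K i t) ({..<m} \<times> {0..<1})"
      using assms(1) by (simp add: smooth_compact_curve_def)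
  qed (use smooth assms(2) in auto)
  show ?thesis by (rule planar_eq_spatial)
qed

end
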